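(* Suppose that the six standing conditions (quasi-uniform partition, local basis, data generating process, loss function, simplified setup, approximation error) listed in the context hold, that $\mathcal{B}=\{\mathbf b\in\mathbb{R}^K:\|\mathbf b\|_\infty\le R\}$ with $R\ge2\sup_{q\in\mathcal{Q}}\|\boldsymbol\beta_0(q)\|_\infty$ in the definition of $\widehat{\boldsymbol\beta}(q)$ ($R>0$ a fixed constant), that $m>d/2$, and that there exists some constant $c>0$ such that $\inf\Psi_1(\mathbf x,\zeta;q)>c$, where the infimum is over $\mathbf x\in\mathcal{X}$, $q\in\mathcal{Q}$, $\zeta$ between $\eta(\mathbf p(\mathbf x)^\top\boldsymbol\beta)$ and $\eta(\mu_0(\mathbf x,q))$, and $\boldsymbol\beta\in\mathcal{B}$. Furthermore, assume one of the following two conditions holds: (i) $\frac{(\log n)^{\frac{\nu}{\nu-1}}}{nh^{\frac{2\nu}{\nu-1}d}}=o(1)$, or (ii) $\frac{(\log n)^{3/2}}{nh^{2d}}=o(1)$ and $\overline\psi(\mathbf x_i,y_i)$ is sub-Gaussian conditional on $\mathbf x_i$. Then $$\sup_{q\in\mathcal{Q}}\|\widehat{\boldsymbol\beta}(q)-\boldsymbol\beta_0(q)\|=o_{\mathbb P}(1),$$ $$\sup_{\mathbf x\in\mathcal{X}}\sup_{q\in\mathcal{Q}}|\widehat\mu^{(\mathbf v)}(\mathbf x,q)-\mu_0^{(\mathbf v)}(\mathbf x,q)|=o_{\mathbb P}(h^{-|\mathbf v|}),$$ $$\sup_{q\in\mathcal{Q}}\int\big(\widehat\mu^{(\mathbf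 v)}(\mathbf x,q)-\mu_0^{(\mathbf v)}(\mathbf x,q)\big)^2f_X(\mathbf x)\,d\mathbf x=o_{\mathbb P}(h^{d-2|\mathbf v|}).$$
   Context: **Notation.** Limits are as $n\to\infty$; $d,m$ are fixed, while $K,\Delta,\mathbf p,h$ depend on $n$. $a_n\lesssim b_n$ means $\limsup_n|a_n/b_n|<\infty$. $a\wedge b=\min\{a,b\}$, $a\vee b=\max\{a,b\}$. $\|\cdot\|$ and $\|\cdot\|_\infty$ are the Euclidean and max norms of vectors. For a multi-index $\mathbf v$, $|\mathbf v|$ is the sum of its entries and $f^{(\mathbf v)}$ the corresponding partial derivative (in $\mathbf x$ for functions of $(\mathbf x,q)$). A random variable $\xi$ is sub-Gaussian conditional on $\mathbf X$ if for some constant $\sigma^2>0$, $\mathbb P(|\xi|\ge t\mid\mathbf X=\mathbf x)\le2\exp(-t^2/\sigma^2)$ for all $t\ge0$, $\mathbf x\in\mathcal{X}$. A function $f$ is $\alpha$-Hölder on a set if $|f(x_1)-f(x_2)|\le C\|x_1-x_2\|^\alpha$ there for some constant $C>0$. $\mathbf 1(\cdot)$ is the indicator. **Setting.** $(y_1,\mathbf x_1),\dots,(y_n,\mathbf x_n)$ are i.i.d. copies of $(Y,\mathbf X)\in\mathcal{Y}\times\mathcal{X}\subseteq\mathbb{R}\times\mathbb{R}^d$. The loss is $\rho:\mathcal{Y}\times\mathcal{E}\times\mathcal{Q}\to\mathbb{R}$ with $\mathcal{E}\subseteq\mathbb{R}$ open connected and $\mathcal{Q}\subseteq\mathbb{R}$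 connected compact; $\eta:\mathbb{R}\to\mathcal{E}$ is strictly monotonic. The parameter $\mu_0:\mathcal{X}\times\mathcal{Q}\to\mathbb{R}$ satisfies $$\mu_0(\cdot,q)\in\arg\min_{\mu}\mathbb{E}[\rho(y_i,\eta(\mu(\mathbf x_i));q)]\qquad(\ast)$$ over measurable $\mu:\mathcal{X}\to\mathbb{R}$ (the (local) minimum is assumed achieved). The estimator is $\widehat\mu(\mathbf x,q)=\mathbf p(\mathbf x)^\top\widehat{\boldsymbol\beta}(q)$, $\widehat{\boldsymbol\beta}(q)\in\arg\min_{\mathbf b\in\mathcal{B}}\sum_{i=1}^n\rho(y_i,\eta(\mathbf p(\mathbf x_i)^\top\mathbf b);q)$, with $\mathcal{B}\subseteq\mathbb{R}^K$ the feasible set, and $\widehat\mu^{(\mathbf v)}(\mathbf x,q)=\mathbf p^{(\mathbf v)}(\mathbf x)^\top\widehat{\boldsymbol\beta}(q)$. Here $\mathbf p=(p_1,\dots,p_K)^\top$ is a dictionary of $K$ locally supported basis functions of order $m$ based on a partition $\Delta=\{\delta_l:1\le l\le\kappa\}$ of open disjoint polyhedra in $\mathcal{X}$ such that the closure of their union covers $\mathcal{X}$. **Quasi-uniform partition.** The ratio of the sizes of inscribed and circumscribed balls of each $\delta\in\Delta$ is bounded away from zero uniformly in $\delta\in\Delta$, and $\max_{\delta\in\Delta}\mathrm{diam}(\delta)/\min_{\delta\in\Delta}\mathrm{diam}(\delta)\lesssim1$. With $h=\max_{\delta\in\Delta}\mathrm{diam}(\delta)$: $h=o(1)$ and $\log(1/h)\lesssim\log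 n$. **Local basis.** (A function is active on $\delta$ if it is not identically zero on $\delta$.) (i) For each $k$, the union of elements of $\Delta$ on which $p_k$ is active is a connected set, denoted $\mathcal{H}_k$; for all $k$, both the number of elements of $\Delta$ in $\mathcal{H}_k$ and the number of basis functions active on $\mathcal{H}_k$ are bounded by a constant. (ii) For any $\mathbf a=(a_1,\dots,a_K)^\top\in\mathbb{R}^K$, $a_k^2h^d\lesssim\mathbf a^\top\int_{\mathcal{H}_k}\mathbf p(\mathbf x)\mathbf p(\mathbf x)^\top d\mathbf x\,\mathbf a$ for $k=1,\dots,K$. (iii) $|\mathbf v|<m$, and there is an integer $\varsigma\in[|\mathbf v|,m)$ such that for all multi-indices $\boldsymbol\varsigma$ with $|\boldsymbol\varsigma|\le\varsigma$, $h^{-|\boldsymbol\varsigma|}\lesssim\inf_{\delta\in\Delta}\inf_{\mathbf x\in\mathrm{cl}(\delta)}\|\mathbf p^{(\boldsymbol\varsigma)}(\mathbf x)\|\le\sup_{\delta\in\Delta}\sup_{\mathbf x\in\mathrm{cl}(\delta)}\|\mathbf p^{(\boldsymbol\varsigma)}(\mathbf x)\|\lesssim h^{-|\boldsymbol\varsigma|}$, $\mathrm{cl}$ denoting closure. **Data generating process.** (i) $((y_i,\mathbf x_i):1\le i\le n)$ is a random sample satisfying $(\ast)$. (ii) $\mathbf x_i$ has a Lebesgue density $f_X$ that is continuous and bounded away from zero on its support $\mathcal{X}\subset\mathbb{R}^d$, where $\mathcal{X}$ is the closure of an open, connected and bounded set. (iii) The conditional distribution of $y_i$ given $\mathbf x_i$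 has a conditional density $f_{Y|X}(y|\mathbf x)$ with support $\mathcal{Y}_{\mathbf x}$ with respect to some sigma-finite measure $\mathfrak{M}$, and $\sup_{\mathbf x\in\mathcal{X}}\sup_{y\in\mathcal{Y}_{\mathbf x}}f_{Y|X}(y|\mathbf x)<\infty$. (iv) $\mathbf x\mapsto\mu_0(\mathbf x,q)$ is $m\ge1$ times continuously differentiable for every $q\in\mathcal{Q}$; $\mu_0(\cdot,q)$ and its derivatives of order at most $m$ are bounded uniformly over $(\mathbf x,q)\in\mathcal{X}\times\mathcal{Q}$; and $\sup_{\mathbf x\in\mathcal{X}}\sup_{q_1\ne q_2}|\mu_0(\mathbf x,q_1)-\mu_0(\mathbf x,q_2)|/|q_1-q_2|\lesssim1$. **Loss function.** Let $B_q(\mathbf x)=\{\zeta:|\zeta-\mu_0(\mathbf x,q)|\le r\}$ for some fixed (small enough) constant $r>0$. (i) $\mathcal{Q}\subseteq\mathbb{R}$ is connected compact; for each $q\in\mathcal{Q}$, $y\in\mathcal{Y}$ and some open connected $\mathcal{E}\subseteq\mathbb{R}$ not depending on $y$, $\eta\mapsto\rho(y,\eta;q)$ is absolutely continuous on closed bounded intervals within $\mathcal{E}$ and admits an a.e. derivative $\psi(y,\eta;q)$. (ii) $\mathbb{E}[\psi(y_i,\eta(\mu_0(\mathbf x_i,q));q)|\mathbf x_i]=0$; the function $\mathbb{E}[\psi(y_i,\eta(\mu_0(\mathbf x_i,q));q)^2|\mathbf x_i=\mathbf x]$ is continuous in both arguments $(\mathbf x,q)\in\mathcal{X}\times\mathcal{Q}$,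 bounded away from zero, and Lipschitz in $q$ uniformly in $\mathbf x$; there is a positive measurable envelope $\overline\psi(\mathbf x_i,y_i)$ with $\sup_{q\in\mathcal{Q}}|\psi(y_i,\eta(\mu_0(\mathbf x_i,q));q)|\le\overline\psi(\mathbf x_i,y_i)$ and $\sup_{\mathbf x\in\mathcal{X}}\mathbb{E}[\overline\psi(\mathbf x_i,y_i)^\nu|\mathbf x_i=\mathbf x]<\infty$ for some $\nu>2$. (iii) $\eta(\cdot)$ is strictly monotonic and twice continuously differentiable; for some fixed $\alpha\in(0,1]$, any $(\mathbf x,q)\in\mathcal{X}\times\mathcal{Q}$ and $\zeta_1,\zeta_2\in B_q(\mathbf x)$ (constants in $\lesssim$ not depending on $\mathbf x,q,\zeta_1,\zeta_2$): if $\mathfrak{M}$ is Lebesgue measure, with $I=[\eta(\zeta_1)\wedge\eta(\zeta_2),\eta(\zeta_1)\vee\eta(\zeta_2)]$, $$\sup_{\lambda\in[0,1]}\sup_{y\notin I}|\psi(y,\eta(\zeta_1+\lambda(\zeta_2-\zeta_1));q)-\psi(y,\eta(\zeta_2);q)|\lesssim|\zeta_1-\zeta_2|^\alpha,$$ $$\sup_{\lambda\in[0,1]}\sup_{y\in I}|\psi(y,\eta(\zeta_1+\lambda(\zeta_2-\zeta_1));q)-\psi(y,\eta(\zeta_2);q)|\lesssim1;$$ if $\mathfrak{M}$ is not Lebesgue measure, $\sup_{\lambda\in[0,1]}\sup_{y\in\mathcal{Y}}|\psi(y,\eta(\zeta_1+\lambda(\zeta_2-\zeta_1));q)-\psi(y,\eta(\zeta_2);q)|\lesssim|\zeta_1-\zeta_2|^\alpha$.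 (iv) $\Psi(\mathbf x,\eta;q)=\mathbb{E}[\psi(y_i,\eta;q)|\mathbf x_i=\mathbf x]$ is twice continuously differentiable in $\eta$; with $\Psi_k=\frac{\partial^k}{\partial\eta^k}\Psi$, $\sup_{\mathbf x\in\mathcal{X},q\in\mathcal{Q}}\sup_{\zeta\in B_q(\mathbf x)}|\Psi_k(\mathbf x,\eta(\zeta);q)|<\infty$ for $k=1,2$, and $\inf_{\mathbf x\in\mathcal{X},q\in\mathcal{Q}}\inf_{\zeta\in B_q(\mathbf x)}\Psi_1(\mathbf x,\eta(\zeta);q)(\eta^{(1)}(\zeta))^2>0$. **Simplified setup.** (i) $q\mapsto\mu_0(\mathbf x,q)$ is non-decreasing. (ii) $\rho(y,\eta;q)=\sum_{j=1}^4\rho_j(y,\eta;q)$ with $\rho_1=(f_1(y)+D_1\eta)\mathbf 1(y\le\eta)$, $\rho_2=(f_2(y)+D_2\eta)\mathbf 1(y\le q)$, $\rho_3=(f_3(y)+D_3\eta)q$, $\rho_4=\mathcal{T}(y,\eta)$, where $f_j$ are fixed continuous functions, $D_j$ universal constants, $\mathcal{T}$ a fixed continuous function. (iii) With $\tau(y,\eta)=\frac{\partial}{\partial\eta}\mathcal{T}(y,\eta)$, $\eta\mapsto\mathbb{E}[\tau(y_i,\eta)|\mathbf x_i=\mathbf x]$ is differentiable, and $\tau(y,\eta)$ and $\frac{\partial}{\partial\eta}\mathbb{E}[\tau(y_i,\eta)|\mathbf x_i=\mathbf x]$ are continuous in their arguments and $\alpha$-Hölder continuous ($\alpha\in(0,1]$)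 in $\eta$ for $\eta$ in any fixed compact subset of $\mathcal{E}$, with Hölder constants independent of $(y,\mathbf x)$. (iv) $\sup_{q\in\mathcal{Q}}|\tau(y,\eta(\mu_0(\mathbf x,q)))|\le\bar\tau(\mathbf x,y)$ with $\sup_{\mathbf x\in\mathcal{X}}\mathbb{E}[\bar\tau(\mathbf x_i,y_i)^\nu|\mathbf x_i=\mathbf x]<\infty$ for some $\nu>2$. (v) If $D_1\ne0$, then $F_{Y|X}$ is differentiable with Lebesgue density $f_{Y|X}$, $f_{Y|X}$ is continuous in both arguments, and $y\mapsto f_{Y|X}(y|\mathbf x)$ is continuously differentiable. **Approximation error.** There exists $\boldsymbol\beta_0(q)\in\mathbb{R}^K$ such that for all $\boldsymbol\varsigma$ with $|\boldsymbol\varsigma|\le\varsigma$ ($\varsigma$ from the local basis condition), $\sup_{q\in\mathcal{Q}}\sup_{\mathbf x\in\mathcal{X}}|\mu_0^{(\boldsymbol\varsigma)}(\mathbf x,q)-\boldsymbol\beta_0(q)^\top\mathbf p^{(\boldsymbol\varsigma)}(\mathbf x)|\lesssim h^{m-|\boldsymbol\varsigma|}$. The symbols $\alpha$, $\nu$ denote the constants in these conditions. *)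

theory Defs
  imports "HOL-Probability.Probability" "HOL-Library.Landau_Symbols"
begin

(* Conventions.  The covariate space is real^'d, so the dimension is CARD('d).  All objects that
   depend on the sample size carry it as a nat argument n.  The sample is indexed from 0, so the
   sample of size n is (ys i, xs i) for i < n.  Vectors in R^K are functions nat => real of which
   only the entries k < K matter.  An asymptotic bound that holds uniformly in further parameters
   is written with one constant and "eventually in n". *)

section \<open>Vectors, multi-indices, smoothness\<close>

definition max_norm :: "nat \<Rightarrow> (nat \<Rightarrow> real) \<Rightarrow> real" where
  "max_norm K b = Max (insert 0 ((\<lambda>k. \<bar>b k\<bar>) ` {..<K}))"

definition eucl_norm :: "nat \<Rightarrow> (nat \<Rightarrow> real) \<Rightarrow> real" where
  "eucl_norm K b = L2_set b {..<K}"

definition dot :: "nat \<Rightarrow> (nat \<Rightarrow> real) \<Rightarrow> (nat \<Rightarrow> real) \<Rightarrow> real" where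
  "dot K a b = (\<Sum>k<K. a k * b k)"

definition mi_order :: "('d::finite \<Rightarrow> nat) \<Rightarrow> nat" where
  "mi_order s = (\<Sum>i\<in>UNIV. s i)"

(* D lists the partial derivatives of f up to order k: they are classical partial derivatives in
   the interior of S and continuous on S.  If S is contained in the closure of its interior, this
   determines D s on S for mi_order s <= k: at boundary points the derivatives are the continuous
   extensions from the interior. *)
definition partials_upto ::
    "nat \<Rightarrow> (real^'d) set \<Rightarrow> (real^'d \<Rightarrow> real) \<Rightarrow> (('d::finite \<Rightarrow> nat) \<Rightarrow> real^'d \<Rightarrow> real) \<Rightarrow> bool" where
  "partials_upto k S f D \<longleftrightarrow>
     (\<forall>x\<in>S. D (\<lambda>_. 0) x = f x) \<and>
     (\<forall>s. mi_order s \<le> k \<longrightarrow> continuous_on S (D s)) \<and>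
     (\<forall>s i. mi_order s < k \<longrightarrow> (\<forall>x\<in>interior S.
        ((\<lambda>t. D s (x + t *\<^sub>R axis i 1)) has_real_derivative D (s(i := Suc (s i))) x) (at 0)))"

definition abs_continuous_on_interval :: "real \<Rightarrow> real \<Rightarrow> (real \<Rightarrow> real) \<Rightarrow> bool" where
  "abs_continuous_on_interval a b f \<longleftrightarrow>
     (\<forall>\<epsilon>>0. \<exists>\<delta>>0. \<forall>(N::nat) (l::nat \<Rightarrow> real) (u::nat \<Rightarrow> real).
        (\<forall>i<N. a \<le> l i \<and> l i \<le> u i \<and> u i \<le> b) \<and>
        disjoint_family_on (\<lambda>i. {l i<..<u i}) {..<N} \<and>
        (\<Sum>i<N. u i - l i) < \<delta> \<longrightarrow>
        (\<Sum>i<N. \<bar>f (u i) - f (l i)\<bar>) < \<epsilon>)"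

(* Only used for open U. *)
definition twice_cont_diff_on :: "real set \<Rightarrow> (real \<Rightarrow> real) \<Rightarrow> bool" where
  "twice_cont_diff_on U f \<longleftrightarrow>
     (\<forall>z\<in>U. f field_differentiable (at z) \<and> deriv f field_differentiable (at z)) \<and>
     continuous_on U ((deriv ^^ 2) f)"


section \<open>Stochastic order\<close>

(* Z n = o_P(a n) for positive a.  The events need not be measurable (suprema over uncountable
   sets, arbitrary selections of minimisers), so the outer probability is used; it agrees with the
   probability on measurable events. *)
definition small_oP :: "'w measure \<Rightarrow> (nat \<Rightarrow> 'w \<Rightarrow> ennreal) \<Rightarrow> (nat \<Rightarrow> real) \<Rightarrow> bool" where
  "small_oP M Z a \<longleftrightarrow>
     (\<forall>\<epsilon>>0. (\<lambda>n. outer_measure_of M {\<omega>\<in>space M. Z n \<omega> > ennreal (\<epsilon> * a n)}) \<longlonglongrightarrow> 0)"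


section \<open>Conditional distributions\<close>

(* Throughout, fYX x y is the conditional density of Y at y given X = x, with respect to the
   sigma-finite measure N on the real line; it vanishes off the support. *)

definition cond_support :: "(real^'d \<Rightarrow> real \<Rightarrow> real) \<Rightarrow> real^'d \<Rightarrow> real set" where
  "cond_support fYX x = {y. fYX x y \<noteq> 0}"

(* E[g(Y) | X = x].  The density is kept inside the integrand because g may be specified only on
   the range of Y. *)
definition cond_expect ::
    "real measure \<Rightarrow> (real^'d \<Rightarrow> real \<Rightarrow> real) \<Rightarrow> (real \<Rightarrow> real) \<Rightarrow> real^'d \<Rightarrow> real" where
  "cond_expect N fYX g x = (\<integral>y. g y * fYX x y \<partial>N)"

definition cond_integrable ::
    "real measure \<Rightarrow> (real^'d \<Rightarrow> real \<Rightarrow> real) \<Rightarrow> (real \<Rightarrow> real) \<Rightarrow> real^'d \<Rightarrow> bool" where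
  "cond_integrable N fYX g x \<longleftrightarrow> integrable N (\<lambda>y. g y * fYX x y)"

(* E[g(Y) | X = x] in [0, infinity] for nonnegative g. *)
definition cond_nn_expect ::
    "real measure \<Rightarrow> (real^'d \<Rightarrow> real \<Rightarrow> real) \<Rightarrow> (real \<Rightarrow> real) \<Rightarrow> real^'d \<Rightarrow> ennreal" where
  "cond_nn_expect N fYX g x = (\<integral>\<^sup>+y. ennreal (g y * fYX x y) \<partial>N)"

definition cond_cdf ::
    "real measure \<Rightarrow> (real^'d \<Rightarrow> real \<Rightarrow> real) \<Rightarrow> real^'d \<Rightarrow> real \<Rightarrow> real" where
  "cond_cdf N fYX x = cdf (density N (\<lambda>y. ennreal (fYX x y)))"

(* The random variable z(X, Y) is sub-Gaussian conditional on X. *)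
definition cond_sub_gaussian ::
    "real measure \<Rightarrow> (real^'d \<Rightarrow> real \<Rightarrow> real) \<Rightarrow> (real^'d) set \<Rightarrow> (real^'d \<Rightarrow> real \<Rightarrow> real) \<Rightarrow> bool" where
  "cond_sub_gaussian N fYX Xs z \<longleftrightarrow>
     (\<exists>sigma2>0. \<forall>x\<in>Xs. \<forall>t\<ge>0.
        cond_nn_expect N fYX (\<lambda>y. of_bool (\<bar>z x y\<bar> \<ge> t)) x \<le> ennreal (2 * exp (- t\<^sup>2 / sigma2)))"

definition Psi ::
    "real measure \<Rightarrow> (real^'d \<Rightarrow> real \<Rightarrow> real) \<Rightarrow> (real \<Rightarrow> real \<Rightarrow> real \<Rightarrow> real) \<Rightarrow>
     real^'d \<Rightarrow> real \<Rightarrow> real \<Rightarrow> real" where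
  "Psi N fYX psi x e q = cond_expect N fYX (\<lambda>y. psi y e q) x"

definition Psi_deriv ::
    "nat \<Rightarrow> real measure \<Rightarrow> (real^'d \<Rightarrow> real \<Rightarrow> real) \<Rightarrow> (real \<Rightarrow> real \<Rightarrow> real \<Rightarrow> real) \<Rightarrow>
     real^'d \<Rightarrow> real \<Rightarrow> real \<Rightarrow> real" where
  "Psi_deriv k N fYX psi x e q = (deriv ^^ k) (\<lambda>e. Psi N fYX psi x e q) e"


section \<open>Partitions\<close>

(* The library's polyhedra are convex; here cells are interiors of finite unions of those. *)
definition open_polyhedron :: "(real^'d) set \<Rightarrow> bool" where
  "open_polyhedron S \<longleftrightarrow> (\<exists>F. finite F \<and> (\<forall>P\<in>F. polyhedron P) \<and> S = interior (\<Union>F))"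

definition polyhedral_partition :: "(real^'d) set \<Rightarrow> (real^'d) set set \<Rightarrow> bool" where
  "polyhedral_partition Xs \<Delta> \<longleftrightarrow>
     finite \<Delta> \<and> \<Delta> \<noteq> {} \<and>
     (\<forall>\<delta>\<in>\<Delta>. open_polyhedron \<delta> \<and> \<delta> \<noteq> {} \<and> \<delta> \<subseteq> Xs) \<and>
     disjoint \<Delta> \<and> Xs \<subseteq> closure (\<Union>\<Delta>)"

definition inscribed_radius :: "(real^'d) set \<Rightarrow> real" where
  "inscribed_radius S = Sup {r. \<exists>c. ball c r \<subseteq> S}"

definition circumscribed_radius :: "(real^'d) set \<Rightarrow> real" where
  "circumscribed_radius S = Inf {r. \<exists>c. S \<subseteq> cball c r}"

definition mesh :: "(real^'d) set set \<Rightarrow> real" where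
  "mesh \<Delta> = Max (diameter ` \<Delta>)"

definition quasi_uniform_partition :: "(nat \<Rightarrow> (real^'d) set set) \<Rightarrow> bool" where
  "quasi_uniform_partition \<Delta> \<longleftrightarrow>
     (\<exists>c>0. \<forall>n. \<forall>\<delta>\<in>\<Delta> n. c \<le> inscribed_radius \<delta> / circumscribed_radius \<delta>) \<and>
     (\<lambda>n. Max (diameter ` \<Delta> n) / Min (diameter ` \<Delta> n)) \<in> O(\<lambda>_. 1) \<and>
     (\<lambda>n. mesh (\<Delta> n)) \<in> o(\<lambda>_. 1) \<and>
     (\<lambda>n. ln (1 / mesh (\<Delta> n))) \<in> O(\<lambda>n. ln (real n))"


section \<open>Basis functions\<close>

definition active_on :: "(real^'d \<Rightarrow> real) \<Rightarrow> (real^'d) set \<Rightarrow> bool" where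
  "active_on f S \<longleftrightarrow> (\<exists>x\<in>S. f x \<noteq> 0)"

definition active_cells :: "(real^'d) set set \<Rightarrow> (real^'d \<Rightarrow> real) \<Rightarrow> (real^'d) set set" where
  "active_cells \<Delta> f = {\<delta>\<in>\<Delta>. active_on f \<delta>}"

definition active_region :: "(real^'d) set set \<Rightarrow> (real^'d \<Rightarrow> real) \<Rightarrow> (real^'d) set" where
  "active_region \<Delta> f = \<Union>(active_cells \<Delta> f)"

(* p n k is the k-th basis function and dp n s k its partial derivative of multi-index s, up to
   order sg.  Basis functions are piecewise smooth: inside each cell dp is the classical derivative.
   On the boundaries between cells the derivatives may be multi-valued, and dp there is an arbitrary
   choice of values, restricted only by the bounds in local_basis (and by approximation_error). *)
definition cellwise_partials ::
    "(real^'d) set \<Rightarrow> (nat \<Rightarrow> (real^'d) set set) \<Rightarrow> (nat \<Rightarrow> nat) \<Rightarrow> (nat \<Rightarrow> nat \<Rightarrow> real^'d \<Rightarrow> real) \<Rightarrow>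
     (nat \<Rightarrow> ('d::finite \<Rightarrow> nat) \<Rightarrow> nat \<Rightarrow> real^'d \<Rightarrow> real) \<Rightarrow> nat \<Rightarrow> bool" where
  "cellwise_partials Xs \<Delta> K p dp sg \<longleftrightarrow>
     (\<forall>n. \<forall>k<K n.
        (\<forall>x\<in>Xs. dp n (\<lambda>_. 0) k x = p n k x) \<and>
        (\<forall>\<delta>\<in>\<Delta> n. partials_upto sg \<delta> (p n k) (\<lambda>s. dp n s k)))"

(* The cells are open and disjoint, so "the union of the active cells is connected" can only be
   meant up to the common boundaries, that is, for the closure of the union. *)
definition local_basis ::
    "(real^'d) set \<Rightarrow> (nat \<Rightarrow> (real^'d) set set) \<Rightarrow> (nat \<Rightarrow> nat) \<Rightarrow> (nat \<Rightarrow> nat \<Rightarrow> real^'d \<Rightarrow> real) \<Rightarrow>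
     (nat \<Rightarrow> ('d::finite \<Rightarrow> nat) \<Rightarrow> nat \<Rightarrow> real^'d \<Rightarrow> real) \<Rightarrow> ('d \<Rightarrow> nat) \<Rightarrow> nat \<Rightarrow> nat \<Rightarrow> bool" where
  "local_basis Xs \<Delta> K p dp v m sg \<longleftrightarrow>
     cellwise_partials Xs \<Delta> K p dp sg \<and>
     (\<forall>n. \<forall>k<K n. connected (closure (active_region (\<Delta> n) (p n k)))) \<and>
     (\<exists>C. \<forall>n. \<forall>k<K n.
        card (active_cells (\<Delta> n) (p n k)) \<le> C \<and>
        card {j\<in>{..<K n}. active_on (p n j) (active_region (\<Delta> n) (p n k))} \<le> C) \<and>
     (\<exists>C. eventually (\<lambda>n. \<forall>a. \<forall>k<K n.
        (a k)\<^sup>2 * mesh (\<Delta> n) ^ CARD('d) \<le>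
        C * (\<Sum>i<K n. \<Sum>j<K n.
               a i * (LINT x:active_region (\<Delta> n) (p n k)|lborel. p n i x * p n j x) * a j))
       sequentially) \<and>
     mi_order v < m \<and> mi_order v \<le> sg \<and> sg < m \<and>
     (\<forall>s. mi_order s \<le> sg \<longrightarrow>
       (\<exists>c>0. \<exists>C. eventually (\<lambda>n. \<forall>\<delta>\<in>\<Delta> n. \<forall>x\<in>closure \<delta>.
          c * mesh (\<Delta> n) powi (- int (mi_order s)) \<le> eucl_norm (K n) (\<lambda>k. dp n s k x) \<and>
          eucl_norm (K n) (\<lambda>k. dp n s k x) \<le> C * mesh (\<Delta> n) powi (- int (mi_order s)))
         sequentially))"


section \<open>Data generating process\<close>

(* mu0 ( . , q) minimises the expected loss.  The minimum is allowed to be local in the sup norm (a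
   global minimum is a special case); competitors for which the expected loss does not exist are
   disregarded. *)
definition population_minimizer ::
    "'w measure \<Rightarrow> (real^'d) set \<Rightarrow> real set \<Rightarrow> (nat \<Rightarrow> 'w \<Rightarrow> real^'d) \<Rightarrow> (nat \<Rightarrow> 'w \<Rightarrow> real) \<Rightarrow>
     (real \<Rightarrow> real \<Rightarrow> real \<Rightarrow> real) \<Rightarrow> (real \<Rightarrow> real) \<Rightarrow> (real^'d \<Rightarrow> real \<Rightarrow> real) \<Rightarrow> bool" where
  "population_minimizer M Xs Qs xs ys rho eta mu0 \<longleftrightarrow>
     (\<forall>q\<in>Qs. \<forall>i.
        (\<lambda>x. mu0 x q) \<in> borel_measurable (restrict_space borel Xs) \<and>
        integrable M (\<lambda>\<omega>. rho (ys i \<omega>) (eta (mu0 (xs i \<omega>) q)) q) \<and>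
        (\<exists>\<epsilon>>0. \<forall>mu \<in> borel_measurable (restrict_space borel Xs).
           (\<forall>x\<in>Xs. \<bar>mu x - mu0 x q\<bar> < \<epsilon>) \<and>
           integrable M (\<lambda>\<omega>. rho (ys i \<omega>) (eta (mu (xs i \<omega>))) q) \<longrightarrow>
           (\<integral>\<omega>. rho (ys i \<omega>) (eta (mu0 (xs i \<omega>) q)) q \<partial>M)
             \<le> (\<integral>\<omega>. rho (ys i \<omega>) (eta (mu (xs i \<omega>))) q \<partial>M)))"

definition random_sample ::
    "'w measure \<Rightarrow> (real^'d) set \<Rightarrow> real set \<Rightarrow> (nat \<Rightarrow> 'w \<Rightarrow> real^'d) \<Rightarrow> (nat \<Rightarrow> 'w \<Rightarrow> real) \<Rightarrow>
     real measure \<Rightarrow> (real^'d \<Rightarrow> real) \<Rightarrow> (real^'d \<Rightarrow> real \<Rightarrow> real) \<Rightarrow> bool" where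
  "random_sample M Xs Ys xs ys N fX fYX \<longleftrightarrow>
     prob_space M \<and>
     (\<forall>i. \<forall>\<omega>\<in>space M. xs i \<omega> \<in> Xs \<and> ys i \<omega> \<in> Ys) \<and>
     prob_space.indep_vars M (\<lambda>_. borel \<Otimes>\<^sub>M borel) (\<lambda>i \<omega>. (xs i \<omega>, ys i \<omega>)) UNIV \<and>
     (\<forall>i. distributed M lborel (xs i) (\<lambda>x. ennreal (fX x))) \<and>
     (\<forall>i. distributed M (lborel \<Otimes>\<^sub>M N) (\<lambda>\<omega>. (xs i \<omega>, ys i \<omega>))
            (\<lambda>(x, y). ennreal (fX x * fYX x y)))"

definition data_generating_process ::
    "'w measure \<Rightarrow> (real^'d::finite) set \<Rightarrow> real set \<Rightarrow> real set \<Rightarrow>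
     (nat \<Rightarrow> 'w \<Rightarrow> real^'d) \<Rightarrow> (nat \<Rightarrow> 'w \<Rightarrow> real) \<Rightarrow>
     real measure \<Rightarrow> (real^'d \<Rightarrow> real) \<Rightarrow> (real^'d \<Rightarrow> real \<Rightarrow> real) \<Rightarrow>
     (real \<Rightarrow> real \<Rightarrow> real \<Rightarrow> real) \<Rightarrow> (real \<Rightarrow> real) \<Rightarrow> (real^'d \<Rightarrow> real \<Rightarrow> real) \<Rightarrow>
     (('d \<Rightarrow> nat) \<Rightarrow> real^'d \<Rightarrow> real \<Rightarrow> real) \<Rightarrow> nat \<Rightarrow> bool" where
  "data_generating_process M Xs Ys Qs xs ys N fX fYX rho eta mu0 dmu0 m \<longleftrightarrow>
     random_sample M Xs Ys xs ys N fX fYX \<and>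
     population_minimizer M Xs Qs xs ys rho eta mu0 \<and>
     (\<exists>U. open U \<and> connected U \<and> bounded U \<and> Xs = closure U) \<and>
     (\<forall>x. 0 \<le> fX x) \<and> (\<forall>x. x \<notin> Xs \<longrightarrow> fX x = 0) \<and>
     continuous_on Xs fX \<and> (\<exists>c>0. \<forall>x\<in>Xs. c \<le> fX x) \<and>
     sigma_finite_measure N \<and> sets N = sets borel \<and>
     (\<forall>x\<in>Xs. fYX x \<in> borel_measurable borel \<and> (\<forall>y. 0 \<le> fYX x y) \<and>
        (\<integral>\<^sup>+y. ennreal (fYX x y) \<partial>N) = 1 \<and> cond_support fYX x \<subseteq> Ys) \<and>
     (\<exists>C. \<forall>x\<in>Xs. \<forall>y\<in>cond_support fYX x. fYX x y \<le> C) \<and>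
     m \<ge> 1 \<and>
     (\<forall>q\<in>Qs. partials_upto m Xs (\<lambda>x. mu0 x q) (\<lambda>s x. dmu0 s x q)) \<and>
     (\<forall>s. mi_order s \<le> m \<longrightarrow> (\<exists>C. \<forall>x\<in>Xs. \<forall>q\<in>Qs. \<bar>dmu0 s x q\<bar> \<le> C)) \<and>
     (\<exists>C. \<forall>x\<in>Xs. \<forall>q1\<in>Qs. \<forall>q2\<in>Qs. q1 \<noteq> q2 \<longrightarrow>
        \<bar>mu0 x q1 - mu0 x q2\<bar> / \<bar>q1 - q2\<bar> \<le> C)"


section \<open>Loss function\<close>

(* psi is one fixed version of the a.e. derivative of rho in eta; its joint measurability in
   (y, eta), and the existence of the expectation that defines Psi, are part of the meaning of the
   conditional expectations. *)
definition loss_function ::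
    "(real^'d) set \<Rightarrow> real set \<Rightarrow> real set \<Rightarrow> real set \<Rightarrow>
     real measure \<Rightarrow> (real^'d \<Rightarrow> real \<Rightarrow> real) \<Rightarrow>
     (real \<Rightarrow> real \<Rightarrow> real \<Rightarrow> real) \<Rightarrow> (real \<Rightarrow> real \<Rightarrow> real \<Rightarrow> real) \<Rightarrow> (real^'d \<Rightarrow> real \<Rightarrow> real) \<Rightarrow>
     (real \<Rightarrow> real) \<Rightarrow> (real^'d \<Rightarrow> real \<Rightarrow> real) \<Rightarrow> real \<Rightarrow> real \<Rightarrow> bool" where
  "loss_function Xs Ys Es Qs N fYX rho psi psibar eta mu0 \<alpha> \<nu> \<longleftrightarrow>
     connected Qs \<and> compact Qs \<and> open Es \<and> connected Es \<and>
     (\<forall>q\<in>Qs. \<forall>y\<in>Ys.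
        (\<forall>a b. a \<le> b \<and> {a..b} \<subseteq> Es \<longrightarrow> abs_continuous_on_interval a b (\<lambda>e. rho y e q)) \<and>
        (AE e in lborel. e \<in> Es \<longrightarrow> ((\<lambda>e. rho y e q) has_real_derivative psi y e q) (at e))) \<and>
     (\<forall>q\<in>Qs. (\<lambda>(y, e). psi y e q) \<in> borel_measurable (restrict_space borel (Ys \<times> Es))) \<and>
     (\<forall>x\<in>Xs. \<forall>q\<in>Qs. cond_expect N fYX (\<lambda>y. psi y (eta (mu0 x q)) q) x = 0) \<and>
     (let sigma2 = (\<lambda>x q. cond_expect N fYX (\<lambda>y. (psi y (eta (mu0 x q)) q)\<^sup>2) x) in
        continuous_on (Xs \<times> Qs) (\<lambda>(x, q). sigma2 x q) \<and>
        (\<exists>c>0. \<forall>x\<in>Xs. \<forall>q\<in>Qs. c \<le> sigma2 x q) \<and>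
        (\<exists>L. \<forall>x\<in>Xs. \<forall>q1\<in>Qs. \<forall>q2\<in>Qs. \<bar>sigma2 x q1 - sigma2 x q2\<bar> \<le> L * \<bar>q1 - q2\<bar>)) \<and>
     (\<lambda>(x, y). psibar x y) \<in> borel_measurable (restrict_space borel (Xs \<times> Ys)) \<and>
     (\<forall>x\<in>Xs. \<forall>y\<in>Ys. 0 < psibar x y \<and> (\<forall>q\<in>Qs. \<bar>psi y (eta (mu0 x q)) q\<bar> \<le> psibar x y)) \<and>
     \<nu> > 2 \<and>
     (\<exists>C. \<forall>x\<in>Xs. cond_nn_expect N fYX (\<lambda>y. psibar x y powr \<nu>) x \<le> ennreal C) \<and>
     range eta \<subseteq> Es \<and> (strict_mono eta \<or> strict_antimono_on UNIV eta) \<and>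
     twice_cont_diff_on UNIV eta \<and>
     0 < \<alpha> \<and> \<alpha> \<le> 1 \<and>
     (\<exists>r>0.
       (let B = (\<lambda>x q. {z. \<bar>z - mu0 x q\<bar> \<le> r});
            incr = (\<lambda>y z1 z2 l q. \<bar>psi y (eta (z1 + l * (z2 - z1))) q - psi y (eta z2) q\<bar>);
            I = (\<lambda>z1 z2. {min (eta z1) (eta z2) .. max (eta z1) (eta z2)}) in
         (N = lborel \<longrightarrow>
           (\<exists>C. \<forall>x\<in>Xs. \<forall>q\<in>Qs. \<forall>z1\<in>B x q. \<forall>z2\<in>B x q. \<forall>l\<in>{0..1}.
              (\<forall>y\<in>Ys - I z1 z2. incr y z1 z2 l q \<le> C * \<bar>z1 - z2\<bar> powr \<alpha>) \<and>
              (\<forall>y\<in>Ys \<inter> I z1 z2. incr y z1 z2 l q \<le> C))) \<and>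
         (N \<noteq> lborel \<longrightarrow>
           (\<exists>C. \<forall>x\<in>Xs. \<forall>q\<in>Qs. \<forall>z1\<in>B x q. \<forall>z2\<in>B x q. \<forall>l\<in>{0..1}.
              \<forall>y\<in>Ys. incr y z1 z2 l q \<le> C * \<bar>z1 - z2\<bar> powr \<alpha>)) \<and>
         (\<forall>x\<in>Xs. \<forall>q\<in>Qs. (\<forall>e\<in>Es. cond_integrable N fYX (\<lambda>y. psi y e q) x) \<and>
            twice_cont_diff_on Es (\<lambda>e. Psi N fYX psi x e q)) \<and>
         (\<forall>k\<in>{1,2}. \<exists>C. \<forall>x\<in>Xs. \<forall>q\<in>Qs. \<forall>z\<in>B x q.
            \<bar>Psi_deriv k N fYX psi x (eta z) q\<bar> \<le> C) \<and>
         (\<exists>c>0. \<forall>x\<in>Xs. \<forall>q\<in>Qs. \<forall>z\<in>B x q.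
            c \<le> Psi_deriv 1 N fYX psi x (eta z) q * (deriv eta z)\<^sup>2)))"


section \<open>Simplified setup\<close>

definition simplified_setup ::
    "(real^'d) set \<Rightarrow> real set \<Rightarrow> real set \<Rightarrow> real set \<Rightarrow>
     real measure \<Rightarrow> (real^'d \<Rightarrow> real \<Rightarrow> real) \<Rightarrow>
     (real \<Rightarrow> real \<Rightarrow> real \<Rightarrow> real) \<Rightarrow> (real \<Rightarrow> real) \<Rightarrow> (real^'d \<Rightarrow> real \<Rightarrow> real) \<Rightarrow>
     real \<Rightarrow> real \<Rightarrow> bool" where
  "simplified_setup Xs Ys Es Qs N fYX rho eta mu0 \<alpha> \<nu> \<longleftrightarrow>
     (\<forall>x\<in>Xs. mono_on Qs (mu0 x)) \<and>
     (\<exists>(f :: nat \<Rightarrow> real \<Rightarrow> real) (D :: nat \<Rightarrow> real) (T :: real \<Rightarrow> real \<Rightarrow> real)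
        (tau :: real \<Rightarrow> real \<Rightarrow> real) (taubar :: real^'d \<Rightarrow> real \<Rightarrow> real).
        (\<forall>j\<in>{1,2,3}. continuous_on Ys (f j)) \<and>
        continuous_on (Ys \<times> Es) (\<lambda>(y, e). T y e) \<and>
        (\<forall>y\<in>Ys. \<forall>e\<in>Es. \<forall>q\<in>Qs.
           rho y e q = (f 1 y + D 1 * e) * of_bool (y \<le> e) + (f 2 y + D 2 * e) * of_bool (y \<le> q)
             + (f 3 y + D 3 * e) * q + T y e) \<and>
        (\<forall>y\<in>Ys. \<forall>e\<in>Es. (T y has_real_derivative tau y e) (at e)) \<and>
        continuous_on (Ys \<times> Es) (\<lambda>(y, e). tau y e) \<and>
        (\<forall>x\<in>Xs. \<forall>e\<in>Es. (\<lambda>e. cond_expect N fYX (\<lambda>y. tau y e) x) field_differentiable (at e)) \<and>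
        continuous_on (Xs \<times> Es) (\<lambda>(x, e). deriv (\<lambda>e. cond_expect N fYX (\<lambda>y. tau y e) x) e) \<and>
        0 < \<alpha> \<and> \<alpha> \<le> 1 \<and>
        (\<forall>A. compact A \<and> A \<subseteq> Es \<longrightarrow>
          (\<exists>L. \<forall>e1\<in>A. \<forall>e2\<in>A.
             (\<forall>y\<in>Ys. \<bar>tau y e1 - tau y e2\<bar> \<le> L * \<bar>e1 - e2\<bar> powr \<alpha>) \<and>
             (\<forall>x\<in>Xs. \<bar>deriv (\<lambda>e. cond_expect N fYX (\<lambda>y. tau y e) x) e1
                       - deriv (\<lambda>e. cond_expect N fYX (\<lambda>y. tau y e) x) e2\<bar>
                     \<le> L * \<bar>e1 - e2\<bar> powr \<alpha>))) \<and>
        (\<lambda>(x, y). taubar x y) \<in> borel_measurable (restrict_space borel (Xs \<times> Ys)) \<and>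
        (\<forall>x\<in>Xs. \<forall>y\<in>Ys. \<forall>q\<in>Qs. \<bar>tau y (eta (mu0 x q))\<bar> \<le> taubar x y) \<and>
        \<nu> > 2 \<and>
        (\<exists>C. \<forall>x\<in>Xs. cond_nn_expect N fYX (\<lambda>y. taubar x y powr \<nu>) x \<le> ennreal C) \<and>
        \<comment> \<open>differentiability and continuity in y are understood on the range of Y\<close>
        (D 1 \<noteq> 0 \<longrightarrow>
          (\<forall>x\<in>Xs.
             density N (\<lambda>y. ennreal (fYX x y)) = density lborel (\<lambda>y. ennreal (fYX x y)) \<and>
             (\<forall>y\<in>Ys. (cond_cdf N fYX x has_real_derivative fYX x y) (at y within Ys))) \<and>
          continuous_on (Xs \<times> Ys) (\<lambda>(x, y). fYX x y) \<and>
          (\<forall>x\<in>Xs. \<exists>f'. continuous_on Ys f' \<and>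
             (\<forall>y\<in>Ys. (fYX x has_real_derivative f' y) (at y within Ys)))))"


section \<open>Approximation error and the estimator\<close>

definition approximation_error ::
    "(real^'d) set \<Rightarrow> real set \<Rightarrow> (nat \<Rightarrow> (real^'d) set set) \<Rightarrow> (nat \<Rightarrow> nat) \<Rightarrow>
     (nat \<Rightarrow> ('d::finite \<Rightarrow> nat) \<Rightarrow> nat \<Rightarrow> real^'d \<Rightarrow> real) \<Rightarrow>
     (('d \<Rightarrow> nat) \<Rightarrow> real^'d \<Rightarrow> real \<Rightarrow> real) \<Rightarrow> (nat \<Rightarrow> real \<Rightarrow> nat \<Rightarrow> real) \<Rightarrow>
     nat \<Rightarrow> nat \<Rightarrow> bool" where
  "approximation_error Xs Qs \<Delta> K dp dmu0 beta0 m sg \<longleftrightarrow>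
     (\<forall>s. mi_order s \<le> sg \<longrightarrow>
       (\<exists>C. eventually (\<lambda>n. \<forall>q\<in>Qs. \<forall>x\<in>Xs.
          \<bar>dmu0 s x q - dot (K n) (beta0 n q) (\<lambda>k. dp n s k x)\<bar>
            \<le> C * mesh (\<Delta> n) powi (int m - int (mi_order s)))
         sequentially))"

definition m_estimator ::
    "'w measure \<Rightarrow> real set \<Rightarrow> (nat \<Rightarrow> 'w \<Rightarrow> real^'d) \<Rightarrow> (nat \<Rightarrow> 'w \<Rightarrow> real) \<Rightarrow>
     (real \<Rightarrow> real \<Rightarrow> real \<Rightarrow> real) \<Rightarrow> (real \<Rightarrow> real) \<Rightarrow>
     (nat \<Rightarrow> nat) \<Rightarrow> (nat \<Rightarrow> nat \<Rightarrow> real^'d \<Rightarrow> real) \<Rightarrow> (nat \<Rightarrow> (nat \<Rightarrow> real) set) \<Rightarrow>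
     (nat \<Rightarrow> real \<Rightarrow> 'w \<Rightarrow> nat \<Rightarrow> real) \<Rightarrow> bool" where
  "m_estimator M Qs xs ys rho eta K p Bs betahat \<longleftrightarrow>
     (\<forall>n. \<forall>q\<in>Qs. \<forall>\<omega>\<in>space M.
        is_arg_min (\<lambda>b. \<Sum>i<n. rho (ys i \<omega>) (eta (dot (K n) (\<lambda>k. p n k (xs i \<omega>)) b)) q)
          (\<lambda>b. b \<in> Bs n) (betahat n q \<omega>))"

definition mu_hat ::
    "(nat \<Rightarrow> nat) \<Rightarrow> (nat \<Rightarrow> ('d \<Rightarrow> nat) \<Rightarrow> nat \<Rightarrow> real^'d \<Rightarrow> real) \<Rightarrow>
     (nat \<Rightarrow> real \<Rightarrow> 'w \<Rightarrow> nat \<Rightarrow> real) \<Rightarrow> ('d \<Rightarrow> nat) \<Rightarrow> nat \<Rightarrow> 'w \<Rightarrow> real^'d \<Rightarrow> real \<Rightarrow> real" where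
  "mu_hat K dp betahat v n \<omega> x q = dot (K n) (\<lambda>k. dp n v k x) (betahat n q \<omega>)"

end

theory Submission
  imports Defs
begin

text \<open>
  The idea is a one-sided uniform law for the loss increments
  \<open>d\<^sub>i(b, q) = \<rho>(y\<^sub>i, \<eta>(p(x\<^sub>i)\<^sup>T b); q) - \<rho>(y\<^sub>i, \<eta>(p(x\<^sub>i)\<^sup>T \<beta>\<^sub>0(q)); q)\<close>, whose sum is nonpositive at the estimator.
  Integrating \<open>\<Psi>\<close> twice, the curvature condition gives \<open>E d \<ge> c s - C h^2m\<close> with \<open>s = E (p\<^sup>T (b - \<beta>\<^sub>0))^2\<close>,
  while \<open>E d^2 \<le> C s\<close>, and the local basis condition gives \<open>s \<ge> c h^d |b - \<beta>\<^sub>0|^2\<close>.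
  Since \<open>e^u \<le> 1 + u + u^2\<close> for \<open>u \<le> 1\<close>, Chernoff's method applied to \<open>d\<close> clipped from below at a multiple of
  the truncation level \<open>J\<close> of the envelope bounds the probability that the average of \<open>d\<close> at a fixed \<open>(b, q)\<close>
  with \<open>|b - \<beta>\<^sub>0| > \<epsilon>\<close> falls below \<open>c \<epsilon>^2 h^d\<close> by \<open>exp (- c n h^d / J)\<close>. A net of the parameters has
  \<open>exp (C h^(-d) log n)\<close> points because \<open>K h^d\<close> is bounded, so that the union bound needs
  \<open>n h^(2d) / (J log n) \<rightarrow> \<infinity>\<close>; with \<open>J\<close> of order \<open>n^(1/\<nu>)\<close>, or of order \<open>(log n)^(1/2)\<close> in the sub-Gaussian case,
  these are the two rate conditions. The discontinuity of the loss in \<open>q\<close> is only through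
  \<open>1(y \<le> q)\<close>, and is handled by grouping the values of \<open>q\<close> according to the distribution function of \<open>Y\<close>.
\<close>

section \<open>Lower deviations of sums of independent variables\<close>

text \<open>The parameter \<open>b\<close> ranges over the whole box of radius \<open>R\<close>,
  where its spline is bounded but need not be close to \<open>mu0\<close>, whereas the conditions on
  \<open>psi\<close> and its envelope concern a ball around \<open>mu0\<close>. The explicit form of
  the loss bridges the gap: \<open>tau\<close> is Hoelder continuous on compact sets, so its size on
  the box is governed by its size near \<open>mu0\<close>, hence by the envelope plus a constant.
  Mean and second moment of an increment are compared with the same \<open>s\<close>. This permits a
  tilt \<open>\<theta>\<close> of order \<open>1 / J\<close> whose constant does not depend on
  \<open>b\<close>. The bias of order h^(2m) is dominated by the signal, of order \<epsilon>^2 h^d,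
  because m > d/2. No continuity of \<open>beta0 n q\<close> in \<open>q\<close> is available, so
  its coordinates are discretised together with those of \<open>b\<close>; this doubles the
  dimension of the net. The estimator is an arbitrary selection of minimisers, hence all parameters
  are treated at once outside a single measurable event, and the estimator is inserted only
  there.\<close>

lemma exp_le_quadratic:
  fixes u :: real
  assumes "u \<le> 1"
  shows "exp u \<le> 1 + u + u\<^sup>2"
proof (cases "0 \<le> u")
  case True
  then show ?thesis using exp_bound assms by blast
next
  case False
  then have u: "u < 0" by simp
  have "exp (- u) \<ge> 1 - u" using exp_ge_add_one_self[of "-u"] by simp
  then have "exp u \<le> 1 / (1 - u)"
    using u by (simp add: exp_minus field_simps)
  also have "\<dots> \<le> 1 + u + u\<^sup>2"
  proof -
    have "(1 + u + u\<^sup>2) * (1 - u) = 1 + (-u) * u\<^sup>2"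
      by (simp add: algebra_simps power2_eq_square)
    also have "\<dots> \<ge> 1" using u by (simp add: mult_nonneg_nonneg mult_nonpos_nonneg)
    finally show ?thesis using u by (simp add: divide_le_eq)
  qed
  finally show ?thesis .
qed

context prob_space begin

text \<open>Markov's inequality for the product of the factors
  \<open>exp (- \<theta> * Z i \<omega>)\<close>, whose expectation splits by independence. The
  number \<open>s\<close> acts as an effective mean, and its distance to the threshold
  \<open>t\<close> becomes the exponent.\<close>

lemma chernoff_lower:
  fixes Z :: "nat \<Rightarrow> 'a \<Rightarrow> real"
  assumes indep: "indep_vars (\<lambda>_. borel) Z {..<n}"
    and lam: "0 \<le> \<theta>"
    and int: "\<And>i. i < n \<Longrightarrow> integrable M (\<lambda>\<omega>. exp (- \<theta> * Z i \<omega>))"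
    and le: "\<And>i. i < n \<Longrightarrow> expectation (\<lambda>\<omega>. exp (- \<theta> * Z i \<omega>)) \<le> exp (- \<theta> * s)"
  shows "prob {\<omega>\<in>space M. (\<Sum>i<n. Z i \<omega>) \<le> real n * t} \<le> exp (- \<theta> * real n * (s - t))"
proof (cases "n = 0")
  case True
  then show ?thesis by simp
next
  case False
  have ind: "indep_vars (\<lambda>_. borel) (\<lambda>i \<omega>. exp (- \<theta> * Z i \<omega>)) {..<n}"
    using indep_vars_compose2[OF indep, of "\<lambda>_ x. exp (- \<theta> * x)" "\<lambda>_. borel"] by simp
  have [measurable]: "\<And>i. i < n \<Longrightarrow> Z i \<in> borel_measurable M"
    using indep by (simp add: indep_vars_def)
  have I: "integrable M (\<lambda>\<omega>. \<Prod>i<n. exp (- \<theta> * Z i \<omega>))"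
    using False by (intro indep_vars_integrable ind int) auto
  have "expectation (\<lambda>\<omega>. \<Prod>i<n. exp (- \<theta> * Z i \<omega>)) = (\<Prod>i<n. expectation (\<lambda>\<omega>. exp (- \<theta> * Z i \<omega>)))"
    using False by (intro indep_vars_lebesgue_integral ind int) auto
  also have "\<dots> \<le> (\<Prod>i<n. exp (- \<theta> * s))"
    using le by (intro prod_mono) auto
  also have "\<dots> = exp (real n * (- \<theta> * s))"
    by (simp add: exp_of_nat_mult[symmetric])
  finally have E: "expectation (\<lambda>\<omega>. \<Prod>i<n. exp (- \<theta> * Z i \<omega>)) \<le> exp (real n * (- \<theta> * s))" .
  have "prob {\<omega>\<in>space M. (\<Sum>i<n. Z i \<omega>) \<le> real n * t} \<le>
      prob {\<omega>\<in>space M. (\<Prod>i<n. exp (- \<theta> * Z i \<omega>)) \<ge> exp (- \<theta> * (real n * t))}"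
  proof (intro finite_measure_mono subsetI)
    fix \<omega> assume \<omega>: "\<omega> \<in> {\<omega>\<in>space M. (\<Sum>i<n. Z i \<omega>) \<le> real n * t}"
    have "(\<Prod>i<n. exp (- \<theta> * Z i \<omega>)) = exp (- \<theta> * (\<Sum>i<n. Z i \<omega>))"
      by (simp add: exp_sum sum_distrib_left)
    then show "\<omega> \<in> {\<omega>\<in>space M. (\<Prod>i<n. exp (- \<theta> * Z i \<omega>)) \<ge> exp (- \<theta> * (real n * t))}"
      using \<omega> lam by (auto intro: mult_left_mono)
  qed measurable
  also have "\<dots> \<le> expectation (\<lambda>\<omega>. \<Prod>i<n. exp (- \<theta> * Z i \<omega>)) / exp (- \<theta> * (real n * t))"
    by (intro integral_Markov_inequality_measure[where A="{}"] I) (auto intro!: prod_nonneg)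
  also have "\<dots> \<le> exp (real n * (- \<theta> * s)) / exp (- \<theta> * (real n * t))"
    by (intro divide_right_mono E) simp
  also have "\<dots> = exp (- \<theta> * real n * (s - t))"
    by (simp add: exp_diff[symmetric] algebra_simps)
  finally show ?thesis .
qed

text \<open>With u = - \<theta> g, at most 1 by the lower bound on \<open>g\<close>, the quadratic
  bound for exp gives E exp(- \<theta> g) \<le> 1 - \<theta> (E g - \<theta> E g^2) \<le> exp(-
  \<theta> s). Large positive values of \<open>g\<close> enter through the second moment
  alone.\<close>

lemma iid_lower_deviation:
  fixes g :: "'b \<Rightarrow> real"
  assumes indep: "indep_vars (\<lambda>_. S) X UNIV"
    and law: "\<And>i. distr M S (X i) = L"
    and g [measurable]: "g \<in> borel_measurable S"
    and lam: "0 < \<theta>" and lb: "\<And>z. z \<in> space S \<Longrightarrow> - 1 / \<theta> \<le> g z"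
    and int: "integrable L g" and int2: "integrable L (\<lambda>z. (g z)\<^sup>2)"
    and mean: "s \<le> (\<integral>z. g z \<partial>L) - \<theta> * (\<integral>z. (g z)\<^sup>2 \<partial>L)"
  shows "prob {\<omega>\<in>space M. (\<Sum>i<n. g (X i \<omega>)) \<le> real n * t} \<le> exp (- \<theta> * real n * (s - t))"
proof -
  have X [measurable]: "\<And>i. X i \<in> measurable M S"
    using indep by (auto simp: indep_vars_def)
  interpret L: prob_space L using law[of 0] prob_space_distr[OF X] by metis
  have sL[simp, measurable_cong]: "sets L = sets S" using law[of 0] by (metis sets_distr)
  have spL: "space L = space S" using sL by (rule sets_eq_imp_space_eq)
  let ?e = "\<lambda>z. exp (- \<theta> * g z)"
  let ?u = "\<lambda>z. 1 - \<theta> * g z + \<theta>\<^sup>2 * (g z)\<^sup>2"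
  have le: "?e z \<le> ?u z" if "z \<in> space S" for z
    using exp_le_quadratic[of "- \<theta> * g z"] lb[OF that] lam
    by (simp add: field_simps power_mult_distrib)
  have iu: "integrable L ?u" using int int2 by auto
  have ie: "integrable L ?e"
    by (rule Bochner_Integration.integrable_bound[OF iu])
       (auto simp: spL intro!: AE_I2 order.trans[OF le[simplified]])
  have "(\<integral>z. ?e z \<partial>L) \<le> (\<integral>z. ?u z \<partial>L)"
    by (intro integral_mono ie iu) (simp add: spL le[simplified])
  also have "\<dots> = 1 - \<theta> * ((\<integral>z. g z \<partial>L) - \<theta> * (\<integral>z. (g z)\<^sup>2 \<partial>L))"
    using int int2 by (simp add: L.prob_space algebra_simps power2_eq_square)
  also have "\<dots> \<le> 1 + (- \<theta> * s)"
    using mult_left_mono[OF mean, of \<theta>] lam by simp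
  also have "\<dots> \<le> exp (- \<theta> * s)" by (rule exp_ge_add_one_self)
  finally have E: "(\<integral>z. ?e z \<partial>L) \<le> exp (- \<theta> * s)" .
  show ?thesis
  proof (rule chernoff_lower)
    have "indep_vars (\<lambda>_. S) X {..<n}" by (rule indep_vars_subset[OF indep]) simp
    then show "indep_vars (\<lambda>_. borel) (\<lambda>i \<omega>. g (X i \<omega>)) {..<n}"
      using indep_vars_compose2[of "\<lambda>_. S" X "{..<n}" "\<lambda>_. g" "\<lambda>_. borel"] by simp
    fix i
    show "integrable M (\<lambda>\<omega>. exp (- \<theta> * g (X i \<omega>)))"
      using ie unfolding law[of i, symmetric] by (subst (asm) integrable_distr_eq) auto
    have "(\<integral>z. ?e z \<partial>L) = expectation (\<lambda>\<omega>. exp (- \<theta> * g (X i \<omega>)))"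
      unfolding law[of i, symmetric] by (subst integral_distr) auto
    with E show "expectation (\<lambda>\<omega>. exp (- \<theta> * g (X i \<omega>))) \<le> exp (- \<theta> * s)" by simp
  qed (use lam in auto)
qed

text \<open>The clipping at \<open>- 1 / \<theta>\<close> only increases the mean and only decreases the second
  moment, so that no bias has to be controlled.\<close>

lemma iid_lower_deviation_clipped:
  fixes g :: "'b \<Rightarrow> real"
  assumes indep: "indep_vars (\<lambda>_. S) X UNIV"
    and law: "\<And>i. distr M S (X i) = L"
    and g [measurable]: "g \<in> borel_measurable S"
    and lam: "0 < \<theta>"
    and int: "integrable L g" and int2: "integrable L (\<lambda>z. (g z)\<^sup>2)"
    and mean: "s \<le> (\<integral>z. g z \<partial>L) - \<theta> * (\<integral>z. (g z)\<^sup>2 \<partial>L)"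
  shows "prob {\<omega>\<in>space M. (\<Sum>i<n. max (g (X i \<omega>)) (- 1 / \<theta>)) \<le> real n * t} \<le> exp (- \<theta> * real n * (s - t))"
proof (rule iid_lower_deviation[OF indep law _ lam])
  have X [measurable]: "\<And>i. X i \<in> measurable M S"
    using indep by (auto simp: indep_vars_def)
  interpret L: prob_space L using law[of 0] prob_space_distr[OF X] by metis
  have sL[simp, measurable_cong]: "sets L = sets S" using law[of 0] by (metis sets_distr)
  have sq: "(max (g z) (- 1 / \<theta>))\<^sup>2 \<le> (g z)\<^sup>2" for z
  proof -
    have "\<bar>max (g z) (- 1 / \<theta>)\<bar> \<le> \<bar>g z\<bar>"
    proof -
      have "- 1 / \<theta> < 0" using lam by simp
      then show ?thesis by linarith
    qed
    then show ?thesis by (simp add: abs_le_square_iff)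
  qed
  show i: "integrable L (\<lambda>z. max (g z) (- 1 / \<theta>))" using int by auto
  show i2: "integrable L (\<lambda>z. (max (g z) (- 1 / \<theta>))\<^sup>2)"
    by (rule Bochner_Integration.integrable_bound[OF int2]) (use sq in auto)
  have "(\<integral>z. g z \<partial>L) \<le> (\<integral>z. max (g z) (- 1 / \<theta>) \<partial>L)"
    by (intro integral_mono int i) simp
  moreover have "(\<integral>z. (max (g z) (- 1 / \<theta>))\<^sup>2 \<partial>L) \<le> (\<integral>z. (g z)\<^sup>2 \<partial>L)"
    by (intro integral_mono int2 i2 sq)
  ultimately show "s \<le> (\<integral>z. max (g z) (- 1 / \<theta>) \<partial>L) - \<theta> * (\<integral>z. (max (g z) (- 1 / \<theta>))\<^sup>2 \<partial>L)"
    using mean mult_left_mono[of _ _ \<theta>] lam by (smt (verit))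
qed auto

text \<open>A compact subset of a class of equal \<open>\<lfloor>cdf Q / w\<rfloor>\<close> lies in a single bracket of mass at most \<open>w\<close>; inner
  regularity carries this bound over to the whole class, whether or not its endpoints are attained.\<close>

lemma empirical_brackets:
  fixes Y :: "nat \<Rightarrow> 'a \<Rightarrow> real" and w :: real
  assumes indep: "indep_vars (\<lambda>_. borel) Y UNIV"
    and law: "\<And>i. distr M borel (Y i) = Q" and w: "0 < w"
  shows "\<exists>E\<in>events. prob E \<le> (1 / w + 2) * exp (- real n * w) \<and>
    (\<forall>\<omega>\<in>space M - E. \<forall>a b. a \<le> b \<and> \<lfloor>cdf Q a / w\<rfloor> = \<lfloor>cdf Q b / w\<rfloor> \<longrightarrow>
       (\<Sum>i<n. of_bool (a < Y i \<omega> \<and> Y i \<omega> \<le> b)) \<le> 3 * w * real n)"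
proof -
  have Y [measurable]: "\<And>i. Y i \<in> borel_measurable M"
    using indep by (auto simp: indep_vars_def)
  interpret Q: prob_space Q using law[of 0] prob_space_distr[OF Y] by metis
  have sQ[simp, measurable_cong]: "sets Q = sets borel" using law[of 0] by (metis sets_distr)
  interpret Q: real_distribution Q by unfold_locales (simp_all add: sets_eq_imp_space_eq[OF sQ])
  \<comment> \<open>The union of all brackets whose two end points have the code \<open>j\<close>.
    It is an interval, and uncountably many brackets are thus replaced by finitely many
    sets.\<close>
  define V where "V j = {y. \<exists>a b. \<lfloor>cdf Q a / w\<rfloor> = j \<and> \<lfloor>cdf Q b / w\<rfloor> = j \<and> a < y \<and> y \<le> b}" for j
  have "is_interval (V j)" for j
    unfolding is_interval_1 V_def by (blast intro: less_le_trans order.trans)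
  then have V [measurable]: "V j \<in> sets borel" for j by (rule real_interval_borel_measurable)
  have diff: "cdf Q b - cdf Q a \<le> w" if "\<lfloor>cdf Q a / w\<rfloor> = \<lfloor>cdf Q b / w\<rfloor>" for a b
  proof -
    have "cdf Q b / w - cdf Q a / w \<le> 1" using that by linarith
    then show ?thesis using w by (simp add: field_simps)
  qed
  have mV: "measure Q (V j) \<le> w" for j
  proof -
    have "emeasure Q (V j) = (SUP C\<in>{C. C \<subseteq> V j \<and> compact C}. emeasure Q C)"
      by (rule inner_regular) auto
    also have "\<dots> \<le> ennreal w"
    proof (rule SUP_least)
      fix C assume C: "C \<in> {C. C \<subseteq> V j \<and> compact C}"
      show "emeasure Q C \<le> ennreal w"
      proof (cases "C = {}")
        case False
        then obtain l u where lu: "l \<in> C" "u \<in> C" "\<And>y. y \<in> C \<Longrightarrow> l \<le> y" "\<And>y. y \<in> C \<Longrightarrow> y \<le> u"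
          using C compact_attains_inf[of C] compact_attains_sup[of C] by auto
        then have "l \<in> V j" "u \<in> V j" using C by auto
        then obtain a b where ab: "\<lfloor>cdf Q a / w\<rfloor> = j" "\<lfloor>cdf Q b / w\<rfloor> = j" "a < l" "u \<le> b"
          unfolding V_def by blast
        have sub: "C \<subseteq> {a<..b}" using lu ab by force
        have "emeasure Q C \<le> emeasure Q {a<..b}" by (intro emeasure_mono sub) simp
        also have "\<dots> = ennreal (cdf Q b - cdf Q a)"
        proof -
          have "a < b" using lu ab by fastforce
          then show ?thesis using Q.cdf_diff_eq[of a b] by (simp add: Q.emeasure_eq_measure)
        qed
        also have "\<dots> \<le> ennreal w" using diff[of a b] ab by (intro ennreal_leI) simp
        finally show ?thesis .
      qed simp
    qed
    finally show ?thesis using w by (simp add: Q.emeasure_eq_measure)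
  qed
  \<comment> \<open>For minus the indicator and tilt 1, the effective mean is minus twice the mass
    of \<open>V j\<close>, hence at least - 2 w. The threshold - 3 w leaves the gap w, which is the
    exponent per observation.\<close>
  define E where "E = (\<Union>j\<in>{0..\<lfloor>1 / w\<rfloor>}. {\<omega>\<in>space M. (\<Sum>i<n. - indicator (V j) (Y i \<omega>)) \<le> real n * (- 3 * w)})"
  have E [measurable]: "E \<in> events" unfolding E_def by measurable
  have "prob E \<le> (\<Sum>j\<in>{0..\<lfloor>1 / w\<rfloor>}. prob {\<omega>\<in>space M. (\<Sum>i<n. - indicator (V j) (Y i \<omega>)) \<le> real n * (- 3 * w)})"
    unfolding E_def by (intro finite_measure_subadditive_finite) auto
  also have "\<dots> \<le> (\<Sum>j\<in>{0..\<lfloor>1 / w\<rfloor>}. exp (- real n * w))"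
  proof (rule sum_mono)
    fix j
    have "prob {\<omega>\<in>space M. (\<Sum>i<n. - indicator (V j) (Y i \<omega>)) \<le> real n * (- 3 * w)}
      \<le> exp (- 1 * real n * ((- 2 * w) - (- 3 * w)))"
    proof (rule iid_lower_deviation[where S = borel and L = Q and g = "\<lambda>z. - indicator (V j) z" and s = "- 2 * w" and \<theta> = 1])
      have "(\<lambda>z. (- indicator (V j) z :: real)\<^sup>2) = indicator (V j)"
        by (auto simp: indicator_def)
      moreover have "integrable Q (indicator (V j) :: real \<Rightarrow> real)"
        by (rule Q.integrable_const_bound[where B=1]) (auto simp: indicator_def)
      ultimately show "integrable Q (\<lambda>z. (- indicator (V j) z :: real)\<^sup>2)"
        "- 2 * w \<le> (\<integral>z. - indicator (V j) z \<partial>Q) - 1 * (\<integral>z. (- indicator (V j) z)\<^sup>2 \<partial>Q)"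
        "integrable Q (\<lambda>z. - indicator (V j) z :: real)"
        using mV[of j] by simp_all
    qed (use indep law in \<open>auto simp: indicator_def\<close>)
    then show "prob {\<omega>\<in>space M. (\<Sum>i<n. - indicator (V j) (Y i \<omega>)) \<le> real n * (- 3 * w)}
      \<le> exp (- real n * w)" by (simp add: algebra_simps)
  qed
  also have "\<dots> = real (card {0..\<lfloor>1 / w\<rfloor>}) * exp (- real n * w)" by simp
  also have "\<dots> \<le> (1 / w + 2) * exp (- real n * w)"
  proof (rule mult_right_mono)
    have "0 \<le> \<lfloor>1 / w\<rfloor>" using w by simp
    then have "real (card {0..\<lfloor>1 / w\<rfloor>}) = real_of_int \<lfloor>1 / w\<rfloor> + 1" by simp
    also have "\<dots> \<le> 1 / w + 2" by linarith
    finally show "real (card {0..\<lfloor>1 / w\<rfloor>}) \<le> 1 / w + 2" .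
  qed simp
  finally have pE: "prob E \<le> (1 / w + 2) * exp (- real n * w)" .
  have "(\<Sum>i<n. of_bool (a < Y i \<omega> \<and> Y i \<omega> \<le> b)) \<le> 3 * w * real n"
    if \<omega>: "\<omega> \<in> space M - E" and "a \<le> b" and eq: "\<lfloor>cdf Q a / w\<rfloor> = \<lfloor>cdf Q b / w\<rfloor>" for \<omega> a b
  proof -
    define j where "j = \<lfloor>cdf Q a / w\<rfloor>"
    have "0 \<le> cdf Q a / w" "cdf Q a / w \<le> 1 / w"
      using w Q.cdf_nonneg[of a] Q.cdf_bounded_prob[of a] by (auto intro: divide_right_mono)
    then have "0 \<le> j" "j \<le> \<lfloor>1 / w\<rfloor>" unfolding j_def by (auto intro: floor_mono)
    then have "\<not> (\<Sum>i<n. - indicator (V j) (Y i \<omega>)) \<le> real n * (- 3 * w)"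
      using \<omega> unfolding E_def by auto
    then have le: "(\<Sum>i<n. indicator (V j) (Y i \<omega>)) \<le> 3 * w * real n"
      by (simp add: sum_negf algebra_simps)
    have "(\<Sum>i<n. of_bool (a < Y i \<omega> \<and> Y i \<omega> \<le> b)) \<le> (\<Sum>i<n. indicator (V j) (Y i \<omega>) :: real)"
    proof (rule sum_mono)
      fix i
      show "of_bool (a < Y i \<omega> \<and> Y i \<omega> \<le> b) \<le> (indicator (V j) (Y i \<omega>) :: real)"
        using eq unfolding V_def j_def by (auto simp: indicator_def)
    qed
    with le show ?thesis by linarith
  qed
  with pE E show ?thesis by blast
qed

end

section \<open>The loss function\<close>

lemma abs_continuous_on_interval_imp_continuous_on:
  assumes "abs_continuous_on_interval a b f"
  shows "continuous_on {a..b} f"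
proof (unfold continuous_on_iff, intro ballI allI impI)
  fix x and e :: real assume x: "x \<in> {a..b}" and e: "0 < e"
  obtain d where d: "d > 0" and
    D: "\<And>l u. a \<le> l \<Longrightarrow> l \<le> u \<Longrightarrow> u \<le> b \<Longrightarrow> u - l < d \<Longrightarrow> \<bar>f u - f l\<bar> < e"
  proof -
    obtain d where d: "d > 0" and
      D: "\<forall>(N::nat) l u. (\<forall>i<N. a \<le> l i \<and> l i \<le> u i \<and> u i \<le> b) \<and>
          disjoint_family_on (\<lambda>i. {l i<..<u i}) {..<N} \<and> (\<Sum>i<N. u i - l i) < d \<longrightarrow>
          (\<Sum>i<N. \<bar>f (u i) - f (l i)\<bar>) < e"
      using assms[unfolded abs_continuous_on_interval_def, rule_format, OF e] by (elim exE conjE)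
    have "\<bar>f u - f l\<bar> < e" if "a \<le> l" "l \<le> u" "u \<le> b" "u - l < d" for l u
      using D[rule_format, of 1 "\<lambda>_. l" "\<lambda>_. u"] that by (simp add: disjoint_family_on_def)
    with d show thesis by (rule that)
  qed
  show "\<exists>d>0. \<forall>x'\<in>{a..b}. dist x' x < d \<longrightarrow> dist (f x') (f x) < e"
  proof (intro exI[of _ d] conjI ballI impI d)
    fix x' assume x': "x' \<in> {a..b}" and "dist x' x < d"
    then have "\<bar>f (max x x') - f (min x x')\<bar> < e"
      using x x' by (intro D) (auto simp: dist_real_def)
    then show "dist (f x') (f x) < e"
      by (simp add: dist_real_def max_def min_def abs_minus_commute split: if_splits)
  qed
qed

text \<open>Serves to pick, in an interval of positive length, a point where two almost everywhere
  defined versions of a derivative agree.\<close>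

lemma AE_lborel_ex_in_interval:
  fixes l u :: real
  assumes "AE x in lborel. P x" "l < u"
  shows "\<exists>x\<in>{l<..<u}. P x"
proof (rule ccontr)
  assume "\<not> ?thesis"
  then have "AE x in lborel. x \<notin> {l<..<u}" using assms(1) by (auto elim!: eventually_mono)
  then have "emeasure lborel {x. l < x \<and> x < u} = 0" by (subst (asm) AE_iff_measurable[OF _ refl]) auto
  moreover have "{x. l < x \<and> x < u} = {l<..<u}" by auto
  ultimately have "emeasure lborel {l<..<u} = 0" by simp
  then show False using assms(2) by (simp add: ennreal_eq_0_iff)
qed

lemma closed_segment_subset_image:
  fixes f :: "real \<Rightarrow> real"
  assumes "continuous_on (closed_segment a b) f"
  shows "closed_segment (f a) (f b) \<subseteq> f ` closed_segment a b"
proof -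
  have "connected (f ` closed_segment a b)"
    using assms by (intro connected_continuous_image) auto
  then have "convex (f ` closed_segment a b)"
    by (simp add: is_interval_connected_1[symmetric] is_interval_convex_1)
  then show ?thesis by (intro closed_segment_subset) auto
qed

text \<open>\<open>psi\<close>, \<open>psibar\<close> and \<open>rho\<close> are measurable only
  relative to sets built from \<open>Ys\<close>, about which no measurability is known. Cutting such
  a function down to a Borel subset makes it measurable on the whole space.\<close>

lemma borel_measurable_indicator_restrict:
  fixes f :: "'a \<Rightarrow> real"
  assumes f: "f \<in> borel_measurable (restrict_space M A)" and "B \<subseteq> A" and B: "B \<in> sets M"
  shows "(\<lambda>x. f x * indicator B x) \<in> borel_measurable M"
proof -
  have "f \<in> borel_measurable (restrict_space M B)"
    by (rule measurable_restrict_mono[OF f]) fact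
  then have "(\<lambda>x. indicator B x *\<^sub>R f x) \<in> borel_measurable M"
    using B sets.sets_into_space[OF B]
    by (subst (asm) borel_measurable_restrict_space_iff) (auto simp: Int_absorb2)
  then show ?thesis by (simp add: mult.commute)
qed

text \<open>What the loss and the conditional density contribute, separated from the sample and the
  basis. The uniform bound \<open>B0\<close> on \<open>mu0\<close> keeps all arguments of
  \<open>eta\<close> in one compact interval, on which constants can be chosen uniformly in
  \<open>x\<close> and \<open>q\<close>.\<close>

locale regular_loss =
  fixes Xs :: "(real^'d::finite) set" and Ys Es Qs :: "real set"
    and N :: "real measure" and fYX :: "real^'d \<Rightarrow> real \<Rightarrow> real"
    and rho psi :: "real \<Rightarrow> real \<Rightarrow> real \<Rightarrow> real" and psibar :: "real^'d \<Rightarrow> real \<Rightarrow> real"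
    and eta :: "real \<Rightarrow> real" and mu0 :: "real^'d \<Rightarrow> real \<Rightarrow> real" and \<alpha> \<nu> B0 :: real
  assumes loss: "loss_function Xs Ys Es Qs N fYX rho psi psibar eta mu0 \<alpha> \<nu>"
    and simplified: "simplified_setup Xs Ys Es Qs N fYX rho eta mu0 \<alpha> \<nu>"
    and mu0_bound: "\<And>x q. x \<in> Xs \<Longrightarrow> q \<in> Qs \<Longrightarrow> \<bar>mu0 x q\<bar> \<le> B0"
    and sigma_finite_N: "sigma_finite_measure N" and sets_N [measurable_cong]: "sets N = sets borel"
    and fYX_meas: "\<And>x. x \<in> Xs \<Longrightarrow> fYX x \<in> borel_measurable borel"
    and fYX_nonneg: "\<And>x y. x \<in> Xs \<Longrightarrow> 0 \<le> fYX x y"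
    and fYX_total: "\<And>x. x \<in> Xs \<Longrightarrow> (\<integral>\<^sup>+y. ennreal (fYX x y) \<partial>N) = 1"
    and fYX_support: "\<And>x. x \<in> Xs \<Longrightarrow> cond_support fYX x \<subseteq> Ys"
begin

lemma fYX_Ys: "x \<in> Xs \<Longrightarrow> fYX x y \<noteq> 0 \<Longrightarrow> y \<in> Ys"
  using fYX_support by (auto simp: cond_support_def)

lemmas loss_unfolded = loss[unfolded loss_function_def Let_def]

lemma nu_gt_2: "\<nu> > 2" and alpha_pos: "0 < \<alpha>" and open_Es: "open Es" and compact_Qs: "compact Qs"
  using loss_unfolded by - (elim conjE, assumption)+

lemma eta_Es: "eta z \<in> Es"
proof -
  have "range eta \<subseteq> Es" using loss_unfolded by (elim conjE)
  then show ?thesis by blast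
qed

lemma Qs_bounded: "\<exists>C\<ge>0. \<forall>q\<in>Qs. \<bar>q\<bar> \<le> C"
proof -
  have "bounded Qs" using compact_Qs by (rule compact_imp_bounded)
  then show ?thesis by (auto simp: bounded_pos intro: less_imp_le)
qed

lemma eta_C1: "(eta has_real_derivative deriv eta z) (at z)"
  and deta_C0: "continuous_on UNIV (deriv eta)"
proof -
  have "twice_cont_diff_on UNIV eta" using loss_unfolded by (elim conjE)
  then have *: "\<And>z. eta field_differentiable (at z)" "\<And>z. deriv eta field_differentiable (at z)"
    by (auto simp: twice_cont_diff_on_def)
  show "(eta has_real_derivative deriv eta z) (at z)"
    using *(1) by (rule DERIV_deriv_iff_field_differentiable[THEN iffD2])
  show "continuous_on UNIV (deriv eta)"
    by (intro continuous_at_imp_continuous_on ballI field_differentiable_imp_continuous_at *(2))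
qed

lemma eta_cont: "continuous_on S eta"
  using eta_C1 DERIV_isCont by (meson continuous_at_imp_continuous_on)

lemma eta_strict: "strict_mono eta \<or> strict_antimono_on UNIV eta"
  using loss_unfolded by (elim conjE)

lemma eta_neq: "z1 \<noteq> z2 \<Longrightarrow> eta z1 \<noteq> eta z2"
  using eta_strict unfolding strict_mono_def monotone_on_def
  by (metis UNIV_I less_irrefl linorder_neqE_linordered_idom)

lemma eta_lipschitz: "\<exists>C>0. \<forall>z1\<in>{-W..W}. \<forall>z2\<in>{-W..W}. \<bar>eta z1 - eta z2\<bar> \<le> C * \<bar>z1 - z2\<bar>"
proof -
  have "compact (deriv eta ` {-W..W})"
    by (intro compact_continuous_image continuous_on_subset[OF deta_C0]) auto
  then obtain C where C: "C > 0" "\<And>z. z \<in> {-W..W} \<Longrightarrow> \<bar>deriv eta z\<bar> \<le> C"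
    using compact_imp_bounded bounded_pos[of "deriv eta ` {-W..W}"] by auto
  have "norm (eta z1 - eta z2) \<le> C * norm (z1 - z2)" if "z1 \<in> {-W..W}" "z2 \<in> {-W..W}" for z1 z2
    by (rule field_differentiable_bound[where S="{-W..W}" and f'="deriv eta"])
       (use that C eta_C1 in \<open>auto intro: has_field_derivative_at_within\<close>)
  then show ?thesis using C(1) by auto
qed

lemma psibar_pos: "x \<in> Xs \<Longrightarrow> y \<in> Ys \<Longrightarrow> 0 < psibar x y"
  and psi_le_psibar: "x \<in> Xs \<Longrightarrow> y \<in> Ys \<Longrightarrow> q \<in> Qs \<Longrightarrow> \<bar>psi y (eta (mu0 x q)) q\<bar> \<le> psibar x y"
proof -
  have "\<forall>x\<in>Xs. \<forall>y\<in>Ys. 0 < psibar x y \<and> (\<forall>q\<in>Qs. \<bar>psi y (eta (mu0 x q)) q\<bar> \<le> psibar x y)"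
    using loss_unfolded by (elim conjE)
  then show "x \<in> Xs \<Longrightarrow> y \<in> Ys \<Longrightarrow> 0 < psibar x y"
    "x \<in> Xs \<Longrightarrow> y \<in> Ys \<Longrightarrow> q \<in> Qs \<Longrightarrow> \<bar>psi y (eta (mu0 x q)) q\<bar> \<le> psibar x y" by blast+
qed

lemma psibar_meas: "(\<lambda>(x, y). psibar x y) \<in> borel_measurable (restrict_space borel (Xs \<times> Ys))"
  and psi_meas': "\<forall>q\<in>Qs. (\<lambda>(y, e). psi y e q) \<in> borel_measurable (restrict_space borel (Ys \<times> Es))"
  and psibar_moment: "\<exists>C. \<forall>x\<in>Xs. cond_nn_expect N fYX (\<lambda>y. psibar x y powr \<nu>) x \<le> ennreal C"
  using loss_unfolded by - (elim conjE, assumption)+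

lemmas psi_meas = psi_meas'[rule_format]

lemma rho_cont: "q \<in> Qs \<Longrightarrow> y \<in> Ys \<Longrightarrow> a \<le> b \<Longrightarrow> {a..b} \<subseteq> Es \<Longrightarrow> continuous_on {a..b} (\<lambda>e. rho y e q)"
  and rho_AE: "q \<in> Qs \<Longrightarrow> y \<in> Ys \<Longrightarrow>
    AE e in lborel. e \<in> Es \<longrightarrow> ((\<lambda>e. rho y e q) has_real_derivative psi y e q) (at e)"
proof -
  have *: "\<forall>q\<in>Qs. \<forall>y\<in>Ys.
        (\<forall>a b. a \<le> b \<and> {a..b} \<subseteq> Es \<longrightarrow> abs_continuous_on_interval a b (\<lambda>e. rho y e q)) \<and>
        (AE e in lborel. e \<in> Es \<longrightarrow> ((\<lambda>e. rho y e q) has_real_derivative psi y e q) (at e))"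
    using loss_unfolded by (elim conjE)
  show "q \<in> Qs \<Longrightarrow> y \<in> Ys \<Longrightarrow> a \<le> b \<Longrightarrow> {a..b} \<subseteq> Es \<Longrightarrow> continuous_on {a..b} (\<lambda>e. rho y e q)"
    by (rule abs_continuous_on_interval_imp_continuous_on) (use * in blast)
  show "q \<in> Qs \<Longrightarrow> y \<in> Ys \<Longrightarrow>
    AE e in lborel. e \<in> Es \<longrightarrow> ((\<lambda>e. rho y e q) has_real_derivative psi y e q) (at e)"
    using * by blast
qed

lemma Psi_zero: "x \<in> Xs \<Longrightarrow> q \<in> Qs \<Longrightarrow> Psi N fYX psi x (eta (mu0 x q)) q = 0"
proof -
  have "\<forall>x\<in>Xs. \<forall>q\<in>Qs. cond_expect N fYX (\<lambda>y. psi y (eta (mu0 x q)) q) x = 0"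
    using loss_unfolded by (elim conjE)
  then show "x \<in> Xs \<Longrightarrow> q \<in> Qs \<Longrightarrow> ?thesis" by (simp add: Psi_def)
qed

text \<open>One radius and one pair of constants for all local conditions. The Hoelder bound and the
  constant bound for \<open>y\<close> between the two values of \<open>eta\<close> are both weakened
  to a uniform bound on the change of \<open>psi\<close> over the ball, which merges the two cases
  of the dominating measure.\<close>

lemma local_facts:
  obtains r C c where "r > 0" "c > 0" "C > 0"
    "\<And>x q z y. x \<in> Xs \<Longrightarrow> q \<in> Qs \<Longrightarrow> \<bar>z - mu0 x q\<bar> \<le> r \<Longrightarrow> y \<in> Ys \<Longrightarrow>
       \<bar>psi y (eta z) q - psi y (eta (mu0 x q)) q\<bar> \<le> C"
    "\<And>x q. x \<in> Xs \<Longrightarrow> q \<in> Qs \<Longrightarrow> twice_cont_diff_on Es (\<lambda>e. Psi N fYX psi x e q)"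
    "\<And>x q z. x \<in> Xs \<Longrightarrow> q \<in> Qs \<Longrightarrow> \<bar>z - mu0 x q\<bar> \<le> r \<Longrightarrow> \<bar>Psi_deriv 1 N fYX psi x (eta z) q\<bar> \<le> C"
    "\<And>x q z. x \<in> Xs \<Longrightarrow> q \<in> Qs \<Longrightarrow> \<bar>z - mu0 x q\<bar> \<le> r \<Longrightarrow>
       c \<le> Psi_deriv 1 N fYX psi x (eta z) q * (deriv eta z)\<^sup>2"
proof -
  let ?incr = "\<lambda>y z1 z2 l q. \<bar>psi y (eta (z1 + l * (z2 - z1))) q - psi y (eta z2) q\<bar>"
  let ?I = "\<lambda>z1 z2. {min (eta z1) (eta z2) .. max (eta z1) (eta z2)}"
  have "\<exists>r>0. (N = lborel \<longrightarrow>
           (\<exists>C. \<forall>x\<in>Xs. \<forall>q\<in>Qs. \<forall>z1\<in>{z. \<bar>z - mu0 x q\<bar> \<le> r}. \<forall>z2\<in>{z. \<bar>z - mu0 x q\<bar> \<le> r}. \<forall>l\<in>{0..1}.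
              (\<forall>y\<in>Ys - ?I z1 z2. ?incr y z1 z2 l q \<le> C * \<bar>z1 - z2\<bar> powr \<alpha>) \<and>
              (\<forall>y\<in>Ys \<inter> ?I z1 z2. ?incr y z1 z2 l q \<le> C))) \<and>
     (N \<noteq> lborel \<longrightarrow>
           (\<exists>C. \<forall>x\<in>Xs. \<forall>q\<in>Qs. \<forall>z1\<in>{z. \<bar>z - mu0 x q\<bar> \<le> r}. \<forall>z2\<in>{z. \<bar>z - mu0 x q\<bar> \<le> r}. \<forall>l\<in>{0..1}.
              \<forall>y\<in>Ys. ?incr y z1 z2 l q \<le> C * \<bar>z1 - z2\<bar> powr \<alpha>)) \<and>
     (\<forall>x\<in>Xs. \<forall>q\<in>Qs. (\<forall>e\<in>Es. cond_integrable N fYX (\<lambda>y. psi y e q) x) \<and>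
            twice_cont_diff_on Es (\<lambda>e. Psi N fYX psi x e q)) \<and>
     (\<forall>k\<in>{1,2}. \<exists>C. \<forall>x\<in>Xs. \<forall>q\<in>Qs. \<forall>z\<in>{z. \<bar>z - mu0 x q\<bar> \<le> r}.
            \<bar>Psi_deriv k N fYX psi x (eta z) q\<bar> \<le> C) \<and>
     (\<exists>c>0. \<forall>x\<in>Xs. \<forall>q\<in>Qs. \<forall>z\<in>{z. \<bar>z - mu0 x q\<bar> \<le> r}.
            c \<le> Psi_deriv 1 N fYX psi x (eta z) q * (deriv eta z)\<^sup>2)"
    using loss_unfolded by (elim conjE)
  then obtain r where r': "r > 0 \<and> (N = lborel \<longrightarrow>
           (\<exists>C. \<forall>x\<in>Xs. \<forall>q\<in>Qs. \<forall>z1\<in>{z. \<bar>z - mu0 x q\<bar> \<le> r}. \<forall>z2\<in>{z. \<bar>z - mu0 x q\<bar> \<le> r}. \<forall>l\<in>{0..1}.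
              (\<forall>y\<in>Ys - ?I z1 z2. ?incr y z1 z2 l q \<le> C * \<bar>z1 - z2\<bar> powr \<alpha>) \<and>
              (\<forall>y\<in>Ys \<inter> ?I z1 z2. ?incr y z1 z2 l q \<le> C))) \<and>
     (N \<noteq> lborel \<longrightarrow>
           (\<exists>C. \<forall>x\<in>Xs. \<forall>q\<in>Qs. \<forall>z1\<in>{z. \<bar>z - mu0 x q\<bar> \<le> r}. \<forall>z2\<in>{z. \<bar>z - mu0 x q\<bar> \<le> r}. \<forall>l\<in>{0..1}.
              \<forall>y\<in>Ys. ?incr y z1 z2 l q \<le> C * \<bar>z1 - z2\<bar> powr \<alpha>)) \<and>
     (\<forall>x\<in>Xs. \<forall>q\<in>Qs. (\<forall>e\<in>Es. cond_integrable N fYX (\<lambda>y. psi y e q) x) \<and>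
            twice_cont_diff_on Es (\<lambda>e. Psi N fYX psi x e q)) \<and>
     (\<forall>k\<in>{1,2}. \<exists>C. \<forall>x\<in>Xs. \<forall>q\<in>Qs. \<forall>z\<in>{z. \<bar>z - mu0 x q\<bar> \<le> r}.
            \<bar>Psi_deriv k N fYX psi x (eta z) q\<bar> \<le> C) \<and>
     (\<exists>c>0. \<forall>x\<in>Xs. \<forall>q\<in>Qs. \<forall>z\<in>{z. \<bar>z - mu0 x q\<bar> \<le> r}.
            c \<le> Psi_deriv 1 N fYX psi x (eta z) q * (deriv eta z)\<^sup>2)"
    by (rule exE)
  then have r: "r > 0" by (rule conjunct1)
  have A: "N = lborel \<longrightarrow>
           (\<exists>C. \<forall>x\<in>Xs. \<forall>q\<in>Qs. \<forall>z1\<in>{z. \<bar>z - mu0 x q\<bar> \<le> r}. \<forall>z2\<in>{z. \<bar>z - mu0 x q\<bar> \<le> r}. \<forall>l\<in>{0..1}.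
              (\<forall>y\<in>Ys - ?I z1 z2. ?incr y z1 z2 l q \<le> C * \<bar>z1 - z2\<bar> powr \<alpha>) \<and>
              (\<forall>y\<in>Ys \<inter> ?I z1 z2. ?incr y z1 z2 l q \<le> C))"
    using r' by (elim conjE)
  have B: "N \<noteq> lborel \<longrightarrow>
           (\<exists>C. \<forall>x\<in>Xs. \<forall>q\<in>Qs. \<forall>z1\<in>{z. \<bar>z - mu0 x q\<bar> \<le> r}. \<forall>z2\<in>{z. \<bar>z - mu0 x q\<bar> \<le> r}. \<forall>l\<in>{0..1}.
              \<forall>y\<in>Ys. ?incr y z1 z2 l q \<le> C * \<bar>z1 - z2\<bar> powr \<alpha>)"
    using r' by (elim conjE)
  have C2: "\<forall>x\<in>Xs. \<forall>q\<in>Qs. (\<forall>e\<in>Es. cond_integrable N fYX (\<lambda>y. psi y e q) x) \<and>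
            twice_cont_diff_on Es (\<lambda>e. Psi N fYX psi x e q)"
    using r' by (elim conjE)
  have D: "\<forall>k\<in>{1,2}. \<exists>C. \<forall>x\<in>Xs. \<forall>q\<in>Qs. \<forall>z\<in>{z. \<bar>z - mu0 x q\<bar> \<le> r}.
            \<bar>Psi_deriv k N fYX psi x (eta z) q\<bar> \<le> C"
    using r' by (elim conjE)
  have E: "\<exists>c>0. \<forall>x\<in>Xs. \<forall>q\<in>Qs. \<forall>z\<in>{z. \<bar>z - mu0 x q\<bar> \<le> r}.
            c \<le> Psi_deriv 1 N fYX psi x (eta z) q * (deriv eta z)\<^sup>2"
    using r' by (elim conjE)
  have "\<exists>C. \<forall>x\<in>Xs. \<forall>q\<in>Qs. \<forall>z. \<bar>z - mu0 x q\<bar> \<le> r \<longrightarrow> (\<forall>y\<in>Ys.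
       \<bar>psi y (eta z) q - psi y (eta (mu0 x q)) q\<bar> \<le> C)"
  proof -
    \<comment> \<open>The argument 0 is the convex weight: then the first point is \<open>z\<close>
      itself, compared directly with \<open>mu0 x q\<close>.\<close>
    obtain C where C: "\<And>x q z y. x \<in> Xs \<Longrightarrow> q \<in> Qs \<Longrightarrow> \<bar>z - mu0 x q\<bar> \<le> r \<Longrightarrow> y \<in> Ys \<Longrightarrow>
       ?incr y z (mu0 x q) 0 q \<le> C * \<bar>z - mu0 x q\<bar> powr \<alpha> \<or> ?incr y z (mu0 x q) 0 q \<le> C"
    proof (cases "N = lborel")
      case True
      with A obtain C where C: "\<forall>x\<in>Xs. \<forall>q\<in>Qs. \<forall>z1\<in>{z. \<bar>z - mu0 x q\<bar> \<le> r}. \<forall>z2\<in>{z. \<bar>z - mu0 x q\<bar> \<le> r}. \<forall>l\<in>{0..1}.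
              (\<forall>y\<in>Ys - ?I z1 z2. ?incr y z1 z2 l q \<le> C * \<bar>z1 - z2\<bar> powr \<alpha>) \<and>
              (\<forall>y\<in>Ys \<inter> ?I z1 z2. ?incr y z1 z2 l q \<le> C)" by blast
      show ?thesis
      proof (rule that[of C])
        fix x q z y assume h: "x \<in> Xs" "q \<in> Qs" "\<bar>z - mu0 x q\<bar> \<le> r" "y \<in> Ys"
        have m: "mu0 x q \<in> {z. \<bar>z - mu0 x q\<bar> \<le> r}" using r by simp
        have z: "z \<in> {z. \<bar>z - mu0 x q\<bar> \<le> r}" using h by simp
        have "(\<forall>y\<in>Ys - ?I z (mu0 x q). ?incr y z (mu0 x q) 0 q \<le> C * \<bar>z - mu0 x q\<bar> powr \<alpha>) \<and>
              (\<forall>y\<in>Ys \<inter> ?I z (mu0 x q). ?incr y z (mu0 x q) 0 q \<le> C)"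
          using C[rule_format, OF h(1,2) z m, of 0] by simp
        then show "?incr y z (mu0 x q) 0 q \<le> C * \<bar>z - mu0 x q\<bar> powr \<alpha> \<or> ?incr y z (mu0 x q) 0 q \<le> C"
          using h(4) by blast
      qed
    next
      case False
      with B obtain C where C: "\<forall>x\<in>Xs. \<forall>q\<in>Qs. \<forall>z1\<in>{z. \<bar>z - mu0 x q\<bar> \<le> r}. \<forall>z2\<in>{z. \<bar>z - mu0 x q\<bar> \<le> r}. \<forall>l\<in>{0..1}.
              \<forall>y\<in>Ys. ?incr y z1 z2 l q \<le> C * \<bar>z1 - z2\<bar> powr \<alpha>" by blast
      show ?thesis
      proof (rule that[of C])
        fix x q z y assume h: "x \<in> Xs" "q \<in> Qs" "\<bar>z - mu0 x q\<bar> \<le> r" "y \<in> Ys"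
        have m: "mu0 x q \<in> {z. \<bar>z - mu0 x q\<bar> \<le> r}" using r by simp
        have z: "z \<in> {z. \<bar>z - mu0 x q\<bar> \<le> r}" using h by simp
        show "?incr y z (mu0 x q) 0 q \<le> C * \<bar>z - mu0 x q\<bar> powr \<alpha> \<or> ?incr y z (mu0 x q) 0 q \<le> C"
          using C[rule_format, OF h(1,2) z m, of 0 y] h(4) by simp
      qed
    qed
    have "\<bar>psi y (eta z) q - psi y (eta (mu0 x q)) q\<bar> \<le> \<bar>C\<bar> * (r powr \<alpha> + 1)"
      if h: "x \<in> Xs" "q \<in> Qs" "\<bar>z - mu0 x q\<bar> \<le> r" "y \<in> Ys" for x q z y
    proof -
      have "C * \<bar>z - mu0 x q\<bar> powr \<alpha> \<le> \<bar>C\<bar> * (r powr \<alpha> + 1)"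
        using powr_mono2[of \<alpha> "\<bar>z - mu0 x q\<bar>" r] alpha_pos h(3)
        by (intro mult_mono) auto
      moreover have "C \<le> \<bar>C\<bar> * (r powr \<alpha> + 1)"
        using mult_left_mono[of 1 "r powr \<alpha> + 1" "\<bar>C\<bar>"] by simp
      ultimately show ?thesis using C[OF h, simplified] by linarith
    qed
    then show ?thesis by (intro exI[of _ "\<bar>C\<bar> * (r powr \<alpha> + 1)"]) blast
  qed
  then obtain C1 where C1: "\<And>x q z y. x \<in> Xs \<Longrightarrow> q \<in> Qs \<Longrightarrow> \<bar>z - mu0 x q\<bar> \<le> r \<Longrightarrow> y \<in> Ys \<Longrightarrow>
       \<bar>psi y (eta z) q - psi y (eta (mu0 x q)) q\<bar> \<le> C1" by blast
  obtain C' where C': "\<And>x q z. x \<in> Xs \<Longrightarrow> q \<in> Qs \<Longrightarrow> \<bar>z - mu0 x q\<bar> \<le> r \<Longrightarrow> \<bar>Psi_deriv 1 N fYX psi x (eta z) q\<bar> \<le> C'"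
  proof -
    have "\<exists>C. \<forall>x\<in>Xs. \<forall>q\<in>Qs. \<forall>z\<in>{z. \<bar>z - mu0 x q\<bar> \<le> r}. \<bar>Psi_deriv 1 N fYX psi x (eta z) q\<bar> \<le> C"
      using D by (rule bspec) simp
    then show thesis by (elim exE) (rule that, blast)
  qed
  obtain c where c: "c > 0" "\<And>x q z. x \<in> Xs \<Longrightarrow> q \<in> Qs \<Longrightarrow> \<bar>z - mu0 x q\<bar> \<le> r \<Longrightarrow>
       c \<le> Psi_deriv 1 N fYX psi x (eta z) q * (deriv eta z)\<^sup>2"
    using E by (auto simp: Ball_def)
  show ?thesis
  proof (rule that[of r c "max 1 (max C1 C')"])
    fix x q z y assume h: "x \<in> Xs" "q \<in> Qs" "\<bar>z - mu0 x q\<bar> \<le> r"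
    show "\<bar>Psi_deriv 1 N fYX psi x (eta z) q\<bar> \<le> max 1 (max C1 C')" using C'[OF h] by linarith
    assume "y \<in> Ys"
    then show "\<bar>psi y (eta z) q - psi y (eta (mu0 x q)) q\<bar> \<le> max 1 (max C1 C')" using C1[OF h, of y] by linarith
  qed (use r c C2 in auto)
qed

text \<open>The derivative of the loss in \<open>e\<close>, away from \<open>e = y\<close>.\<close>

definition phi :: "(nat \<Rightarrow> real) \<Rightarrow> (real \<Rightarrow> real \<Rightarrow> real) \<Rightarrow> real \<Rightarrow> real \<Rightarrow> real \<Rightarrow> real" where
  "phi D tau y e q = D 1 * of_bool (y \<le> e) + D 2 * of_bool (y \<le> q) + D 3 * q + tau y e"

text \<open>Brings the existential witnesses of the simplified setup into the form in which they can
  instantiate the parameters of \<open>explicit_regular_loss\<close>.\<close>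

lemma explicit_loss:
  obtains f :: "nat \<Rightarrow> real \<Rightarrow> real" and D :: "nat \<Rightarrow> real" and T tau :: "real \<Rightarrow> real \<Rightarrow> real" where
    "\<And>j. j \<in> {1,2,3} \<Longrightarrow> continuous_on Ys (f j)"
    "continuous_on (Ys \<times> Es) (\<lambda>(y, e). T y e)"
    "\<And>y e q. y \<in> Ys \<Longrightarrow> e \<in> Es \<Longrightarrow> q \<in> Qs \<Longrightarrow>
       rho y e q = (f 1 y + D 1 * e) * of_bool (y \<le> e) + (f 2 y + D 2 * e) * of_bool (y \<le> q)
             + (f 3 y + D 3 * e) * q + T y e"
    "\<And>y e. y \<in> Ys \<Longrightarrow> e \<in> Es \<Longrightarrow> (T y has_real_derivative tau y e) (at e)"
    "\<And>A. compact A \<Longrightarrow> A \<subseteq> Es \<Longrightarrow> \<exists>L. \<forall>e1\<in>A. \<forall>e2\<in>A. \<forall>y\<in>Ys. \<bar>tau y e1 - tau y e2\<bar> \<le> L * \<bar>e1 - e2\<bar> powr \<alpha>"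
proof -
  have "\<exists>(f :: nat \<Rightarrow> real \<Rightarrow> real) (D :: nat \<Rightarrow> real) (T :: real \<Rightarrow> real \<Rightarrow> real) (tau :: real \<Rightarrow> real \<Rightarrow> real).
        (\<forall>j\<in>{1,2,3}. continuous_on Ys (f j)) \<and>
        continuous_on (Ys \<times> Es) (\<lambda>(y, e). T y e) \<and>
        (\<forall>y\<in>Ys. \<forall>e\<in>Es. \<forall>q\<in>Qs.
           rho y e q = (f 1 y + D 1 * e) * of_bool (y \<le> e) + (f 2 y + D 2 * e) * of_bool (y \<le> q)
             + (f 3 y + D 3 * e) * q + T y e) \<and>
        (\<forall>y\<in>Ys. \<forall>e\<in>Es. (T y has_real_derivative tau y e) (at e)) \<and>
        (\<forall>A. compact A \<and> A \<subseteq> Es \<longrightarrow>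
          (\<exists>L. \<forall>e1\<in>A. \<forall>e2\<in>A. \<forall>y\<in>Ys. \<bar>tau y e1 - tau y e2\<bar> \<le> L * \<bar>e1 - e2\<bar> powr \<alpha>))"
    using simplified[unfolded simplified_setup_def, THEN conjunct2]
    apply (elim exE conjE)
    subgoal for f D T tau taubar
      apply (rule exI[of _ f], rule exI[of _ D], rule exI[of _ T], rule exI[of _ tau])
      apply (intro conjI)
          apply assumption
         apply assumption
        apply assumption
       apply assumption
      apply (intro allI impI)
      subgoal premises prems for A
        using prems(10)[rule_format, OF prems(16)] by (elim exE, intro exI) blast
      done
    done
  then show thesis
    by (elim exE conjE) (rule that, auto)
qed

lemma image_eta_subset: "eta ` S \<subseteq> Es"
  using eta_Es by blast

text \<open>Integrals of the derivative of the loss between two points of the image of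
  \<open>eta\<close> stay in this compact image, where the bounds are uniform.\<close>

lemma eta_interval:
  assumes "a \<in> eta ` {-W..W}" "b \<in> eta ` {-W..W}"
  shows "closed_segment a b \<subseteq> eta ` {-W..W}"
proof -
  obtain z1 z2 where z: "a = eta z1" "b = eta z2" "z1 \<in> {-W..W}" "z2 \<in> {-W..W}"
    using assms by auto
  have "closed_segment a b \<subseteq> eta ` closed_segment z1 z2"
    unfolding z by (rule closed_segment_subset_image[OF eta_cont])
  also have "closed_segment z1 z2 \<subseteq> {-W..W}"
    using z by (intro closed_segment_subset) auto
  finally show ?thesis by (simp add: image_mono)
qed

end

text \<open>The pieces of the loss are parameters here so that several lemmas can share them;
  \<open>loss_bounds\<close> instantiates them and returns to statements in which they no longer
  occur.\<close>

locale explicit_regular_loss = regular_loss +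
  fixes f :: "nat \<Rightarrow> real \<Rightarrow> real" and D :: "nat \<Rightarrow> real" and T tau :: "real \<Rightarrow> real \<Rightarrow> real"
  assumes f_cont: "\<And>j. j \<in> {1,2,3} \<Longrightarrow> continuous_on Ys (f j)"
    and T_cont: "continuous_on (Ys \<times> Es) (\<lambda>(y, e). T y e)"
    and rho_eq: "\<And>y e q. y \<in> Ys \<Longrightarrow> e \<in> Es \<Longrightarrow> q \<in> Qs \<Longrightarrow>
       rho y e q = (f 1 y + D 1 * e) * of_bool (y \<le> e) + (f 2 y + D 2 * e) * of_bool (y \<le> q)
             + (f 3 y + D 3 * e) * q + T y e"
    and T_deriv: "\<And>y e. y \<in> Ys \<Longrightarrow> e \<in> Es \<Longrightarrow> (T y has_real_derivative tau y e) (at e)"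
    and tau_holder: "\<And>A. compact A \<Longrightarrow> A \<subseteq> Es \<Longrightarrow>
       \<exists>L. \<forall>e1\<in>A. \<forall>e2\<in>A. \<forall>y\<in>Ys. \<bar>tau y e1 - tau y e2\<bar> \<le> L * \<bar>e1 - e2\<bar> powr \<alpha>"
begin

lemma rho_deriv:
  assumes y: "y \<in> Ys" and q: "q \<in> Qs" and e: "e \<in> Es" and neq: "e \<noteq> y"
  shows "((\<lambda>e. rho y e q) has_real_derivative phi D tau y e q) (at e)"
proof -
  \<comment> \<open>On this neighbourhood of \<open>e\<close>, which avoids \<open>y\<close>, the
    indicator of \<open>y \<le> e\<close> is constant.\<close>
  define S where "S = Es \<inter> (if e < y then {..<y} else {y<..})"
  have S: "open S" "e \<in> S" "S \<subseteq> Es" using open_Es e neq unfolding S_def by (auto split: if_splits)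
  have "((\<lambda>x. (f 1 y + D 1 * x) * of_bool (y \<le> e) + (f 2 y + D 2 * x) * of_bool (y \<le> q)
             + (f 3 y + D 3 * x) * q + T y x) has_real_derivative phi D tau y e q) (at e)"
    unfolding phi_def by (auto intro!: derivative_eq_intros T_deriv y e)
  then show ?thesis
  proof (rule has_field_derivative_transform_within_open[OF _ S(1,2)])
    fix x assume x: "x \<in> S"
    then have "of_bool (y \<le> x) = (of_bool (y \<le> e) :: real)"
      unfolding S_def by (auto split: if_splits)
    then show "(f 1 y + D 1 * x) * of_bool (y \<le> e) + (f 2 y + D 2 * x) * of_bool (y \<le> q)
             + (f 3 y + D 3 * x) * q + T y x = rho y x q"
      using x S(3) rho_eq[OF y _ q, of x] by auto
  qed
qed

text \<open>Both are derivatives of \<open>rho\<close> in \<open>e\<close>, hence equal wherever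
  both exist. The exceptional null set varies with \<open>y\<close> and \<open>q\<close>.\<close>

lemma phi_eq_psi:
  assumes y: "y \<in> Ys" and q: "q \<in> Qs"
  shows "AE e in lborel. e \<in> Es \<longrightarrow> phi D tau y e q = psi y e q"
proof -
  have "AE e in lborel. e \<noteq> y" by (rule AE_lborel_singleton)
  with rho_AE[OF q y] show ?thesis
    by eventually_elim (blast intro: DERIV_unique rho_deriv y q)
qed

text \<open>The envelope bounds \<open>psi\<close> at \<open>mu0 x q\<close>, and the local
  conditions carry the bound over the ball. The image of the ball under \<open>eta\<close> has
  positive length, hence contains a point where \<open>phi\<close> and \<open>psi\<close> agree.
  There \<open>tau\<close> is at most the envelope plus a constant, and Hoelder continuity
  transports this to the whole compact image. Nonemptiness of \<open>Qs\<close> supplies the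
  \<open>q\<close> at which the comparison is made.\<close>

lemma tau_bound: "\<exists>C\<ge>0. \<forall>x\<in>Xs. \<forall>y\<in>Ys. \<forall>e\<in>eta ` {-W..W}. Qs \<noteq> {} \<longrightarrow> \<bar>tau y e\<bar> \<le> psibar x y + C"
proof -
  obtain r C c where r: "r > 0" and C: "C > 0" and
    loc: "\<And>x q z y. x \<in> Xs \<Longrightarrow> q \<in> Qs \<Longrightarrow> \<bar>z - mu0 x q\<bar> \<le> r \<Longrightarrow> y \<in> Ys \<Longrightarrow>
       \<bar>psi y (eta z) q - psi y (eta (mu0 x q)) q\<bar> \<le> C"
    by (rule local_facts) blast
  \<comment> \<open>Large enough for the requested interval and for every ball around a value of
    \<open>mu0\<close>.\<close>
  define V where "V = max W (\<bar>B0\<bar> + r)"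
  define A where "A = eta ` {-V..V}"
  have A: "compact A" "A \<subseteq> Es"
    unfolding A_def by (auto intro!: compact_continuous_image eta_cont eta_Es)
  obtain L where L: "\<And>e1 e2 y. e1 \<in> A \<Longrightarrow> e2 \<in> A \<Longrightarrow> y \<in> Ys \<Longrightarrow> \<bar>tau y e1 - tau y e2\<bar> \<le> L * \<bar>e1 - e2\<bar> powr \<alpha>"
    using tau_holder[OF A] by blast
  obtain B where B: "B > 0" "\<And>e. e \<in> A \<Longrightarrow> \<bar>e\<bar> \<le> B"
    using compact_imp_bounded[OF A(1)] by (auto simp: bounded_pos)
  obtain Q where Q: "Q \<ge> 0" "\<And>q. q \<in> Qs \<Longrightarrow> \<bar>q\<bar> \<le> Q" using Qs_bounded by blast
  define C' where "C' = C + \<bar>D 1\<bar> + \<bar>D 2\<bar> + \<bar>D 3\<bar> * Q + \<bar>L\<bar> * (2 * B) powr \<alpha>"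
  have L': "\<bar>tau y e1 - tau y e2\<bar> \<le> \<bar>L\<bar> * (2 * B) powr \<alpha>" if "e1 \<in> A" "e2 \<in> A" "y \<in> Ys" for e1 e2 y
  proof -
    have "\<bar>e1 - e2\<bar> \<le> 2 * B" using B(2)[of e1] B(2)[of e2] that by linarith
    then have "L * \<bar>e1 - e2\<bar> powr \<alpha> \<le> \<bar>L\<bar> * (2 * B) powr \<alpha>"
      using alpha_pos by (intro mult_mono powr_mono2) auto
    with L[OF that] show ?thesis by linarith
  qed
  have "\<bar>tau y e\<bar> \<le> psibar x y + C'" if x: "x \<in> Xs" and y: "y \<in> Ys" and e: "e \<in> eta ` {-W..W}" and q: "q \<in> Qs" for x y e q
  proof -
    let ?m = "mu0 x q"
    define l u where "l = min (eta (?m - r)) (eta (?m + r))" and "u = max (eta (?m - r)) (eta (?m + r))"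
    have lu: "l < u" using eta_neq[of "?m - r" "?m + r"] r unfolding l_def u_def by auto
    have sub: "{l<..<u} \<subseteq> eta ` {?m - r..?m + r}"
    proof -
      have "{l<..<u} \<subseteq> closed_segment (eta (?m - r)) (eta (?m + r))"
        unfolding l_def u_def by (auto simp: closed_segment_eq_real_ivl)
      also have "\<dots> \<subseteq> eta ` closed_segment (?m - r) (?m + r)"
        by (rule closed_segment_subset_image[OF eta_cont])
      finally show ?thesis using r by (simp add: closed_segment_eq_real_ivl)
    qed
    obtain e' where e': "e' \<in> {l<..<u}" "e' \<in> Es \<longrightarrow> phi D tau y e' q = psi y e' q"
      using AE_lborel_ex_in_interval[OF phi_eq_psi[OF y q] lu] by blast
    then obtain z where z: "e' = eta z" "z \<in> {?m - r..?m + r}" using sub by blast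
    have zr: "\<bar>z - ?m\<bar> \<le> r" using z by auto
    have "z \<in> {-V..V}" using z mu0_bound[OF x q] unfolding V_def by auto
    then have e'A: "e' \<in> A" unfolding A_def z by blast
    have eA: "e \<in> A" using e unfolding A_def V_def by (elim imageE) (auto intro!: imageI)
    have "phi D tau y e' q = psi y e' q" using e' e'A A(2) by blast
    then have "\<bar>phi D tau y e' q\<bar> \<le> psibar x y + C"
      using loc[OF x q zr y] psi_le_psibar[OF x y q] unfolding z by linarith
    moreover have "\<bar>tau y e'\<bar> \<le> \<bar>phi D tau y e' q\<bar> + \<bar>D 1\<bar> + \<bar>D 2\<bar> + \<bar>D 3\<bar> * Q"
    proof -
      have "\<bar>D 1 * of_bool (y \<le> e')\<bar> \<le> \<bar>D 1\<bar>" "\<bar>D 2 * of_bool (y \<le> q)\<bar> \<le> \<bar>D 2\<bar>" by auto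
      moreover have "\<bar>D 3 * q\<bar> \<le> \<bar>D 3\<bar> * Q" unfolding abs_mult by (intro mult_left_mono Q q) simp
      ultimately show ?thesis unfolding phi_def by linarith
    qed
    ultimately show ?thesis using L'[OF eA e'A y] unfolding C'_def by linarith
  qed
  moreover have "C' \<ge> 0" using C Q unfolding C'_def by simp
  ultimately show ?thesis by (intro exI[of _ C']) blast
qed

lemma phi_bound: "\<exists>C\<ge>0. \<forall>x\<in>Xs. \<forall>y\<in>Ys. \<forall>e\<in>eta ` {-W..W}. \<forall>q\<in>Qs. \<bar>phi D tau y e q\<bar> \<le> psibar x y + C"
proof -
  obtain C where C: "C \<ge> 0" "\<And>x y e. x \<in> Xs \<Longrightarrow> y \<in> Ys \<Longrightarrow> e \<in> eta ` {-W..W} \<Longrightarrow> Qs \<noteq> {} \<Longrightarrow> \<bar>tau y e\<bar> \<le> psibar x y + C"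
    using tau_bound[of W] by blast
  obtain Q where Q: "Q \<ge> 0" "\<And>q. q \<in> Qs \<Longrightarrow> \<bar>q\<bar> \<le> Q" using Qs_bounded by blast
  have "\<bar>phi D tau y e q\<bar> \<le> psibar x y + (C + \<bar>D 1\<bar> + \<bar>D 2\<bar> + \<bar>D 3\<bar> * Q)"
    if h: "x \<in> Xs" "y \<in> Ys" "e \<in> eta ` {-W..W}" and q: "q \<in> Qs" for x y e q
  proof -
    have "\<bar>D 1 * of_bool (y \<le> e)\<bar> \<le> \<bar>D 1\<bar>" "\<bar>D 2 * of_bool (y \<le> q)\<bar> \<le> \<bar>D 2\<bar>" by auto
    moreover have "\<bar>D 3 * q\<bar> \<le> \<bar>D 3\<bar> * Q" unfolding abs_mult by (intro mult_left_mono Q q) simp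
    moreover have "\<bar>tau y e\<bar> \<le> psibar x y + C" using C(2)[OF h] q by blast
    ultimately show ?thesis unfolding phi_def by linarith
  qed
  then show ?thesis using C(1) Q(1) by (intro exI[of _ "C + \<bar>D 1\<bar> + \<bar>D 2\<bar> + \<bar>D 3\<bar> * Q"]) auto
qed

text \<open>The indicator in \<open>rho\<close> could produce a jump at \<open>e = y\<close>, but
  absolute continuity excludes it. The fundamental theorem therefore applies with the single
  exceptional point \<open>y\<close>.\<close>

lemma rho_has_integral:
  assumes y: "y \<in> Ys" and q: "q \<in> Qs" and ab: "a \<le> b" "{a..b} \<subseteq> Es"
  shows "((\<lambda>e. phi D tau y e q) has_integral (rho y b q - rho y a q)) {a..b}"
proof (rule fundamental_theorem_of_calculus_interior_strong[of "{y}" a b "\<lambda>e. rho y e q"])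
  fix x assume "x \<in> {a<..<b} - {y}"
  then show "((\<lambda>e. rho y e q) has_vector_derivative phi D tau y x q) (at x)"
    using rho_deriv[OF y q, of x] subsetD[OF ab(2), of x]
    by (auto simp: has_real_derivative_iff_has_vector_derivative)
qed (use ab rho_cont[OF q y ab] in auto)

text \<open>Integrates the bound on \<open>phi\<close>. The summand 1 next to the envelope absorbs
  the constant: psibar + C \<le> (C + 1) (psibar + 1).\<close>

lemma rho_lipschitz:
  "\<exists>C>0. \<forall>x\<in>Xs. \<forall>q\<in>Qs. \<forall>y\<in>Ys. \<forall>a\<in>eta ` {-W..W}. \<forall>b\<in>eta ` {-W..W}.
     \<bar>rho y a q - rho y b q\<bar> \<le> C * (psibar x y + 1) * \<bar>a - b\<bar>"
proof -
  obtain C where C: "C \<ge> 0" "\<And>x y e q. x \<in> Xs \<Longrightarrow> y \<in> Ys \<Longrightarrow> e \<in> eta ` {-W..W} \<Longrightarrow> q \<in> Qs \<Longrightarrow> \<bar>phi D tau y e q\<bar> \<le> psibar x y + C"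
    using phi_bound[of W] by blast
  have *: "\<bar>rho y b q - rho y a q\<bar> \<le> (C + 1) * (psibar x y + 1) * (b - a)"
    if h: "x \<in> Xs" "q \<in> Qs" "y \<in> Ys" "a \<in> eta ` {-W..W}" "b \<in> eta ` {-W..W}" and ab: "a \<le> b" for x q y a b
  proof -
    have sub: "{a..b} \<subseteq> eta ` {-W..W}" using eta_interval[OF h(4,5)] ab by (simp add: closed_segment_eq_real_ivl)
    have pos: "0 < psibar x y" by (rule psibar_pos[OF h(1,3)])
    have le: "psibar x y + C \<le> (C + 1) * (psibar x y + 1)" using pos C(1) by (simp add: algebra_simps)
    have "norm (rho y b q - rho y a q) \<le> (C + 1) * (psibar x y + 1) * measure lborel (cbox a b)"
    proof (rule has_integral_bound)
      show "((\<lambda>e. phi D tau y e q) has_integral rho y b q - rho y a q) (cbox a b)"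
        using rho_has_integral[OF h(3,2) ab order.trans[OF sub image_eta_subset]] by simp
      show "norm (phi D tau y e q) \<le> (C + 1) * (psibar x y + 1)" if "e \<in> cbox a b" for e
        using C(2)[OF h(1,3) _ h(2), of e] that sub le by force
    qed (use C(1) pos in simp)
    then show ?thesis using ab by simp
  qed
  have "\<bar>rho y a q - rho y b q\<bar> \<le> (C + 1) * (psibar x y + 1) * \<bar>a - b\<bar>"
    if h: "x \<in> Xs" "q \<in> Qs" "y \<in> Ys" "a \<in> eta ` {-W..W}" "b \<in> eta ` {-W..W}" for x q y a b
  proof (cases "a \<le> b")
    case True
    then show ?thesis using *[OF h] by (simp add: abs_minus_commute)
  next
    case False
    then show ?thesis using *[OF h(1-3,5,4)] by simp
  qed
  then show ?thesis using C(1) by (intro exI[of _ "C + 1"]) simp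
qed

text \<open>All terms depending on \<open>y\<close> and \<open>q\<close> alone or on
  \<open>y\<close> and \<open>e\<close> alone cancel in the double difference. The remainder is
  bounded in \<open>y\<close>: moving \<open>q\<close> costs no factor of the envelope, only a count
  of the observations between the two values of \<open>q\<close>.\<close>

lemma rho_diff_q:
  assumes y: "y \<in> Ys" and e: "a \<in> Es" "b \<in> Es" and q: "q \<in> Qs" "q' \<in> Qs"
  shows "(rho y a q - rho y b q) - (rho y a q' - rho y b q') =
    (a - b) * (D 2 * (of_bool (y \<le> q) - of_bool (y \<le> q')) + D 3 * (q - q'))"
  using y e q by (simp add: rho_eq algebra_simps)

lemma rho_meas:
  assumes q: "q \<in> Qs"
  shows "(\<lambda>(y, e). rho y e q) \<in> borel_measurable (restrict_space borel (Ys \<times> Es))"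
proof -
  define R where "R = (restrict_space borel (Ys \<times> Es) :: (real \<times> real) measure)"
  have fm: "(\<lambda>p. f j (fst p)) \<in> borel_measurable R" if "j \<in> {1,2,3}" for j
    unfolding R_def
    by (intro borel_measurable_continuous_on_restrict continuous_on_compose2[OF f_cont[OF that]])
       (auto intro!: continuous_intros)
  have [measurable]: "(\<lambda>p. f 1 (fst p)) \<in> borel_measurable R" "(\<lambda>p. f 2 (fst p)) \<in> borel_measurable R"
    "(\<lambda>p. f 3 (fst p)) \<in> borel_measurable R" by (rule fm; simp)+
  have [measurable]: "(\<lambda>p. T (fst p) (snd p)) \<in> borel_measurable R"
    using T_cont unfolding R_def by (intro borel_measurable_continuous_on_restrict) (simp add: case_prod_unfold)
  have [measurable]: "fst \<in> borel_measurable R" "snd \<in> borel_measurable R"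
    unfolding R_def by (auto intro!: borel_measurable_continuous_on_restrict continuous_intros)
  have "(\<lambda>p. (f 1 (fst p) + D 1 * snd p) * of_bool (fst p \<le> snd p) + (f 2 (fst p) + D 2 * snd p) * of_bool (fst p \<le> q)
             + (f 3 (fst p) + D 3 * snd p) * q + T (fst p) (snd p)) \<in> borel_measurable R"
    by measurable
  then show ?thesis unfolding R_def
    by (rule measurable_cong[THEN iffD1, rotated]) (auto simp: space_restrict_space rho_eq q)
qed

end

section \<open>Moments of the envelope and differentiability of \<open>Psi\<close>\<close>

context regular_loss begin

text \<open>A Borel subset of \<open>Ys\<close> that carries the conditional distribution; it stands
  in for \<open>Ys\<close> wherever measurability in \<open>y\<close> is required.\<close>

lemma fYX_support_borel [measurable]:
  assumes x: "x \<in> Xs"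
  shows "{y. fYX x y \<noteq> 0} \<in> sets borel"
proof -
  note [measurable] = fYX_meas[OF x]
  show ?thesis by measurable
qed

lemma psibar_section:
  assumes x: "x \<in> Xs"
  shows "(\<lambda>y. psibar x y * indicator {y. fYX x y \<noteq> 0} y) \<in> borel_measurable borel"
proof (rule borel_measurable_indicator_restrict)
  show "psibar x \<in> borel_measurable (restrict_space borel Ys)"
  proof -
    have "(\<lambda>y. (x, y)) \<in> measurable (restrict_space borel Ys) (restrict_space borel (Xs \<times> Ys))"
      using x by (intro measurable_restrict_space3) auto
    from measurable_compose[OF this psibar_meas] show ?thesis by simp
  qed
  show "{y. fYX x y \<noteq> 0} \<subseteq> Ys" using fYX_Ys[OF x] by blast
qed (rule fYX_support_borel[OF x])

lemma powr_dominates_square: "0 < (t::real) \<Longrightarrow> t\<^sup>2 \<le> 1 + t powr \<nu>"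
proof (cases "t \<le> 1")
  case True
  assume "0 < t"
  then have "t\<^sup>2 \<le> 1" using True by (simp add: power_le_one_iff)
  then show ?thesis by (simp add: add_increasing2)
next
  case False
  assume "0 < t"
  then have "t\<^sup>2 = t powr 2" by simp
  also have "\<dots> \<le> t powr \<nu>" using False nu_gt_2 by (intro powr_mono) auto
  finally show ?thesis by simp
qed

text \<open>Since \<nu> > 2, the square of the envelope is at most 1 plus its \<nu>-th power;
  (psibar + 1)^2 \<le> 2 psibar^2 + 2 then gives the constant 4 + 2 C. This is the conditional
  moment behind the comparison of E d^2 with \<open>s\<close>.\<close>

lemma psibar_second_moment:
  "\<exists>C\<ge>0. \<forall>x\<in>Xs. (\<integral>\<^sup>+y. ennreal ((psibar x y + 1)\<^sup>2 * fYX x y) \<partial>N) \<le> ennreal C"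
proof -
  obtain C where C: "C \<ge> 0" "\<And>x. x \<in> Xs \<Longrightarrow> cond_nn_expect N fYX (\<lambda>y. psibar x y powr \<nu>) x \<le> ennreal C"
  proof -
    obtain C where C: "\<And>x. x \<in> Xs \<Longrightarrow> cond_nn_expect N fYX (\<lambda>y. psibar x y powr \<nu>) x \<le> ennreal C"
      using psibar_moment by blast
    show thesis
    proof (rule that[of "max C 0"])
      show "cond_nn_expect N fYX (\<lambda>y. psibar x y powr \<nu>) x \<le> ennreal (max C 0)" if "x \<in> Xs" for x
        by (rule order.trans[OF C[OF that] ennreal_leI]) simp
    qed simp
  qed
  have "(\<integral>\<^sup>+y. ennreal ((psibar x y + 1)\<^sup>2 * fYX x y) \<partial>N) \<le> ennreal (4 + 2 * C)" if x: "x \<in> Xs" for x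
  proof -
    note [measurable] = fYX_meas[OF x] psibar_section[OF x] fYX_support_borel[OF x]
    let ?i = "indicator {y. fYX x y \<noteq> 0} :: real \<Rightarrow> real"
    \<comment> \<open>Where the density vanishes both integrands are zero, so the envelope may be
      replaced by its measurable cut-off.\<close>
    have eq: "psibar x y powr \<nu> * fYX x y = (psibar x y * ?i y) powr \<nu> * fYX x y" for y
      by (simp add: indicator_def)
    have "(\<integral>\<^sup>+y. ennreal ((psibar x y + 1)\<^sup>2 * fYX x y) \<partial>N) \<le>
        (\<integral>\<^sup>+y. ennreal 4 * ennreal (fYX x y) + ennreal 2 * ennreal ((psibar x y * ?i y) powr \<nu> * fYX x y) \<partial>N)"
    proof (intro nn_integral_mono)
      fix y
      have "(psibar x y + 1)\<^sup>2 * fYX x y \<le> 4 * fYX x y + 2 * (psibar x y powr \<nu> * fYX x y)"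
      proof (cases "fYX x y = 0")
        case False
        then have "0 < psibar x y" using psibar_pos[OF x] fYX_Ys[OF x] by blast
        then have "(psibar x y)\<^sup>2 \<le> 1 + psibar x y powr \<nu>" by (rule powr_dominates_square)
        moreover have "(psibar x y + 1)\<^sup>2 \<le> 2 * (psibar x y)\<^sup>2 + 2"
          using zero_le_power2[of "psibar x y - 1"] by (simp add: power2_eq_square algebra_simps)
        ultimately have "(psibar x y + 1)\<^sup>2 \<le> 4 + 2 * psibar x y powr \<nu>" by linarith
        from mult_right_mono[OF this fYX_nonneg[OF x, of y]] show ?thesis by (simp add: algebra_simps)
      qed simp
      then show "ennreal ((psibar x y + 1)\<^sup>2 * fYX x y) \<le>
        ennreal 4 * ennreal (fYX x y) + ennreal 2 * ennreal ((psibar x y * ?i y) powr \<nu> * fYX x y)"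
        using fYX_nonneg[OF x, of y] unfolding eq
        by (subst ennreal_mult[symmetric], simp, simp)+
           (auto simp: ennreal_plus[symmetric] simp del: ennreal_plus intro!: ennreal_leI)
    qed
    also have "\<dots> = ennreal 4 * (\<integral>\<^sup>+y. ennreal (fYX x y) \<partial>N) +
        ennreal 2 * (\<integral>\<^sup>+y. ennreal (psibar x y powr \<nu> * fYX x y) \<partial>N)"
      unfolding eq by (subst nn_integral_add) (auto simp: nn_integral_cmult)
    also have "\<dots> \<le> ennreal 4 * 1 + ennreal 2 * ennreal C"
      using C(2)[OF x] unfolding cond_nn_expect_def fYX_total[OF x]
      by (intro add_mono mult_left_mono) auto
    also have "\<dots> = ennreal (4 + 2 * C)"
    proof -
      have "ennreal (4 + 2 * C) = ennreal 4 + ennreal (2 * C)" using C(1) by (intro ennreal_plus) auto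
      also have "ennreal (2 * C) = ennreal 2 * ennreal C" using C(1) by (intro ennreal_mult) auto
      finally show ?thesis by (simp only: mult_1_right)
    qed
    finally show ?thesis .
  qed
  then show ?thesis by (intro exI[of _ "4 + 2 * C"]) (use C(1) in auto)
qed

lemma fYX_integrable: "x \<in> Xs \<Longrightarrow> integrable N (fYX x)"
  using fYX_meas[of x] fYX_nonneg[of x] fYX_total[of x]
  by (intro integrableI_nonneg) (auto simp: measurable_cong_sets[OF sets_N refl])

lemma psibar_integrable:
  assumes x: "x \<in> Xs"
  shows "integrable N (\<lambda>y. (psibar x y + 1) * fYX x y)"
proof (rule integrableI_nonneg)
  note [measurable] = fYX_meas[OF x] psibar_section[OF x] fYX_support_borel[OF x]
  let ?i = "indicator {y. fYX x y \<noteq> 0} :: real \<Rightarrow> real"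
  have eq: "(psibar x y + 1) * fYX x y = (psibar x y * ?i y + 1) * fYX x y" for y
    by (auto simp: indicator_def)
  show "(\<lambda>y. (psibar x y + 1) * fYX x y) \<in> borel_measurable N"
    unfolding eq by measurable
  have pos: "0 \<le> (psibar x y + 1) * fYX x y \<and> (psibar x y + 1) * fYX x y \<le> (psibar x y + 1)\<^sup>2 * fYX x y" for y
  proof (cases "fYX x y = 0")
    case False
    then have "0 < psibar x y" using psibar_pos[OF x] fYX_Ys[OF x] by blast
    then have "psibar x y + 1 \<le> (psibar x y + 1)\<^sup>2" by (simp add: power2_eq_square)
    with \<open>0 < psibar x y\<close> show ?thesis using fYX_nonneg[OF x, of y]
      by (auto intro!: mult_right_mono mult_nonneg_nonneg)
  qed simp
  then show "AE y in N. 0 \<le> (psibar x y + 1) * fYX x y" by simp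
  obtain C where "(\<integral>\<^sup>+y. ennreal ((psibar x y + 1)\<^sup>2 * fYX x y) \<partial>N) \<le> ennreal C"
    using psibar_second_moment x by blast
  moreover have "(\<integral>\<^sup>+y. ennreal ((psibar x y + 1) * fYX x y) \<partial>N) \<le> (\<integral>\<^sup>+y. ennreal ((psibar x y + 1)\<^sup>2 * fYX x y) \<partial>N)"
    using pos by (intro nn_integral_mono ennreal_leI) auto
  ultimately have "(\<integral>\<^sup>+y. ennreal ((psibar x y + 1) * fYX x y) \<partial>N) \<le> ennreal C" by (rule order.trans[rotated])
  also have "\<dots> < \<infinity>" by simp
  finally show "(\<integral>\<^sup>+y. ennreal ((psibar x y + 1) * fYX x y) \<partial>N) < \<infinity>" .
qed

lemma Psi_deriv_has_derivative:
  assumes "x \<in> Xs" "q \<in> Qs" "e \<in> Es"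
  shows "((\<lambda>e. Psi N fYX psi x e q) has_real_derivative Psi_deriv 1 N fYX psi x e q) (at e)"
proof -
  have "twice_cont_diff_on Es (\<lambda>e. Psi N fYX psi x e q)"
    by (rule local_facts) (use assms in blast)
  then show ?thesis using assms(3)
    unfolding twice_cont_diff_on_def Psi_deriv_def by (auto simp: DERIV_deriv_iff_field_differentiable)
qed

lemma Psi_cont: "x \<in> Xs \<Longrightarrow> q \<in> Qs \<Longrightarrow> A \<subseteq> Es \<Longrightarrow> continuous_on A (\<lambda>e. Psi N fYX psi x e q)"
  by (intro continuous_at_imp_continuous_on ballI DERIV_isCont[OF Psi_deriv_has_derivative]) auto

end

section \<open>The conditional mean of a loss difference as an integral of
  \<open>Psi\<close>\<close>

context explicit_regular_loss begin

text \<open>Fubini: the loss difference is the integral of its derivative in \<open>e\<close>, and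
  integrating in \<open>y\<close> first produces \<open>Psi\<close>. That \<open>psi\<close> is the
  derivative only almost everywhere does no harm, since for each \<open>y\<close> the inner integral
  over \<open>e\<close> ignores the null set attached to this \<open>y\<close>.\<close>

lemma expected_loss_diff:
  assumes x: "x \<in> Xs" and q: "q \<in> Qs" and ab: "a \<le> b" and aW: "a \<in> eta ` {-W..W}" and bW: "b \<in> eta ` {-W..W}"
  shows "integrable N (\<lambda>y. (rho y b q - rho y a q) * fYX x y)"
    and "(\<integral>y. (rho y b q - rho y a q) * fYX x y \<partial>N) = integral {a..b} (\<lambda>e. Psi N fYX psi x e q)"
proof -
  interpret N: sigma_finite_measure N by (rule sigma_finite_N)
  interpret pair_sigma_finite N lborel by unfold_locales
  define S where "S = {y. fYX x y \<noteq> 0}"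
  have S [measurable]: "S \<in> sets borel" unfolding S_def by (rule fYX_support_borel[OF x])
  have SY: "S \<subseteq> Ys" using fYX_Ys[OF x] unfolding S_def by blast
  have sub: "{a..b} \<subseteq> eta ` {-W..W}" using eta_interval[OF aW bW] ab by (simp add: closed_segment_eq_real_ivl)
  have subE: "{a..b} \<subseteq> Es" using sub image_eta_subset by blast
  note [measurable] = fYX_meas[OF x]
  obtain C where C: "C \<ge> 0" "\<And>y e. y \<in> Ys \<Longrightarrow> e \<in> eta ` {-W..W} \<Longrightarrow> \<bar>phi D tau y e q\<bar> \<le> psibar x y + C"
    using phi_bound[of W] x q by blast
  \<comment> \<open>Cut down to a Borel rectangle inside \<open>Ys \<times> Es\<close>,
    \<open>psi\<close> becomes jointly measurable on the plane.\<close>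
  define G where "G = (\<lambda>y e. psi y e q * indicator (S \<times> {a..b}) (y, e))"
  have "(\<lambda>p. (\<lambda>(y, e). psi y e q) p * indicator (S \<times> {a..b}) p) \<in> borel_measurable borel"
    by (rule borel_measurable_indicator_restrict[OF psi_meas[OF q]])
       (use SY subE in \<open>auto simp: borel_prod[symmetric]\<close>)
  then have Gm [measurable]: "(\<lambda>p. G (fst p) (snd p)) \<in> borel_measurable (borel \<Otimes>\<^sub>M borel)"
    unfolding G_def by (simp add: borel_prod case_prod_unfold)
  have good_points [measurable]: "G y \<in> borel_measurable borel" for y
    using measurable_compose[OF measurable_Pair1' Gm, of y] by simp
  have AEG: "AE e in lborel. e \<in> {a..b} \<longrightarrow> G y e = phi D tau y e q" if "y \<in> S" for y
  proof -
    have "y \<in> Ys" using that SY by blast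
    from phi_eq_psi[OF this q] show ?thesis
      by eventually_elim (use subE that in \<open>auto simp: G_def\<close>)
  qed
  have G0: "G y e = 0" if "y \<notin> S \<or> e \<notin> {a..b}" for y e
    using that unfolding G_def by (auto simp: indicator_def)
  \<comment> \<open>The envelope bound is known for \<open>phi\<close>, hence for \<open>psi\<close>
    only almost everywhere in \<open>e\<close>.\<close>
  have AEb: "AE e in lborel. norm (G y e) \<le> (psibar x y + C) * indicator {a..b} e" if y: "y \<in> S" for y
    using AEG[OF y]
  proof eventually_elim
    case (elim e)
    show ?case
    proof (cases "e \<in> {a..b}")
      case True
      then have "y \<in> Ys" "e \<in> eta ` {-W..W}" using y SY sub by blast+
      then show ?thesis using C(2)[of y e] elim True by simp
    qed (simp add: G0)
  qed
  have Ii: "integrable lborel (indicat_real {a..b})"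
    using integrable_real_indicator[of "{a..b}" lborel] by (simp add: emeasure_lborel_Icc_eq)
  have Gi: "integrable lborel (G y)" for y
  proof (cases "y \<in> S")
    case True
    show ?thesis
    proof (rule Bochner_Integration.integrable_bound[where f = "\<lambda>e. (psibar x y + C) * indicator {a..b} e"])
      show "AE e in lborel. norm (G y e) \<le> norm ((psibar x y + C) * indicator {a..b} e)"
        using AEb[OF True] by eventually_elim (rule order.trans, assumption, simp)
      show "integrable lborel (\<lambda>e. (psibar x y + C) * indicator {a..b} e)"
        using Ii by simp
      show "G y \<in> borel_measurable lborel" using good_points[of y] by simp
    qed
  next
    case False
    then have "G y = (\<lambda>_. 0)" by (intro ext G0 disjI1)
    then show ?thesis by simp
  qed
  have int_eq: "(\<integral>e. G y e \<partial>lborel) = rho y b q - rho y a q" if y: "y \<in> S" for y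
  proof -
    have "(\<lambda>e. if e \<in> {a..b} then G y e else 0) = G y" by (rule ext) (use G0[of y] in simp)
    moreover have "(G y has_integral (\<integral>e. G y e \<partial>lborel)) UNIV" by (rule has_integral_integral_lborel[OF Gi])
    ultimately have "(G y has_integral (\<integral>e. G y e \<partial>lborel)) {a..b}"
      using has_integral_restrict_UNIV[of "{a..b}" "G y"] by simp
    then have "((\<lambda>e. phi D tau y e q) has_integral (\<integral>e. G y e \<partial>lborel)) {a..b}"
      using has_integral_AE[OF AEG[OF y]] by blast
    then show ?thesis using rho_has_integral[of y q a b] y SY q ab subE has_integral_unique by blast
  qed
  have norm_le: "(\<integral>e. norm (G y e) \<partial>lborel) \<le> (psibar x y + C) * (b - a)" if y: "y \<in> S" for y
  proof -
    have "(\<integral>e. norm (G y e) \<partial>lborel) \<le> (\<integral>e. (psibar x y + C) * indicator {a..b} e \<partial>lborel)"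
      by (intro integral_mono_AE integrable_norm Gi AEb y integrable_mult_right Ii)
    then show ?thesis using ab by simp
  qed
  let ?F = "\<lambda>y e. G y e * fYX x y"
  have FI: "integrable (N \<Otimes>\<^sub>M lborel) (\<lambda>p. ?F (fst p) (snd p))"
  proof (rule Fubini_integrable)
    show "(\<lambda>p. ?F (fst p) (snd p)) \<in> borel_measurable (N \<Otimes>\<^sub>M lborel)" by measurable
    have "integrable N (\<lambda>y. (b - a) * ((psibar x y + 1) * fYX x y + C * fYX x y))"
      using psibar_integrable[OF x] fYX_integrable[OF x] by auto
    then show "integrable N (\<lambda>y. \<integral>e. norm (?F (fst (y, e)) (snd (y, e))) \<partial>lborel)"
    proof (rule Bochner_Integration.integrable_bound)
      show "(\<lambda>y. \<integral>e. norm (?F (fst (y, e)) (snd (y, e))) \<partial>lborel) \<in> borel_measurable N" by measurable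
      have "norm (\<integral>e. norm (?F y e) \<partial>lborel) \<le> norm ((b - a) * ((psibar x y + 1) * fYX x y + C * fYX x y))" for y
      proof (cases "y \<in> S")
        case True
        have "(\<integral>e. norm (?F y e) \<partial>lborel) = (\<integral>e. norm (G y e) \<partial>lborel) * fYX x y"
          using fYX_nonneg[OF x, of y] by (simp add: abs_mult)
        also have "\<dots> \<le> (psibar x y + C) * (b - a) * fYX x y"
          using norm_le[OF True] fYX_nonneg[OF x, of y] by (intro mult_right_mono)
        also have "\<dots> \<le> (b - a) * ((psibar x y + 1) * fYX x y + C * fYX x y)"
          using mult_right_mono[OF ab fYX_nonneg[OF x, of y]] by (simp add: algebra_simps)
        finally have "(\<integral>e. norm (?F y e) \<partial>lborel) \<le> (b - a) * ((psibar x y + 1) * fYX x y + C * fYX x y)" .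
        moreover have "0 \<le> (\<integral>e. norm (?F y e) \<partial>lborel)" by simp
        ultimately show ?thesis by simp
      next
        case False
        then show ?thesis unfolding S_def by simp
      qed
      then show "AE y in N. norm (\<integral>e. norm (?F (fst (y, e)) (snd (y, e))) \<partial>lborel) \<le>
          norm ((b - a) * ((psibar x y + 1) * fYX x y + C * fYX x y))" by simp
    qed
    show "AE y in N. integrable lborel (\<lambda>e. ?F (fst (y, e)) (snd (y, e)))" using Gi by auto
  qed
  have inner: "(\<integral>e. ?F y e \<partial>lborel) = (rho y b q - rho y a q) * fYX x y" for y
    using int_eq[of y] by (cases "y \<in> S") (auto simp: S_def)
  have "integrable N (\<lambda>y. \<integral>e. ?F y e \<partial>lborel)"
    using integrable_fst[of "?F"] FI by (simp add: case_prod_unfold)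
  then show "integrable N (\<lambda>y. (rho y b q - rho y a q) * fYX x y)" unfolding inner .
  have "(\<integral>y. (rho y b q - rho y a q) * fYX x y \<partial>N) = (\<integral>y. \<integral>e. ?F y e \<partial>lborel \<partial>N)"
    unfolding inner ..
  also have "\<dots> = (\<integral>e. \<integral>y. ?F y e \<partial>N \<partial>lborel)"
    by (rule Fubini_integral[symmetric]) (use FI in \<open>simp add: case_prod_unfold\<close>)
  also have "\<dots> = (LINT e:{a..b}|lborel. Psi N fYX psi x e q)"
    unfolding set_lebesgue_integral_def
  proof (rule Bochner_Integration.integral_cong[OF refl])
    fix e
    show "(\<integral>y. ?F y e \<partial>N) = indicat_real {a..b} e *\<^sub>R Psi N fYX psi x e q"
    proof (cases "e \<in> {a..b}")
      case True
      have "(\<lambda>y. ?F y e) = (\<lambda>y. psi y e q * fYX x y)"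
        using True unfolding G_def S_def by (auto simp: indicator_def)
      then have "(\<integral>y. ?F y e \<partial>N) = (\<integral>y. psi y e q * fYX x y \<partial>N)" by (rule arg_cong)
      then show ?thesis using True by (simp only: Psi_def cond_expect_def indicator_simps scaleR_one)
    qed (simp add: G0)
  qed
  also have "\<dots> = integral {a..b} (\<lambda>e. Psi N fYX psi x e q)"
    by (intro set_borel_integral_eq_integral(2) borel_integrable_atLeastAtMost'
        Psi_cont x q subE)
  finally show "(\<integral>y. (rho y b q - rho y a q) * fYX x y \<partial>N) = integral {a..b} (\<lambda>e. Psi N fYX psi x e q)" .
qed

end

section \<open>Quadratic growth of the conditional mean around \<open>mu0\<close>\<close>

context explicit_regular_loss begin

lemma eta_interior:
  assumes "z \<in> {-W..W}"
  shows "eta z \<in> {min (eta (- W - 1)) (eta (W + 1))<..<max (eta (- W - 1)) (eta (W + 1))}"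
proof -
  have "- W - 1 < z" "z < W + 1" using assms by auto
  then show ?thesis
    using eta_strict unfolding strict_mono_def monotone_on_def
    by (auto simp: min_less_iff_disj less_max_iff_disj)
qed

text \<open>\<open>Psi\<close> is integrated from an end point of the image of a strictly larger
  interval. All points of the requested image are then interior, so that the derivative of
  \<open>H\<close> is two-sided, as Taylor's theorem demands.\<close>

lemma expected_loss_antiderivative:
  assumes x: "x \<in> Xs" and q: "q \<in> Qs"
  obtains H where
    "\<And>e. e \<in> eta ` {-W..W} \<Longrightarrow> (H has_real_derivative Psi N fYX psi x e q) (at e)"
    "\<And>a b. a \<in> eta ` {-W..W} \<Longrightarrow> b \<in> eta ` {-W..W} \<Longrightarrow>
       integrable N (\<lambda>y. (rho y b q - rho y a q) * fYX x y) \<and>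
       (\<integral>y. (rho y b q - rho y a q) * fYX x y \<partial>N) = H b - H a"
proof
  define V where "V = \<bar>W\<bar> + 1"
  define a0 b0 where "a0 = min (eta (- V)) (eta V)" and "b0 = max (eta (- V)) (eta V)"
  have V: "- V \<in> {-V..V}" "V \<in> {-V..V}" unfolding V_def by auto
  have a0: "a0 \<in> eta ` {-V..V}" and b0: "b0 \<in> eta ` {-V..V}"
    using V unfolding a0_def b0_def by (auto simp: min_def max_def)
  have sub: "{a0..b0} \<subseteq> eta ` {-V..V}"
  proof -
    have "a0 \<le> b0" unfolding a0_def b0_def by linarith
    then show ?thesis using eta_interval[OF a0 b0] by (simp add: closed_segment_eq_real_ivl)
  qed
  have inter: "e \<in> {a0<..<b0}" if "e \<in> eta ` {-W..W}" for e
    using that eta_interior[of _ "\<bar>W\<bar>"] unfolding a0_def b0_def V_def by force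
  let ?P = "\<lambda>e. Psi N fYX psi x e q"
  let ?H = "\<lambda>e. integral {a0..e} ?P"
  have cont: "continuous_on {a0..b0} ?P"
    by (intro Psi_cont x q order.trans[OF sub image_eta_subset])
  show "(?H has_real_derivative ?P e) (at e)" if e: "e \<in> eta ` {-W..W}" for e
  proof -
    have "(?H has_real_derivative ?P e) (at e within {a0..b0})"
      using inter[OF e] by (intro integral_has_real_derivative cont) auto
    then show ?thesis using inter[OF e] by (simp add: at_within_Icc_at)
  qed
  have *: "integrable N (\<lambda>y. (rho y b q - rho y a q) * fYX x y) \<and>
       (\<integral>y. (rho y b q - rho y a q) * fYX x y \<partial>N) = ?H b - ?H a"
    if a: "a \<in> eta ` {-W..W}" and b: "b \<in> eta ` {-W..W}" and ab: "a \<le> b" for a b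
  proof -
    have "?P integrable_on {a0..b}"
      using inter[OF b] by (intro integrable_continuous_real continuous_on_subset[OF cont]) auto
    then have "?H a + integral {a..b} ?P = ?H b"
      using inter[OF a] ab by (intro Henstock_Kurzweil_Integration.integral_combine) auto
    then show ?thesis using expected_loss_diff[OF x q ab a b] by auto
  qed
  show "integrable N (\<lambda>y. (rho y b q - rho y a q) * fYX x y) \<and>
       (\<integral>y. (rho y b q - rho y a q) * fYX x y \<partial>N) = ?H b - ?H a"
    if a: "a \<in> eta ` {-W..W}" and b: "b \<in> eta ` {-W..W}" for a b
  proof (cases "a \<le> b")
    case False
    have eq: "(\<lambda>y. (rho y b q - rho y a q) * fYX x y) = (\<lambda>y. - ((rho y a q - rho y b q) * fYX x y))"
      by (auto simp: algebra_simps)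
    show ?thesis using *[OF b a] False unfolding eq by auto
  qed (rule *[OF a b])
qed

text \<open>Taylor's theorem with Lagrange remainder, whose linear term vanishes with
  \<open>P a\<close>. For \<open>P\<close> equal to \<open>Psi\<close> and \<open>a\<close> the
  image of \<open>mu0\<close> this is the first-order condition at the truth.\<close>

lemma quadratic_expansion:
  fixes H P P' :: "real \<Rightarrow> real"
  assumes H: "\<And>t. t \<in> closed_segment a b \<Longrightarrow> (H has_real_derivative P t) (at t)"
    and P: "\<And>t. t \<in> closed_segment a b \<Longrightarrow> (P has_real_derivative P' t) (at t)"
    and "P a = 0"
  shows "\<exists>t\<in>closed_segment a b. H b - H a = P' t / 2 * (b - a)\<^sup>2"
proof (cases "a = b")
  case False
  have seg: "closed_segment a b = {min a b..max a b}" by (auto simp: closed_segment_eq_real_ivl)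
  let ?d = "\<lambda>m::nat. if m = 0 then H else if m = 1 then P else P'"
  have "\<exists>t. (if b < a then b < t \<and> t < a else a < t \<and> t < b) \<and>
    H b = (\<Sum>m<2. (?d m a / fact m) * (b - a) ^ m) + (?d 2 t / fact 2) * (b - a) ^ 2"
    using False H P unfolding seg
    by (intro Taylor[of 2 ?d H "min a b" "max a b"]) (auto simp: less_2_cases_iff)
  then obtain t where t: "if b < a then b < t \<and> t < a else a < t \<and> t < b"
    and "H b = (\<Sum>m<2. (?d m a / fact m) * (b - a) ^ m) + (?d 2 t / fact 2) * (b - a) ^ 2" by blast
  then have "H b - H a = P' t / 2 * (b - a)\<^sup>2"
    using \<open>P a = 0\<close> by (simp add: numeral_2_eq_2)
  moreover have "t \<in> closed_segment a b" using t by (auto simp: closed_segment_eq_real_ivl split: if_splits)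
  ultimately show ?thesis by blast
qed auto

text \<open>The derivative of \<open>eta\<close> may vanish away from \<open>mu0\<close>. Inside the
  ball, \<open>Psi_deriv 1\<close> is at most C while its product with the squared derivative is at
  least c, which forces a slope of at least sqrt(c / C). Outside, monotonicity keeps the image at
  distance at least s r, whereas the argument is at distance at most \<open>B\<close>; the slope
  \<open>s * r / B\<close> covers both cases.\<close>

lemma eta_lower: "\<exists>c>0. \<forall>x\<in>Xs. \<forall>q\<in>Qs. \<forall>z\<in>{-W..W}. c * \<bar>z - mu0 x q\<bar> \<le> \<bar>eta z - eta (mu0 x q)\<bar>"
proof -
  obtain r C c where r: "r > 0" "c > 0" "C > 0" and
    C: "\<And>x q z. x \<in> Xs \<Longrightarrow> q \<in> Qs \<Longrightarrow> \<bar>z - mu0 x q\<bar> \<le> r \<Longrightarrow> \<bar>Psi_deriv 1 N fYX psi x (eta z) q\<bar> \<le> C" and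
    c: "\<And>x q z. x \<in> Xs \<Longrightarrow> q \<in> Qs \<Longrightarrow> \<bar>z - mu0 x q\<bar> \<le> r \<Longrightarrow>
       c \<le> Psi_deriv 1 N fYX psi x (eta z) q * (deriv eta z)\<^sup>2"
    by (rule local_facts) blast
  define s where "s = sqrt (c / C)"
  have s: "s > 0" using r unfolding s_def by simp
  have d: "s \<le> \<bar>deriv eta z\<bar>" if "x \<in> Xs" "q \<in> Qs" "\<bar>z - mu0 x q\<bar> \<le> r" for x q z
  proof -
    have "c \<le> C * (deriv eta z)\<^sup>2"
      by (rule order.trans[OF c[OF that]], rule mult_right_mono) (use C[OF that] in auto)
    then have "c / C \<le> (deriv eta z)\<^sup>2" using r by (simp add: divide_le_eq mult.commute)
    then have "sqrt (c / C) \<le> sqrt ((deriv eta z)\<^sup>2)" by (rule real_sqrt_le_mono)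
    then show ?thesis unfolding s_def by simp
  qed
  have near: "s * \<bar>z - mu0 x q\<bar> \<le> \<bar>eta z - eta (mu0 x q)\<bar>"
    if h: "x \<in> Xs" "q \<in> Qs" "\<bar>z - mu0 x q\<bar> \<le> r" for x q z
  proof (cases "z = mu0 x q")
    case False
    obtain t where t: "t \<in> closed_segment (mu0 x q) z" "eta z - eta (mu0 x q) = (z - mu0 x q) * deriv eta t"
    proof (cases "z < mu0 x q")
      case True
      obtain t where t: "z < t" "t < mu0 x q" "eta (mu0 x q) - eta z = (mu0 x q - z) * deriv eta t"
        using MVT2[OF True eta_C1] by blast
      show thesis by (rule that[of t]) (use t in \<open>auto simp: closed_segment_eq_real_ivl algebra_simps\<close>)
    next
      case False
      then have "mu0 x q < z" using \<open>z \<noteq> mu0 x q\<close> by simp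
      then obtain t where t: "mu0 x q < t" "t < z" "eta z - eta (mu0 x q) = (z - mu0 x q) * deriv eta t"
        using MVT2[OF _ eta_C1] by blast
      show thesis by (rule that[of t]) (use t in \<open>auto simp: closed_segment_eq_real_ivl\<close>)
    qed
    have "\<bar>t - mu0 x q\<bar> \<le> r" using t(1) h(3) by (auto simp: closed_segment_eq_real_ivl split: if_splits)
    from d[OF h(1,2) this] have "\<bar>z - mu0 x q\<bar> * s \<le> \<bar>z - mu0 x q\<bar> * \<bar>deriv eta t\<bar>" by (intro mult_left_mono) auto
    then show ?thesis using t(2) by (simp add: abs_mult mult.commute)
  qed simp
  define B where "B = \<bar>W\<bar> + \<bar>B0\<bar> + r"
  have B: "B > 0" "r \<le> B" using r unfolding B_def by auto
  have "s * r / B * \<bar>z - mu0 x q\<bar> \<le> \<bar>eta z - eta (mu0 x q)\<bar>"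
    if h: "x \<in> Xs" "q \<in> Qs" "z \<in> {-W..W}" for x q z
  proof (cases "\<bar>z - mu0 x q\<bar> \<le> r")
    case True
    have "s * r / B \<le> s" using s B r by (simp add: divide_le_eq mult_left_mono)
    then have "s * r / B * \<bar>z - mu0 x q\<bar> \<le> s * \<bar>z - mu0 x q\<bar>" by (rule mult_right_mono) simp
    also note near[OF h(1,2) True]
    finally show ?thesis .
  next
    case False
    \<comment> \<open>The boundary point of the ball on the side of \<open>z\<close>; it lies
      strictly between \<open>mu0 x q\<close> and \<open>z\<close>.\<close>
    define z' where "z' = mu0 x q + (if z > mu0 x q then r else - r)"
    have "s * r \<le> \<bar>eta z' - eta (mu0 x q)\<bar>" using near[OF h(1,2), of z'] r unfolding z'_def by (auto split: if_splits)
    also have "\<dots> \<le> \<bar>eta z - eta (mu0 x q)\<bar>"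
    proof -
      have *: "mu0 x q < z' \<and> z' < z \<or> z < z' \<and> z' < mu0 x q" using False r unfolding z'_def by auto
      show ?thesis using eta_strict
      proof
        assume "strict_mono eta"
        with * have "eta (mu0 x q) < eta z' \<and> eta z' < eta z \<or> eta z < eta z' \<and> eta z' < eta (mu0 x q)"
          unfolding strict_mono_def by blast
        then show ?thesis by linarith
      next
        assume "strict_antimono_on UNIV eta"
        with * have "eta (mu0 x q) > eta z' \<and> eta z' > eta z \<or> eta z > eta z' \<and> eta z' > eta (mu0 x q)"
          unfolding monotone_on_def by blast
        then show ?thesis by linarith
      qed
    qed
    finally have "s * r \<le> \<bar>eta z - eta (mu0 x q)\<bar>" .
    moreover have "\<bar>z - mu0 x q\<bar> \<le> B" using h(3) mu0_bound[OF h(1,2)] r unfolding B_def by auto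
    then have "s * r / B * \<bar>z - mu0 x q\<bar> \<le> s * r / B * B" using s r B by (intro mult_left_mono) auto
    ultimately show ?thesis using B by simp
  qed
  then show ?thesis using s r B by (intro exI[of _ "s * r / B"]) auto
qed

end

context regular_loss begin

text \<open>The only facts about the loss that enter the stochastic argument, with one constant
  \<open>L\<close>. In the last one both squares are centred at \<open>mu0\<close>: the curvature
  condition bounds the loss at any \<open>z1\<close> of the range from below, while the bound from
  above at \<open>z0\<close> rests on the local bound for \<open>Psi_deriv 1\<close> and thus
  requires \<open>z0\<close> in the ball.\<close>

lemma loss_bounds:
  assumes c: "0 < c"
  obtains L r where "L \<ge> 1" "r > 0"
    "\<And>q. q \<in> Qs \<Longrightarrow> (\<lambda>(y, e). rho y e q) \<in> borel_measurable (restrict_space borel (Ys \<times> Es))"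
    "\<And>x q y z1 z2. x \<in> Xs \<Longrightarrow> q \<in> Qs \<Longrightarrow> y \<in> Ys \<Longrightarrow> \<bar>z1\<bar> \<le> W \<Longrightarrow> \<bar>z2\<bar> \<le> W \<Longrightarrow>
       \<bar>rho y (eta z1) q - rho y (eta z2) q\<bar> \<le> L * (psibar x y + 1) * \<bar>z1 - z2\<bar>"
    "\<And>q q' y z1 z2. q \<in> Qs \<Longrightarrow> q' \<in> Qs \<Longrightarrow> y \<in> Ys \<Longrightarrow> \<bar>z1\<bar> \<le> W \<Longrightarrow> \<bar>z2\<bar> \<le> W \<Longrightarrow>
       \<bar>(rho y (eta z1) q - rho y (eta z2) q) - (rho y (eta z1) q' - rho y (eta z2) q')\<bar>
         \<le> L * (\<bar>of_bool (y \<le> q) - of_bool (y \<le> q')\<bar> + \<bar>q - q'\<bar>)"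
    "\<And>x q z1 z0. x \<in> Xs \<Longrightarrow> q \<in> Qs \<Longrightarrow> \<bar>z1\<bar> \<le> W \<Longrightarrow> \<bar>z0\<bar> \<le> W \<Longrightarrow> \<bar>z0 - mu0 x q\<bar> \<le> r \<Longrightarrow>
       (\<And>\<zeta>. \<zeta> \<in> closed_segment (eta z1) (eta (mu0 x q)) \<Longrightarrow> c \<le> Psi_deriv 1 N fYX psi x \<zeta> q) \<Longrightarrow>
       integrable N (\<lambda>y. (rho y (eta z1) q - rho y (eta z0) q) * fYX x y) \<and>
       (z1 - mu0 x q)\<^sup>2 / L - L * (z0 - mu0 x q)\<^sup>2
         \<le> (\<integral>y. (rho y (eta z1) q - rho y (eta z0) q) * fYX x y \<partial>N)"
proof -
  obtain f :: "nat \<Rightarrow> real \<Rightarrow> real" and D :: "nat \<Rightarrow> real" and T tau :: "real \<Rightarrow> real \<Rightarrow> real" where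
    "\<And>j. j \<in> {1,2,3} \<Longrightarrow> continuous_on Ys (f j)"
    "continuous_on (Ys \<times> Es) (\<lambda>(y, e). T y e)"
    "\<And>y e q. y \<in> Ys \<Longrightarrow> e \<in> Es \<Longrightarrow> q \<in> Qs \<Longrightarrow>
       rho y e q = (f 1 y + D 1 * e) * of_bool (y \<le> e) + (f 2 y + D 2 * e) * of_bool (y \<le> q)
             + (f 3 y + D 3 * e) * q + T y e"
    "\<And>y e. y \<in> Ys \<Longrightarrow> e \<in> Es \<Longrightarrow> (T y has_real_derivative tau y e) (at e)"
    "\<And>A. compact A \<Longrightarrow> A \<subseteq> Es \<Longrightarrow> \<exists>L. \<forall>e1\<in>A. \<forall>e2\<in>A. \<forall>y\<in>Ys. \<bar>tau y e1 - tau y e2\<bar> \<le> L * \<bar>e1 - e2\<bar> powr \<alpha>"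
    by (rule explicit_loss; rule that; assumption)
  then interpret explicit_regular_loss Xs Ys Es Qs N fYX rho psi psibar eta mu0 \<alpha> \<nu> B0 f D T tau
    by unfold_locales
  define V where "V = max \<bar>W\<bar> \<bar>B0\<bar>"
  have V: "\<And>z. \<bar>z\<bar> \<le> W \<Longrightarrow> z \<in> {-V..V}" "\<And>x q. x \<in> Xs \<Longrightarrow> q \<in> Qs \<Longrightarrow> mu0 x q \<in> {-V..V}"
    using mu0_bound unfolding V_def by (auto simp: abs_le_iff le_max_iff_disj) force+
  obtain r0 C0 c0 where r: "r0 > 0" "C0 > 0" and
    C0: "\<And>x q z. x \<in> Xs \<Longrightarrow> q \<in> Qs \<Longrightarrow> \<bar>z - mu0 x q\<bar> \<le> r0 \<Longrightarrow> \<bar>Psi_deriv 1 N fYX psi x (eta z) q\<bar> \<le> C0"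
    by (rule local_facts) blast
  obtain C1 where C1: "C1 > 0" "\<And>z1 z2. z1 \<in> {-V..V} \<Longrightarrow> z2 \<in> {-V..V} \<Longrightarrow> \<bar>eta z1 - eta z2\<bar> \<le> C1 * \<bar>z1 - z2\<bar>"
    using eta_lipschitz[of V] by blast
  obtain C2 where C2: "C2 > 0" "\<And>x q y a b. x \<in> Xs \<Longrightarrow> q \<in> Qs \<Longrightarrow> y \<in> Ys \<Longrightarrow> a \<in> eta ` {-V..V} \<Longrightarrow> b \<in> eta ` {-V..V} \<Longrightarrow>
     \<bar>rho y a q - rho y b q\<bar> \<le> C2 * (psibar x y + 1) * \<bar>a - b\<bar>"
    using rho_lipschitz[of V] by blast
  obtain c1 where c1: "c1 > 0" "\<And>x q z. x \<in> Xs \<Longrightarrow> q \<in> Qs \<Longrightarrow> z \<in> {-V..V} \<Longrightarrow> c1 * \<bar>z - mu0 x q\<bar> \<le> \<bar>eta z - eta (mu0 x q)\<bar>"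
    using eta_lower[of V] by blast
  \<comment> \<open>One summand for each of the estimates; the fourth gives 1 / L \<le> c c1^2 / 2,
    half the curvature times the squared lower slope of \<open>eta\<close>.\<close>
  define L where "L = 1 + C2 * C1 + C1 * (2 * V) * (\<bar>D 2\<bar> + \<bar>D 3\<bar>) + 2 / (c * c1\<^sup>2) + C0 / 2 * C1\<^sup>2"
  have V0: "V \<ge> 0" unfolding V_def by simp
  have L: "L \<ge> 1" "C2 * C1 \<le> L" "C1 * (2 * V) * (\<bar>D 2\<bar> + \<bar>D 3\<bar>) \<le> L" "2 / (c * c1\<^sup>2) \<le> L" "C0 / 2 * C1\<^sup>2 \<le> L"
    using V0 C2(1) C1(1) c c1(1) r(2) unfolding L_def by (auto intro!: add_nonneg_nonneg simp: add_increasing add_increasing2)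
  show thesis
  proof (rule that[OF L(1) r(1)])
    show "(\<lambda>(y, e). rho y e q) \<in> borel_measurable (restrict_space borel (Ys \<times> Es))" if "q \<in> Qs" for q
      by (rule rho_meas[OF that])
  next
    fix x q y z1 z2 assume h: "x \<in> Xs" "q \<in> Qs" "y \<in> Ys" "\<bar>z1\<bar> \<le> W" "\<bar>z2\<bar> \<le> W"
    have pos: "0 < psibar x y" by (rule psibar_pos[OF h(1,3)])
    have "\<bar>rho y (eta z1) q - rho y (eta z2) q\<bar> \<le> C2 * (psibar x y + 1) * \<bar>eta z1 - eta z2\<bar>"
      by (intro C2(2) h imageI V(1))
    also have "\<dots> \<le> C2 * (psibar x y + 1) * (C1 * \<bar>z1 - z2\<bar>)"
      using C2(1) pos by (intro mult_left_mono C1(2) V(1) h) auto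
    also have "\<dots> = C2 * C1 * ((psibar x y + 1) * \<bar>z1 - z2\<bar>)" by simp
    also have "\<dots> \<le> L * ((psibar x y + 1) * \<bar>z1 - z2\<bar>)"
      using L(2) pos by (intro mult_right_mono) auto
    finally show "\<bar>rho y (eta z1) q - rho y (eta z2) q\<bar> \<le> L * (psibar x y + 1) * \<bar>z1 - z2\<bar>" by simp
  next
    fix q q' y z1 z2 assume h: "q \<in> Qs" "q' \<in> Qs" "y \<in> Ys" "\<bar>z1\<bar> \<le> W" "\<bar>z2\<bar> \<le> W"
    let ?i = "\<bar>of_bool (y \<le> q) - of_bool (y \<le> q')\<bar> :: real"
    have "\<bar>eta z1 - eta z2\<bar> \<le> C1 * \<bar>z1 - z2\<bar>" by (intro C1(2) V(1) h)
    also have "\<dots> \<le> C1 * (2 * V)" using V(1)[OF h(4)] V(1)[OF h(5)] C1(1) by (intro mult_left_mono) auto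
    finally have e: "\<bar>eta z1 - eta z2\<bar> \<le> C1 * (2 * V)" .
    have d: "\<bar>D 2 * (of_bool (y \<le> q) - of_bool (y \<le> q')) + D 3 * (q - q')\<bar> \<le> (\<bar>D 2\<bar> + \<bar>D 3\<bar>) * (?i + \<bar>q - q'\<bar>)"
    proof -
      have "\<bar>D 2 * (of_bool (y \<le> q) - of_bool (y \<le> q')) + D 3 * (q - q')\<bar> \<le> \<bar>D 2\<bar> * ?i + \<bar>D 3\<bar> * \<bar>q - q'\<bar>"
        by (rule order.trans[OF abs_triangle_ineq]) (simp add: abs_mult)
      also have "\<dots> \<le> (\<bar>D 2\<bar> + \<bar>D 3\<bar>) * (?i + \<bar>q - q'\<bar>)"
        by (simp add: algebra_simps)
      finally show ?thesis .
    qed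
    have "\<bar>(rho y (eta z1) q - rho y (eta z2) q) - (rho y (eta z1) q' - rho y (eta z2) q')\<bar>
      = \<bar>eta z1 - eta z2\<bar> * \<bar>D 2 * (of_bool (y \<le> q) - of_bool (y \<le> q')) + D 3 * (q - q')\<bar>"
      unfolding rho_diff_q[OF h(3) eta_Es eta_Es h(1,2)] by (simp add: abs_mult)
    also have "\<dots> \<le> (C1 * (2 * V)) * ((\<bar>D 2\<bar> + \<bar>D 3\<bar>) * (?i + \<bar>q - q'\<bar>))"
      using C1(1) V0 by (intro mult_mono e d) auto
    also have "\<dots> = C1 * (2 * V) * (\<bar>D 2\<bar> + \<bar>D 3\<bar>) * (?i + \<bar>q - q'\<bar>)" by simp
    also have "\<dots> \<le> L * (?i + \<bar>q - q'\<bar>)" by (intro mult_right_mono L(3)) auto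
    finally show "\<bar>(rho y (eta z1) q - rho y (eta z2) q) - (rho y (eta z1) q' - rho y (eta z2) q')\<bar>
         \<le> L * (?i + \<bar>q - q'\<bar>)" .
  next
    fix x q z1 z0 assume h: "x \<in> Xs" "q \<in> Qs" "\<bar>z1\<bar> \<le> W" "\<bar>z0\<bar> \<le> W" "\<bar>z0 - mu0 x q\<bar> \<le> r0"
      and curv: "\<And>\<zeta>. \<zeta> \<in> closed_segment (eta z1) (eta (mu0 x q)) \<Longrightarrow> c \<le> Psi_deriv 1 N fYX psi x \<zeta> q"
    define es where "es = eta (mu0 x q)"
    have es: "es \<in> eta ` {-V..V}" unfolding es_def by (intro imageI V h)
    have e1: "eta z1 \<in> eta ` {-V..V}" and e0: "eta z0 \<in> eta ` {-V..V}" by (intro imageI V h)+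
    obtain H where H: "\<And>e. e \<in> eta ` {-V..V} \<Longrightarrow> (H has_real_derivative Psi N fYX psi x e q) (at e)"
      and HI: "\<And>a b. a \<in> eta ` {-V..V} \<Longrightarrow> b \<in> eta ` {-V..V} \<Longrightarrow>
       integrable N (\<lambda>y. (rho y b q - rho y a q) * fYX x y) \<and>
       (\<integral>y. (rho y b q - rho y a q) * fYX x y \<partial>N) = H b - H a"
      by (rule expected_loss_antiderivative[OF h(1,2), where W=V]) blast
    have exp: "\<exists>t\<in>closed_segment es b. H b - H es = Psi_deriv 1 N fYX psi x t q / 2 * (b - es)\<^sup>2"
      if b: "b \<in> eta ` {-V..V}" for b
    proof (rule quadratic_expansion)
      fix t assume "t \<in> closed_segment es b"
      then have t: "t \<in> eta ` {-V..V}" using eta_interval[OF es b] by blast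
      then show "(H has_real_derivative Psi N fYX psi x t q) (at t)" by (rule H)
      show "((\<lambda>t. Psi N fYX psi x t q) has_real_derivative Psi_deriv 1 N fYX psi x t q) (at t)"
        using t image_eta_subset by (intro Psi_deriv_has_derivative h) blast
    qed (simp add: es_def Psi_zero h)
    have lower: "(z1 - mu0 x q)\<^sup>2 / L \<le> H (eta z1) - H es"
    proof -
      obtain t where t: "t \<in> closed_segment es (eta z1)" "H (eta z1) - H es = Psi_deriv 1 N fYX psi x t q / 2 * (eta z1 - es)\<^sup>2"
        using exp[OF e1] by blast
      have "c \<le> Psi_deriv 1 N fYX psi x t q" using t(1) by (intro curv) (simp add: es_def closed_segment_commute)
      then have "c / 2 * (eta z1 - es)\<^sup>2 \<le> H (eta z1) - H es"
        unfolding t(2) by (intro mult_right_mono) auto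
      moreover have "c / 2 * (c1 * \<bar>z1 - mu0 x q\<bar>)\<^sup>2 \<le> c / 2 * (eta z1 - es)\<^sup>2"
        using c c1(2)[OF h(1,2) V(1)[OF h(3)]] c1(1) unfolding es_def
        by (intro mult_left_mono) (auto simp: abs_le_square_iff[symmetric])
      moreover have "(z1 - mu0 x q)\<^sup>2 / L \<le> c / 2 * (c1 * \<bar>z1 - mu0 x q\<bar>)\<^sup>2"
      proof -
        have "1 / L \<le> c * c1\<^sup>2 / 2"
          using L(1,4) c c1(1) by (simp add: field_simps)
        then have "1 / L * (z1 - mu0 x q)\<^sup>2 \<le> c * c1\<^sup>2 / 2 * (z1 - mu0 x q)\<^sup>2"
          by (rule mult_right_mono) simp
        then show ?thesis by (simp add: power_mult_distrib)
      qed
      ultimately show ?thesis by linarith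
    qed
    have upper: "H (eta z0) - H es \<le> L * (z0 - mu0 x q)\<^sup>2"
    proof -
      obtain t where t: "t \<in> closed_segment es (eta z0)" "H (eta z0) - H es = Psi_deriv 1 N fYX psi x t q / 2 * (eta z0 - es)\<^sup>2"
        using exp[OF e0] by blast
      \<comment> \<open>The Taylor point lies between two values of \<open>eta\<close>, so it is the
        image of some \<open>z\<close> between \<open>mu0 x q\<close> and \<open>z0\<close>, which
        is again in the ball.\<close>
      obtain z where z: "t = eta z" "z \<in> closed_segment (mu0 x q) z0"
        using t(1) closed_segment_subset_image[OF eta_cont, of "mu0 x q" z0] unfolding es_def by blast
      have "\<bar>z - mu0 x q\<bar> \<le> r0" using z(2) h(5) by (auto simp: closed_segment_eq_real_ivl split: if_splits)
      then have "Psi_deriv 1 N fYX psi x t q \<le> C0" using C0[OF h(1,2), of z] unfolding z(1) by linarith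
      then have "H (eta z0) - H es \<le> C0 / 2 * (eta z0 - es)\<^sup>2"
        unfolding t(2) by (intro mult_right_mono) auto
      also have "\<dots> \<le> C0 / 2 * (C1 * \<bar>z0 - mu0 x q\<bar>)\<^sup>2"
        using C1(2)[OF V(1)[OF h(4)] V(2)[OF h(1,2)]] r(2) C1(1) unfolding es_def
        by (intro mult_left_mono) (auto simp: abs_le_square_iff[symmetric] abs_mult)
      also have "\<dots> = C0 / 2 * C1\<^sup>2 * (z0 - mu0 x q)\<^sup>2" by (simp add: power_mult_distrib)
      also have "\<dots> \<le> L * (z0 - mu0 x q)\<^sup>2" by (intro mult_right_mono L(5)) simp
      finally show ?thesis .
    qed
    show "integrable N (\<lambda>y. (rho y (eta z1) q - rho y (eta z0) q) * fYX x y) \<and>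
       (z1 - mu0 x q)\<^sup>2 / L - L * (z0 - mu0 x q)\<^sup>2
         \<le> (\<integral>y. (rho y (eta z1) q - rho y (eta z0) q) * fYX x y \<partial>N)"
      using HI[OF e0 e1] lower upper by auto
  qed
qed

end

section \<open>The basis\<close>

lemma negligible_frontier_Union_polyhedra:
  fixes F :: "(real^'d::finite) set set"
  assumes "finite F" "\<And>P. P \<in> F \<Longrightarrow> polyhedron P"
  shows "negligible (frontier (\<Union>F))"
proof (rule negligible_subset)
  show "frontier (\<Union>F) \<subseteq> \<Union>(frontier ` F)"
    using frontier_Union_subset[OF assms(1)] by blast
  show "negligible (\<Union>(frontier ` F))"
    using assms by (intro negligible_Union) (auto intro: negligible_convex_frontier polyhedron_imp_convex)
qed

text \<open>A cell is the interior of a finite union of polyhedra. Its closure adds only frontier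
  points of the union, and these lie on the frontiers of the convex pieces.\<close>

lemma negligible_boundary_open_polyhedron:
  fixes S :: "(real^'d::finite) set"
  assumes "open_polyhedron S"
  shows "negligible (closure S - S)"
proof -
  obtain F where F: "finite F" "\<And>P. P \<in> F \<Longrightarrow> polyhedron P" "S = interior (\<Union>F)"
    using assms unfolding open_polyhedron_def by blast
  have "closed (\<Union>F)" using F(1,2) by (intro closed_Union) (auto intro: polyhedron_imp_closed)
  then have "closure S - S \<subseteq> frontier (\<Union>F)"
    using closure_minimal[OF interior_subset[of "\<Union>F"]] unfolding F(3) frontier_def by (auto simp: closure_closed)
  then show ?thesis using negligible_frontier_Union_polyhedra[OF F(1,2)] negligible_subset by blast
qed

lemma eucl_norm_nonneg [simp]: "0 \<le> eucl_norm K b"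
  unfolding eucl_norm_def by (rule L2_set_nonneg)

lemma eucl_norm_power2: "(eucl_norm K b)\<^sup>2 = (\<Sum>k<K. (b k)\<^sup>2)"
  unfolding eucl_norm_def L2_set_def by (simp add: sum_nonneg)

lemma abs_le_eucl_norm: "k < K \<Longrightarrow> \<bar>b k\<bar> \<le> eucl_norm K b"
  using member_le_L2_set[of "{..<K}" k "\<lambda>k. \<bar>b k\<bar>"] unfolding eucl_norm_def L2_set_def by simp

lemma abs_dot_le: "\<bar>dot K a b\<bar> \<le> eucl_norm K a * eucl_norm K b"
proof -
  have "\<bar>dot K a b\<bar> \<le> (\<Sum>k<K. \<bar>a k\<bar> * \<bar>b k\<bar>)"
    unfolding dot_def by (rule order.trans[OF sum_abs]) (simp add: abs_mult)
  also have "\<dots> \<le> L2_set a {..<K} * L2_set b {..<K}" by (rule L2_set_mult_ineq)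
  finally show ?thesis unfolding eucl_norm_def .
qed

lemma dot_diff_right: "dot K a b - dot K a c = dot K a (\<lambda>k. b k - c k)"
  unfolding dot_def by (simp add: sum_subtractf[symmetric] algebra_simps)

lemma dot_commute: "dot K a b = dot K b a"
  unfolding dot_def by (simp add: mult.commute)

lemma max_norm_le_iff: "0 \<le> R \<Longrightarrow> max_norm K b \<le> R \<longleftrightarrow> (\<forall>k<K. \<bar>b k\<bar> \<le> R)"
  unfolding max_norm_def by (auto simp: Max_le_iff)

lemma max_norm_nonneg: "0 \<le> max_norm K b"
  unfolding max_norm_def by (rule Max_ge) auto

section \<open>Geometry of the cells and supports of the basis functions\<close>

locale regular_basis =
  fixes Xs :: "(real^'d::finite) set" and \<Delta> :: "nat \<Rightarrow> (real^'d) set set" and K :: "nat \<Rightarrow> nat"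
    and p :: "nat \<Rightarrow> nat \<Rightarrow> real^'d \<Rightarrow> real" and dp :: "nat \<Rightarrow> ('d \<Rightarrow> nat) \<Rightarrow> nat \<Rightarrow> real^'d \<Rightarrow> real"
    and v :: "'d \<Rightarrow> nat" and m sg :: nat
  assumes partition: "\<And>n. polyhedral_partition Xs (\<Delta> n)"
    and basis: "local_basis Xs \<Delta> K p dp v m sg"
    and bounded_Xs: "bounded Xs"
begin

abbreviation h :: "nat \<Rightarrow> real" where "h n \<equiv> mesh (\<Delta> n)"

definition U :: "nat \<Rightarrow> (real^'d) set" where "U n = \<Union>(\<Delta> n)"

definition region :: "nat \<Rightarrow> nat \<Rightarrow> (real^'d) set" where "region n k = active_region (\<Delta> n) (p n k)"

lemma finite_partition: "finite (\<Delta> n)" and partition_nonempty: "\<Delta> n \<noteq> {}"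
  and partition_disjoint: "disjoint (\<Delta> n)" and Xs_covered: "Xs \<subseteq> closure (\<Union>(\<Delta> n))"
  using partition[of n] unfolding polyhedral_partition_def by auto

lemma cell: "\<delta> \<in> \<Delta> n \<Longrightarrow> open_polyhedron \<delta> \<and> \<delta> \<noteq> {} \<and> \<delta> \<subseteq> Xs \<and> open \<delta> \<and> bounded \<delta>"
  using partition[of n] bounded_subset[OF bounded_Xs]
  unfolding polyhedral_partition_def open_polyhedron_def by auto

lemma U_open: "open (U n)" and U_subset: "U n \<subseteq> Xs"
  unfolding U_def using cell by (auto intro: open_Union)

lemma region_open: "open (region n k)" and region_subset: "region n k \<subseteq> U n"
  unfolding region_def U_def active_region_def active_cells_def using cell by (auto intro: open_Union)

lemma Xs_cell: "x \<in> Xs \<Longrightarrow> \<exists>\<delta>\<in>\<Delta> n. x \<in> closure \<delta>"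
proof -
  have "closed (\<Union>\<delta>\<in>\<Delta> n. closure \<delta>)" using finite_partition by (intro closed_UN) auto
  then have "closure (\<Union>(\<Delta> n)) \<subseteq> (\<Union>\<delta>\<in>\<Delta> n. closure \<delta>)"
    by (rule closure_minimal[rotated]) (use closure_subset in blast)
  then show "x \<in> Xs \<Longrightarrow> ?thesis" using Xs_covered[of n] by blast
qed

text \<open>Continuity and sparsity of the basis are available on the open cells only. Since the
  partition is finite, a point of \<open>Xs\<close> off the cells belongs to the closure of one of
  them, hence to a null boundary.\<close>

lemma AE_U: "AE x in lborel. x \<in> Xs \<longrightarrow> x \<in> U n"
proof -
  have "negligible (Xs - U n)"
  proof (rule negligible_subset)
    show "Xs - U n \<subseteq> (\<Union>\<delta>\<in>\<Delta> n. closure \<delta> - \<delta>)"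
      using Xs_cell[of _ n] unfolding U_def by blast
    show "negligible (\<Union>\<delta>\<in>\<Delta> n. closure \<delta> - \<delta>)"
      using finite_partition cell by (intro negligible_Union) (auto intro: negligible_boundary_open_polyhedron)
  qed
  then have "AE x in lebesgue. x \<notin> Xs - U n"
    by (intro AE_not_in) (simp add: negligible_iff_null_sets)
  then show ?thesis by (simp add: AE_completion_iff)
qed

lemma diameter_le_mesh: "\<delta> \<in> \<Delta> n \<Longrightarrow> diameter \<delta> \<le> h n"
  unfolding mesh_def using finite_partition by (intro Max_ge) auto

lemma mesh_pos: "0 < h n"
proof -
  obtain \<delta> where d: "\<delta> \<in> \<Delta> n" using partition_nonempty by blast
  then obtain x where x: "x \<in> \<delta>" using cell by blast
  obtain e where e: "e > 0" "ball x e \<subseteq> \<delta>" using cell[OF d] x open_contains_ball by metis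
  have "diameter (ball x e) \<le> diameter \<delta>" using cell[OF d] e(2) by (intro diameter_subset) auto
  moreover have "diameter (ball x e) = 2 * e" using e(1) by (simp add: diameter_ball)
  ultimately show ?thesis using diameter_le_mesh[OF d] e(1) by linarith
qed

lemma cell_volume: "\<delta> \<in> \<Delta> n \<Longrightarrow> emeasure lborel \<delta> \<le> ennreal (unit_ball_vol (real CARD('d)) * h n ^ CARD('d))"
proof -
  assume d: "\<delta> \<in> \<Delta> n"
  then obtain x where x: "x \<in> \<delta>" using cell by blast
  have "\<delta> \<subseteq> cball x (h n)"
    using diameter_bounded_bound[of \<delta> x] cell[OF d] x diameter_le_mesh[OF d] by (force intro: order.trans)
  then have "emeasure lborel \<delta> \<le> emeasure lborel (cball x (h n))" by (intro emeasure_mono) auto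
  also have "\<dots> = ennreal (unit_ball_vol (real CARD('d)) * h n ^ CARD('d))"
    using mesh_pos[of n] by (subst emeasure_cball) (auto simp: less_imp_le)
  finally show ?thesis .
qed

lemma cellwise: "k < K n \<Longrightarrow> x \<in> Xs \<Longrightarrow> dp n (\<lambda>_. 0) k x = p n k x"
  "k < K n \<Longrightarrow> \<delta> \<in> \<Delta> n \<Longrightarrow> partials_upto sg \<delta> (p n k) (\<lambda>s. dp n s k)"
  using basis unfolding local_basis_def cellwise_partials_def by blast+

lemma v_order: "mi_order v \<le> sg" "mi_order v < m" "sg < m"
  using basis unfolding local_basis_def by - (elim conjE, assumption)+

lemma dp_continuous: 
  assumes "k < K n" "mi_order s \<le> sg"
  shows "continuous_on (U n) (dp n s k)"
  unfolding U_def
proof (rule continuous_on_open_Union)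
  show "continuous_on \<delta> (dp n s k)" if "\<delta> \<in> \<Delta> n" for \<delta>
    using cellwise(2)[OF assms(1) that] assms(2) unfolding partials_upto_def by blast
qed (use cell in blast)

lemma p_continuous:
  assumes "k < K n"
  shows "continuous_on (U n) (p n k)"
proof -
  have "continuous_on (U n) (dp n (\<lambda>_. 0) k)" using assms by (intro dp_continuous) (auto simp: mi_order_def)
  then show ?thesis
    by (rule continuous_on_cong[THEN iffD1, rotated 2]) (use cellwise(1)[OF assms] U_subset in auto)
qed

text \<open>Induction on the order: a derivative of positive order is a partial derivative of one of
  lower order, which vanishes on the whole open cell.\<close>

lemma dp_inactive:
  assumes k: "k < K n" and d: "\<delta> \<in> \<Delta> n" and na: "\<not> active_on (p n k) \<delta>"
  shows "mi_order s \<le> sg \<Longrightarrow> x \<in> \<delta> \<Longrightarrow> dp n s k x = 0"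
proof (induction "mi_order s" arbitrary: s x)
  case 0
  then have "s = (\<lambda>_. 0)" by (auto simp: mi_order_def)
  then show ?case using cellwise(1)[OF k, of x] 0 d cell na unfolding active_on_def by auto
next
  case (Suc r)
  then obtain i where i: "s i \<noteq> 0" by (force simp: mi_order_def)
  define t where "t = s(i := s i - 1)"
  have s: "s = t(i := Suc (t i))" using i unfolding t_def by auto
  have "mi_order s = mi_order t + 1"
  proof -
    have "mi_order s = s i + sum s (UNIV - {i})" unfolding mi_order_def by (simp add: sum.remove)
    moreover have "mi_order t = t i + sum t (UNIV - {i})" unfolding mi_order_def by (simp add: sum.remove)
    moreover have "sum t (UNIV - {i}) = sum s (UNIV - {i})" unfolding t_def by (intro sum.cong) auto
    ultimately show ?thesis using i by (simp add: t_def)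
  qed
  then have t: "r = mi_order t" "mi_order t < sg" using Suc by auto
  have op: "open \<delta>" using cell[OF d] by blast
  have "((\<lambda>u. dp n t k (x + u *\<^sub>R axis i 1)) has_real_derivative dp n (t(i := Suc (t i))) k x) (at 0)"
    using cellwise(2)[OF k d] t Suc.prems(2) interior_open[OF op] unfolding partials_upto_def by blast
  then have D: "((\<lambda>u. dp n t k (x + u *\<^sub>R axis i 1)) has_real_derivative dp n s k x) (at 0)" using s by simp
  have "((\<lambda>_. 0) has_real_derivative dp n s k x) (at 0)"
  proof (rule has_field_derivative_transform_within_open[OF D])
    show "open ((\<lambda>u. x + u *\<^sub>R axis i 1) -` \<delta>)"
      using op by (intro open_vimage) (auto intro!: continuous_intros)
    show "0 \<in> (\<lambda>u. x + u *\<^sub>R axis i 1) -` \<delta>" using Suc.prems by simp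
    show "dp n t k (x + u *\<^sub>R axis i 1) = 0" if "u \<in> (\<lambda>u. x + u *\<^sub>R axis i 1) -` \<delta>" for u
      using Suc.hyps(1)[OF t(1)] t that by auto
  qed
  then show ?case using DERIV_unique DERIV_const by blast
qed

lemma dp_outside:
  assumes "k < K n" "mi_order s \<le> sg" "x \<in> U n" "x \<notin> region n k"
  shows "dp n s k x = 0"
  using assms dp_inactive[of k n _ s x] unfolding U_def region_def active_region_def active_cells_def by blast

lemma p_outside:
  assumes "k < K n" "x \<in> U n" "x \<notin> region n k"
  shows "p n k x = 0"
  using dp_outside[OF assms(1) _ assms(2,3), of "\<lambda>_. 0"] cellwise(1)[OF assms(1), of x] U_subset assms(2)
  by (auto simp: mi_order_def)

definition active_at :: "nat \<Rightarrow> real^'d \<Rightarrow> nat set" where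
  "active_at n x = {k\<in>{..<K n}. x \<in> region n k}"

text \<open>The hypothesis counts the functions active on the region of a given one. The pointwise
  count follows because a point lies in a single cell: this cell belongs to the region of any
  function active there, so all functions active at the point are active on that region. The added 1
  makes the constant positive.\<close>

lemma counts: "\<exists>C>0. \<forall>n. (\<forall>k<K n. card (active_cells (\<Delta> n) (p n k)) \<le> C) \<and> (\<forall>x. card (active_at n x) \<le> C)"
proof -
  obtain C where C: "\<And>n k. k < K n \<Longrightarrow> card (active_cells (\<Delta> n) (p n k)) \<le> C \<and>
        card {j\<in>{..<K n}. active_on (p n j) (active_region (\<Delta> n) (p n k))} \<le> C"
    using basis unfolding local_basis_def by - (elim conjE exE, blast)
  have "card (active_at n x) \<le> C + 1" for n x
  proof (cases "active_at n x = {}")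
    case False
    then obtain k where k: "k < K n" "x \<in> region n k" unfolding active_at_def by blast
    obtain \<delta> where d: "\<delta> \<in> \<Delta> n" "x \<in> \<delta>" "active_on (p n k) \<delta>"
      using k(2) unfolding region_def active_region_def active_cells_def by blast
    have "active_at n x \<subseteq> {j\<in>{..<K n}. active_on (p n j) (active_region (\<Delta> n) (p n k))}"
    proof
      fix j assume j: "j \<in> active_at n x"
      then obtain \<delta>' where d': "\<delta>' \<in> \<Delta> n" "x \<in> \<delta>'" "active_on (p n j) \<delta>'"
        unfolding active_at_def region_def active_region_def active_cells_def by blast
      have "\<delta>' = \<delta>" using partition_disjoint[of n] d(1,2) d'(1,2) unfolding disjoint_def by blast
      moreover have "\<delta> \<subseteq> active_region (\<Delta> n) (p n k)"
        using d unfolding active_region_def active_cells_def by blast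
      ultimately show "j \<in> {j\<in>{..<K n}. active_on (p n j) (active_region (\<Delta> n) (p n k))}"
        using d'(3) j unfolding active_at_def active_on_def by blast
    qed
    then have "card (active_at n x) \<le> card {j\<in>{..<K n}. active_on (p n j) (active_region (\<Delta> n) (p n k))}"
      by (intro card_mono) auto
    then show ?thesis using C[OF k(1)] by linarith
  qed simp
  then show ?thesis using C by (intro exI[of _ "C + 1"]) (auto intro: le_SucI)
qed

end

lemma set_integrable_open_bounded:
  fixes f :: "'a::euclidean_space \<Rightarrow> real"
  assumes "open S" "bounded S" "continuous_on S f" "\<And>x. x \<in> S \<Longrightarrow> \<bar>f x\<bar> \<le> B"
  shows "set_integrable lborel S f"
  unfolding set_integrable_def
proof (rule Bochner_Integration.integrable_bound)
  show "integrable lborel (\<lambda>x. B * indicator S x)"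
    using assms(1) emeasure_bounded_finite[OF assms(2)] by (intro integrable_mult_right integrable_real_indicator) auto
  show "(\<lambda>x. indicat_real S x *\<^sub>R f x) \<in> borel_measurable lborel"
    using borel_measurable_continuous_on_indicator[of S f] assms(1,3) by simp
  show "AE x in lborel. norm (indicat_real S x *\<^sub>R f x) \<le> norm (B * indicat_real S x)"
    using assms(4) by (intro AE_I2) (auto simp: indicator_def intro: order.trans[OF _ abs_ge_self])
qed

section \<open>Norms of the basis vector and the Gram matrix\<close>

context regular_basis begin

lemma dp_sup:
  assumes "mi_order s \<le> sg"
  shows "\<exists>C>0. \<forall>\<^sub>F n in sequentially. \<forall>x\<in>Xs. eucl_norm (K n) (\<lambda>k. dp n s k x) \<le> C * h n powi (- int (mi_order s))"
proof -
  have "\<forall>s. mi_order s \<le> sg \<longrightarrow>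
       (\<exists>c>0. \<exists>C. eventually (\<lambda>n. \<forall>\<delta>\<in>\<Delta> n. \<forall>x\<in>closure \<delta>.
          c * h n powi (- int (mi_order s)) \<le> eucl_norm (K n) (\<lambda>k. dp n s k x) \<and>
          eucl_norm (K n) (\<lambda>k. dp n s k x) \<le> C * h n powi (- int (mi_order s)))
         sequentially)"
    using basis unfolding local_basis_def by (elim conjE)
  from this[rule_format, OF assms] obtain c C where
    C: "eventually (\<lambda>n. \<forall>\<delta>\<in>\<Delta> n. \<forall>x\<in>closure \<delta>.
          c * h n powi (- int (mi_order s)) \<le> eucl_norm (K n) (\<lambda>k. dp n s k x) \<and>
          eucl_norm (K n) (\<lambda>k. dp n s k x) \<le> C * h n powi (- int (mi_order s))) sequentially" by (elim exE conjE)
  have "\<forall>\<^sub>F n in sequentially. \<forall>x\<in>Xs. eucl_norm (K n) (\<lambda>k. dp n s k x) \<le> max C 1 * h n powi (- int (mi_order s))"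
    using C
  proof eventually_elim
    case (elim n)
    show ?case
    proof
      fix x assume "x \<in> Xs"
      then obtain \<delta> where "\<delta> \<in> \<Delta> n" "x \<in> closure \<delta>" using Xs_cell by blast
      then have "eucl_norm (K n) (\<lambda>k. dp n s k x) \<le> C * h n powi (- int (mi_order s))" using elim by blast
      also have "\<dots> \<le> max C 1 * h n powi (- int (mi_order s))"
        using mesh_pos[of n] by (intro mult_right_mono) (auto simp: less_imp_le)
      finally show "eucl_norm (K n) (\<lambda>k. dp n s k x) \<le> max C 1 * h n powi (- int (mi_order s))" .
    qed
  qed
  then show ?thesis by (intro exI[of _ "max C 1"]) simp
qed

lemma p_sup: "\<exists>C>0. \<forall>\<^sub>F n in sequentially. \<forall>x\<in>Xs. eucl_norm (K n) (\<lambda>k. p n k x) \<le> C"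
proof -
  have z: "mi_order (\<lambda>_::'d. 0) = 0" by (simp add: mi_order_def)
  obtain C where C: "C > 0" "\<forall>\<^sub>F n in sequentially. \<forall>x\<in>Xs. eucl_norm (K n) (\<lambda>k. dp n (\<lambda>_. 0) k x) \<le> C * h n powi (- int (mi_order (\<lambda>_::'d. 0)))"
    using dp_sup[of "\<lambda>_. 0"] z by auto
  have eq: "eucl_norm (K n) (\<lambda>k. dp n (\<lambda>_. 0) k x) = eucl_norm (K n) (\<lambda>k. p n k x)" if "x \<in> Xs" for n x
    unfolding eucl_norm_def using cellwise(1)[OF _ that] by (intro L2_set_cong) auto
  show ?thesis using C by (intro exI[of _ C]) (auto simp: z eq elim!: eventually_mono)
qed

text \<open>At most \<open>c\<close> summands are nonzero, each at most the Euclidean norm of the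
  basis vector. The box constraint on coefficients thereby bounds splines uniformly, with no factor
  growing with \<open>K n\<close>.\<close>

lemma abs_sum_bound:
  "\<exists>C>0. \<forall>\<^sub>F n in sequentially. \<forall>x\<in>U n. (\<Sum>k<K n. \<bar>p n k x\<bar>) \<le> C"
proof -
  obtain C where C: "C > 0" "\<forall>\<^sub>F n in sequentially. \<forall>x\<in>Xs. eucl_norm (K n) (\<lambda>k. p n k x) \<le> C" using p_sup by blast
  obtain c where c: "c > 0" "\<And>n x. card (active_at n x) \<le> c" using counts by blast
  have "\<forall>\<^sub>F n in sequentially. \<forall>x\<in>U n. (\<Sum>k<K n. \<bar>p n k x\<bar>) \<le> real c * C"
    using C(2)
  proof eventually_elim
    case (elim n)
    show ?case
    proof
      fix x assume x: "x \<in> U n"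
      have "(\<Sum>k<K n. \<bar>p n k x\<bar>) = (\<Sum>k\<in>active_at n x. \<bar>p n k x\<bar>)"
        using p_outside[OF _ x] unfolding active_at_def by (intro sum.mono_neutral_right) auto
      also have "\<dots> \<le> (\<Sum>k\<in>active_at n x. C)"
      proof (rule sum_mono)
        fix k assume "k \<in> active_at n x"
        then have "k < K n" unfolding active_at_def by simp
        then have "\<bar>p n k x\<bar> \<le> eucl_norm (K n) (\<lambda>k. p n k x)" by (rule abs_le_eucl_norm)
        also have "\<dots> \<le> C" using elim x U_subset by blast
        finally show "\<bar>p n k x\<bar> \<le> C" .
      qed
      also have "\<dots> \<le> real c * C" using c(2)[of n x] C(1) by simp
      finally show "(\<Sum>k<K n. \<bar>p n k x\<bar>) \<le> real c * C" .
    qed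
  qed
  then show ?thesis using C(1) c(1) by (intro exI[of _ "real c * C"]) auto
qed

lemma abs_dot_sup_le:
  assumes "(\<Sum>k<K n. \<bar>p n k x\<bar>) \<le> C" "\<And>k. k < K n \<Longrightarrow> \<bar>b k\<bar> \<le> B" "0 \<le> B"
  shows "\<bar>dot (K n) (\<lambda>k. p n k x) b\<bar> \<le> C * B"
proof -
  have "\<bar>dot (K n) (\<lambda>k. p n k x) b\<bar> \<le> (\<Sum>k<K n. \<bar>p n k x\<bar> * \<bar>b k\<bar>)"
    unfolding dot_def by (rule order.trans[OF sum_abs]) (simp add: abs_mult)
  also have "\<dots> \<le> (\<Sum>k<K n. \<bar>p n k x\<bar> * B)" by (intro sum_mono mult_left_mono assms) auto
  also have "\<dots> \<le> C * B" unfolding sum_distrib_right[symmetric] by (intro mult_right_mono assms)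
  finally show ?thesis .
qed

lemma dot_continuous: "continuous_on (U n) (\<lambda>x. dot (K n) (\<lambda>k. p n k x) a)"
  unfolding dot_def by (intro continuous_intros p_continuous) auto

lemma bounded_U: "bounded (U n)"
  by (rule bounded_subset[OF bounded_Xs U_subset])

lemma volume_U: "\<exists>V. \<forall>n. measure lborel (U n) \<le> V"
proof -
  obtain r where "\<forall>x\<in>Xs. norm x \<le> r" using bounded_Xs unfolding bounded_iff by blast
  then have r: "Xs \<subseteq> cball 0 r" by auto
  have "measure lborel (U n) \<le> measure lborel (cball (0::real^'d) r)" for n
  proof (rule measure_mono_fmeasurable)
    show "U n \<subseteq> cball 0 r" using r U_subset by blast
    show "U n \<in> sets lborel" using U_open by simp
    show "cball (0::real^'d) r \<in> fmeasurable lborel"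
      using emeasure_bounded_finite[OF bounded_cball, of "0::real^'d" r] by (intro fmeasurableI) auto
  qed
  then show ?thesis by blast
qed

lemma quadratic_form:
  assumes S: "open S" "S \<subseteq> U n" and C: "\<And>x. x \<in> Xs \<Longrightarrow> eucl_norm (K n) (\<lambda>k. p n k x) \<le> C"
  shows "set_integrable lborel S (\<lambda>x. (dot (K n) (\<lambda>k. p n k x) a)\<^sup>2)"
    and "(\<Sum>i<K n. \<Sum>j<K n. a i * (LINT x:S|lborel. p n i x * p n j x) * a j) =
         (LINT x:S|lborel. (dot (K n) (\<lambda>k. p n k x) a)\<^sup>2)"
proof -
  have bS: "bounded S" using bounded_subset[OF bounded_U S(2)] .
  have C0: "0 \<le> C" if "x \<in> S" for x using C[of x] that S(2) U_subset order.trans[OF eucl_norm_nonneg] by blast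
  have le: "\<bar>dot (K n) (\<lambda>k. p n k x) a\<bar> \<le> C * eucl_norm (K n) a" if "x \<in> S" for x
    using that S(2) U_subset C by (intro order.trans[OF abs_dot_le] mult_right_mono) auto
  show "set_integrable lborel S (\<lambda>x. (dot (K n) (\<lambda>k. p n k x) a)\<^sup>2)"
  proof (rule set_integrable_open_bounded[OF S(1) bS])
    show "continuous_on S (\<lambda>x. (dot (K n) (\<lambda>k. p n k x) a)\<^sup>2)"
      by (intro continuous_on_power continuous_on_subset[OF dot_continuous S(2)])
    show "\<bar>(dot (K n) (\<lambda>k. p n k x) a)\<^sup>2\<bar> \<le> (C * eucl_norm (K n) a)\<^sup>2" if "x \<in> S" for x
      using power_mono[OF le[OF that] abs_ge_zero, of 2] by simp
  qed
  have int: "set_integrable lborel S (\<lambda>x. p n i x * p n j x)" if "i < K n" "j < K n" for i j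
  proof (rule set_integrable_open_bounded[OF S(1) bS])
    show "continuous_on S (\<lambda>x. p n i x * p n j x)"
      by (intro continuous_on_mult continuous_on_subset[OF p_continuous S(2)] that)
    show "\<bar>p n i x * p n j x\<bar> \<le> C * C" if x: "x \<in> S" for x
    proof -
      have "x \<in> Xs" using x S(2) U_subset by blast
      then have "\<bar>p n k x\<bar> \<le> C" if "k < K n" for k
        using abs_le_eucl_norm[OF that, of "\<lambda>k. p n k x"] C[of x] by linarith
      then show ?thesis unfolding abs_mult using C0[OF x] \<open>i < K n\<close> \<open>j < K n\<close> by (intro mult_mono) auto
    qed
  qed
  have eq: "(dot (K n) (\<lambda>k. p n k x) a)\<^sup>2 = (\<Sum>i<K n. \<Sum>j<K n. a i * a j * (p n i x * p n j x))" for x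
    unfolding dot_def power2_eq_square sum_product by (intro sum.cong refl) (simp add: mult_ac)
  have "(LINT x:S|lborel. (dot (K n) (\<lambda>k. p n k x) a)\<^sup>2) =
      (\<integral>x. (\<Sum>i<K n. \<Sum>j<K n. a i * a j * (indicator S x *\<^sub>R (p n i x * p n j x))) \<partial>lborel)"
    unfolding eq set_lebesgue_integral_def
    by (intro Bochner_Integration.integral_cong refl) (simp add: sum_distrib_left mult_ac)
  also have "\<dots> = (\<Sum>i<K n. \<Sum>j<K n. \<integral>x. a i * a j * (indicator S x *\<^sub>R (p n i x * p n j x)) \<partial>lborel)"
    by (subst Bochner_Integration.integral_sum;
        (intro sum.cong refl Bochner_Integration.integral_sum)?;
        intro Bochner_Integration.integrable_sum integrable_mult_right int[unfolded set_integrable_def]; simp)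
  also have "\<dots> = (\<Sum>i<K n. \<Sum>j<K n. a i * a j * (LINT x:S|lborel. p n i x * p n j x))"
    unfolding set_lebesgue_integral_def by simp
  finally show "(\<Sum>i<K n. \<Sum>j<K n. a i * (LINT x:S|lborel. p n i x * p n j x) * a j) =
         (LINT x:S|lborel. (dot (K n) (\<lambda>k. p n k x) a)\<^sup>2)" by (simp add: mult_ac)
qed

lemma gram_lower:
  "\<exists>C>0. \<forall>\<^sub>F n in sequentially. \<forall>a. \<forall>k<K n. (a k)\<^sup>2 * h n ^ CARD('d) \<le>
        C * (LINT x:region n k|lborel. (dot (K n) (\<lambda>k. p n k x) a)\<^sup>2)"
proof -
  have "\<exists>C. eventually (\<lambda>n. \<forall>a. \<forall>k<K n.
        (a k)\<^sup>2 * h n ^ CARD('d) \<le>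
        C * (\<Sum>i<K n. \<Sum>j<K n.
               a i * (LINT x:active_region (\<Delta> n) (p n k)|lborel. p n i x * p n j x) * a j))
       sequentially"
    using basis unfolding local_basis_def by (elim conjE)
  then obtain C where C: "\<forall>\<^sub>F n in sequentially. \<forall>a. \<forall>k<K n.
        (a k)\<^sup>2 * h n ^ CARD('d) \<le>
        C * (\<Sum>i<K n. \<Sum>j<K n.
               a i * (LINT x:active_region (\<Delta> n) (p n k)|lborel. p n i x * p n j x) * a j)"
    by (rule exE)
  obtain C' where C': "\<forall>\<^sub>F n in sequentially. \<forall>x\<in>Xs. eucl_norm (K n) (\<lambda>k. p n k x) \<le> C'" using p_sup by blast
  have "\<forall>\<^sub>F n in sequentially. \<forall>a. \<forall>k<K n. (a k)\<^sup>2 * h n ^ CARD('d) \<le>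
        max C 1 * (LINT x:region n k|lborel. (dot (K n) (\<lambda>k. p n k x) a)\<^sup>2)"
    using C C'
  proof eventually_elim
    case (elim n)
    show ?case
    proof (intro allI impI)
      fix a k assume k: "k < K n"
      let ?I = "LINT x:region n k|lborel. (dot (K n) (\<lambda>k. p n k x) a)\<^sup>2"
      have "(a k)\<^sup>2 * h n ^ CARD('d) \<le> C * ?I"
        using elim(1)[rule_format, OF k, of a] quadratic_form(2)[where S="region n k" and n=n and C=C' and a=a, OF region_open region_subset] elim(2)
        unfolding region_def by auto
      also have "\<dots> \<le> max C 1 * ?I"
        unfolding set_lebesgue_integral_def by (intro mult_right_mono integral_nonneg) auto
      finally show "(a k)\<^sup>2 * h n ^ CARD('d) \<le> max C 1 * ?I" .
    qed
  qed
  then show ?thesis by (intro exI[of _ "max C 1"]) simp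
qed

text \<open>Summing the local inequalities over \<open>k\<close> covers each point at most
  \<open>c\<close> times by finite overlap; the smallest eigenvalue of the global Gram matrix is
  therefore at least of order h^d.\<close>

lemma gram_lower_sum:
  "\<exists>C>0. \<forall>\<^sub>F n in sequentially. \<forall>a. (eucl_norm (K n) a)\<^sup>2 * h n ^ CARD('d) \<le>
        C * (LINT x:U n|lborel. (dot (K n) (\<lambda>k. p n k x) a)\<^sup>2)"
proof -
  obtain C where C: "C > 0" "\<forall>\<^sub>F n in sequentially. \<forall>a. \<forall>k<K n. (a k)\<^sup>2 * h n ^ CARD('d) \<le>
        C * (LINT x:region n k|lborel. (dot (K n) (\<lambda>k. p n k x) a)\<^sup>2)" using gram_lower by blast
  obtain c where c: "c > 0" "\<And>n x. card (active_at n x) \<le> c" using counts by blast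
  obtain C' where C': "\<forall>\<^sub>F n in sequentially. \<forall>x\<in>Xs. eucl_norm (K n) (\<lambda>k. p n k x) \<le> C'" using p_sup by blast
  have "\<forall>\<^sub>F n in sequentially. \<forall>a. (eucl_norm (K n) a)\<^sup>2 * h n ^ CARD('d) \<le>
        C * real c * (LINT x:U n|lborel. (dot (K n) (\<lambda>k. p n k x) a)\<^sup>2)"
    using C(2) C'
  proof eventually_elim
    case (elim n)
    show ?case
    proof
      fix a
      let ?g = "\<lambda>x. (dot (K n) (\<lambda>k. p n k x) a)\<^sup>2"
      have iH: "integrable lborel (\<lambda>x. indicator (region n k) x *\<^sub>R ?g x)" for k
        using quadratic_form(1)[where S="region n k" and n=n and C=C' and a=a, OF region_open region_subset] elim(2) unfolding set_integrable_def by auto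
      have iU: "integrable lborel (\<lambda>x. indicator (U n) x *\<^sub>R ?g x)"
        using quadratic_form(1)[where S="U n" and n=n and C=C' and a=a, OF U_open order.refl] elim(2) unfolding set_integrable_def by auto
      have "(eucl_norm (K n) a)\<^sup>2 * h n ^ CARD('d) = (\<Sum>k<K n. (a k)\<^sup>2 * h n ^ CARD('d))"
        by (simp add: eucl_norm_power2 sum_distrib_right)
      also have "\<dots> \<le> (\<Sum>k<K n. C * (LINT x:region n k|lborel. ?g x))"
        using elim(1) by (intro sum_mono) auto
      also have "\<dots> = C * (\<integral>x. (\<Sum>k<K n. indicator (region n k) x *\<^sub>R ?g x) \<partial>lborel)"
        unfolding set_lebesgue_integral_def
        by (subst Bochner_Integration.integral_sum) (auto simp: iH[simplified] sum_distrib_left)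
      also have "\<dots> \<le> C * (\<integral>x. real c * (indicator (U n) x *\<^sub>R ?g x) \<partial>lborel)"
      proof (intro mult_left_mono integral_mono)
        fix x
        show "(\<Sum>k<K n. indicator (region n k) x *\<^sub>R ?g x) \<le> real c * (indicator (U n) x *\<^sub>R ?g x)"
        proof (cases "x \<in> U n")
          case True
          have "(\<Sum>k<K n. indicator (region n k) x *\<^sub>R ?g x) = (\<Sum>k<K n. indicator (region n k) x) * ?g x"
            by (simp add: sum_distrib_right)
          also have "(\<Sum>k<K n. indicator (region n k) x :: real) = real (card (active_at n x))"
          proof -
            have "(\<Sum>k<K n. indicator (region n k) x :: real) = (\<Sum>k\<in>{..<K n}. if x \<in> region n k then 1 else 0)"
              by (intro sum.cong) (simp_all add: indicator_def)
            also have "\<dots> = (\<Sum>k\<in>active_at n x. 1)"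
              unfolding active_at_def by (rule sum.inter_filter[symmetric]) simp
            finally show ?thesis by simp
          qed
          also have "\<dots> * ?g x \<le> real c * ?g x" using c(2)[of n x] by (intro mult_right_mono) auto
          finally show ?thesis using True by simp
        next
          case False
          then have "x \<notin> region n k" for k using region_subset by blast
          then show ?thesis by simp
        qed
      next
        show "integrable lborel (\<lambda>x. \<Sum>k<K n. indicator (region n k) x *\<^sub>R ?g x)"
          by (intro Bochner_Integration.integrable_sum iH)
        show "integrable lborel (\<lambda>x. real c * (indicator (U n) x *\<^sub>R ?g x))"
          by (intro integrable_mult_right iU)
      qed (use C(1) in simp)
      also have "\<dots> = C * real c * (LINT x:U n|lborel. ?g x)"
        unfolding set_lebesgue_integral_def by simp
      finally show "(eucl_norm (K n) a)\<^sup>2 * h n ^ CARD('d) \<le> C * real c * (LINT x:U n|lborel. ?g x)" .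
    qed
  qed
  then show ?thesis using C(1) c(1) by (intro exI[of _ "C * real c"]) auto
qed

text \<open>Tested with unit vectors, the local inequality gives every basis function a squared L2
  norm of order at least h^d. Pointwise the squares sum to a bounded function on a set of bounded
  volume, so at most order h^(-d) functions fit.\<close>

lemma dimension_bound: "\<exists>C>0. \<forall>\<^sub>F n in sequentially. real (K n) * h n ^ CARD('d) \<le> C"
proof -
  obtain C where C: "C > 0" "\<forall>\<^sub>F n in sequentially. \<forall>a. \<forall>k<K n. (a k)\<^sup>2 * h n ^ CARD('d) \<le>
        C * (LINT x:region n k|lborel. (dot (K n) (\<lambda>k. p n k x) a)\<^sup>2)" using gram_lower by blast
  obtain C' where C': "C' > 0" "\<forall>\<^sub>F n in sequentially. \<forall>x\<in>Xs. eucl_norm (K n) (\<lambda>k. p n k x) \<le> C'" using p_sup by blast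
  obtain V where V: "\<And>n. measure lborel (U n) \<le> V" using volume_U by blast
  have V0: "0 \<le> V" using V[of 0] measure_nonneg order.trans by blast
  have "\<forall>\<^sub>F n in sequentially. real (K n) * h n ^ CARD('d) \<le> C * (C'\<^sup>2 * V) + 1"
    using C(2) C'(2)
  proof eventually_elim
    case (elim n)
    let ?e = "\<lambda>k i. of_bool (i = k) :: real"
    have dot_e: "dot (K n) (\<lambda>k. p n k x) (?e k) = p n k x" if "k < K n" for k x
      unfolding dot_def using that by (simp add: of_bool_def if_distrib cong: if_cong)
    have iH: "integrable lborel (\<lambda>x. indicator S x *\<^sub>R (p n k x)\<^sup>2)" if "k < K n" "open S" "S \<subseteq> U n" for k S
      using quadratic_form(1)[where S=S and n=n and C=C' and a="?e k", OF that(2,3)] elim(2) dot_e[OF that(1)] unfolding set_integrable_def by auto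
    have "h n ^ CARD('d) \<le> C * (\<integral>x. indicator (U n) x *\<^sub>R (p n k x)\<^sup>2 \<partial>lborel)" if k: "k < K n" for k
    proof -
      have "h n ^ CARD('d) \<le> C * (\<integral>x. indicator (region n k) x *\<^sub>R (p n k x)\<^sup>2 \<partial>lborel)"
        using elim(1)[rule_format, OF k, of "?e k"] dot_e[OF k] unfolding set_lebesgue_integral_def by simp
      also have "\<dots> \<le> C * (\<integral>x. indicator (U n) x *\<^sub>R (p n k x)\<^sup>2 \<partial>lborel)"
        using C(1) region_subset by (intro mult_left_mono integral_mono iH k region_open U_open) (auto simp: indicator_def)
      finally show ?thesis .
    qed
    then have "(\<Sum>k<K n. h n ^ CARD('d)) \<le> (\<Sum>k<K n. C * (\<integral>x. indicator (U n) x *\<^sub>R (p n k x)\<^sup>2 \<partial>lborel))"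
      by (intro sum_mono) auto
    also have "\<dots> = C * (\<integral>x. (\<Sum>k<K n. indicator (U n) x *\<^sub>R (p n k x)\<^sup>2) \<partial>lborel)"
      by (subst Bochner_Integration.integral_sum) (auto simp: iH[OF _ U_open order.refl, simplified] sum_distrib_left)
    also have "\<dots> \<le> C * (\<integral>x. C'\<^sup>2 * indicator (U n) x \<partial>lborel)"
    proof (intro mult_left_mono integral_mono)
      show "integrable lborel (\<lambda>x. \<Sum>k<K n. indicator (U n) x *\<^sub>R (p n k x)\<^sup>2)"
        by (intro Bochner_Integration.integrable_sum iH U_open) auto
      show "integrable lborel (\<lambda>x. C'\<^sup>2 * indicator (U n) x)"
        using U_open emeasure_bounded_finite[OF bounded_U] by (intro integrable_mult_right integrable_real_indicator) auto
      fix x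
      show "(\<Sum>k<K n. indicator (U n) x *\<^sub>R (p n k x)\<^sup>2) \<le> C'\<^sup>2 * indicator (U n) x"
      proof (cases "x \<in> U n")
        case True
        then have "eucl_norm (K n) (\<lambda>k. p n k x) \<le> C'" using elim(2) U_subset by blast
        then have "(eucl_norm (K n) (\<lambda>k. p n k x))\<^sup>2 \<le> C'\<^sup>2" by (rule power_mono) simp
        then show ?thesis using True by (simp add: eucl_norm_power2)
      qed simp
    qed (use C(1) in simp)
    also have "\<dots> = C * (C'\<^sup>2 * measure lborel (U n))" using U_open by simp
    also have "\<dots> \<le> C * (C'\<^sup>2 * V)" using C(1) by (intro mult_left_mono V) auto
    finally show ?case by simp
  qed
  then show ?thesis using C(1) V0 by (intro exI[of _ "C * (C'\<^sup>2 * V) + 1"]) (auto intro: add_nonneg_pos)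
qed

text \<open>At a point only coefficients of active functions enter, so Cauchy-Schwarz is applied
  with the coefficient vector restricted to them. Integration then charges each squared coefficient
  with the volume of its region, of order h^d; this is the gain over the sup norm bound.\<close>

lemma derivative_L2:
  "\<exists>C>0. \<forall>\<^sub>F n in sequentially. \<forall>a. (\<integral>\<^sup>+x\<in>U n. ennreal ((dot (K n) (\<lambda>k. dp n v k x) a)\<^sup>2) \<partial>lborel)
      \<le> ennreal (C * h n powi (int CARD('d) - 2 * int (mi_order v)) * (eucl_norm (K n) a)\<^sup>2)"
proof -
  obtain C where C: "C > 0" "\<forall>\<^sub>F n in sequentially. \<forall>x\<in>Xs. eucl_norm (K n) (\<lambda>k. dp n v k x) \<le> C * h n powi (- int (mi_order v))"
    using dp_sup[OF v_order(1)] by blast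
  obtain c where c: "c > 0" "\<And>n k. k < K n \<Longrightarrow> card (active_cells (\<Delta> n) (p n k)) \<le> c" using counts by blast
  define ub where "ub = unit_ball_vol (real CARD('d))"
  have ub: "ub > 0" unfolding ub_def by (simp add: unit_ball_vol_pos)
  have vol: "emeasure lborel (region n k) \<le> ennreal (real c * ub * h n ^ CARD('d))" if k: "k < K n" for n k
  proof -
    have "emeasure lborel (region n k) \<le> (\<Sum>\<delta>\<in>active_cells (\<Delta> n) (p n k). emeasure lborel \<delta>)"
    proof -
      have "finite (active_cells (\<Delta> n) (p n k))" using finite_partition[of n] by (simp add: active_cells_def)
      moreover have "(\<lambda>\<delta>. \<delta>) ` active_cells (\<Delta> n) (p n k) \<subseteq> sets lborel"
        using cell by (auto simp: active_cells_def)
      ultimately show ?thesis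
        unfolding region_def active_region_def by (simp add: emeasure_subadditive_finite[where A="\<lambda>\<delta>. \<delta>", simplified])
    qed
    also have "\<dots> \<le> (\<Sum>\<delta>\<in>active_cells (\<Delta> n) (p n k). ennreal (ub * h n ^ CARD('d)))"
      unfolding ub_def by (intro sum_mono cell_volume) (auto simp: active_cells_def)
    also have "\<dots> = ennreal (real (card (active_cells (\<Delta> n) (p n k)))) * ennreal (ub * h n ^ CARD('d))"
      by (simp add: ennreal_of_nat_eq_real_of_nat)
    also have "\<dots> = ennreal (real (card (active_cells (\<Delta> n) (p n k))) * (ub * h n ^ CARD('d)))"
      using ub mesh_pos[of n] by (intro ennreal_mult[symmetric]) (auto simp: less_imp_le)
    also have "\<dots> \<le> ennreal (real c * (ub * h n ^ CARD('d)))"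
      using c(2)[OF k] ub mesh_pos[of n] by (intro ennreal_leI mult_right_mono) (auto simp: less_imp_le)
    finally show ?thesis by (simp add: mult_ac)
  qed
  have "\<forall>\<^sub>F n in sequentially. \<forall>a. (\<integral>\<^sup>+x\<in>U n. ennreal ((dot (K n) (\<lambda>k. dp n v k x) a)\<^sup>2) \<partial>lborel)
      \<le> ennreal (C\<^sup>2 * real c * ub * h n powi (int CARD('d) - 2 * int (mi_order v)) * (eucl_norm (K n) a)\<^sup>2)"
    using C(2)
  proof eventually_elim
    case (elim n)
    define B where "B = (C * h n powi (- int (mi_order v)))\<^sup>2"
    have B0: "B \<ge> 0" unfolding B_def by simp
    have Bh: "B * h n ^ CARD('d) = C\<^sup>2 * h n powi (int CARD('d) - 2 * int (mi_order v))"
    proof -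
      have "(h n powi (- int (mi_order v)))\<^sup>2 * h n powi (int CARD('d)) = h n powi (int CARD('d) - 2 * int (mi_order v))"
      proof -
        have nz: "h n \<noteq> 0" using mesh_pos[of n] by simp
        have "(h n powi (- int (mi_order v)))\<^sup>2 = h n powi (- (2 * int (mi_order v)))"
          unfolding power2_eq_square power_int_add[OF disjI1[OF nz], symmetric] by simp
        then show ?thesis using power_int_add[OF disjI1[OF nz], of "- (2 * int (mi_order v))" "int CARD('d)"] by simp
      qed
      then show ?thesis unfolding B_def by (simp add: power_mult_distrib power_int_of_nat)
    qed
    show ?case
    proof
      fix a
      have "(\<integral>\<^sup>+x\<in>U n. ennreal ((dot (K n) (\<lambda>k. dp n v k x) a)\<^sup>2) \<partial>lborel) \<le>
        (\<integral>\<^sup>+x. (\<Sum>k<K n. ennreal (B * (a k)\<^sup>2) * indicator (region n k) x) \<partial>lborel)"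
      proof (rule nn_integral_mono)
        fix x
        show "ennreal ((dot (K n) (\<lambda>k. dp n v k x) a)\<^sup>2) * indicator (U n) x
          \<le> (\<Sum>k<K n. ennreal (B * (a k)\<^sup>2) * indicator (region n k) x)"
        proof (cases "x \<in> U n")
          case x: True
          define a' where "a' k = (if k \<in> active_at n x then a k else 0)" for k
          have "dot (K n) (\<lambda>k. dp n v k x) a = dot (K n) (\<lambda>k. dp n v k x) a'"
            unfolding dot_def a'_def active_at_def using dp_outside[OF _ v_order(1) x] by (intro sum.cong) auto
          then have "\<bar>dot (K n) (\<lambda>k. dp n v k x) a\<bar> \<le> C * h n powi (- int (mi_order v)) * eucl_norm (K n) a'"
            using elim x U_subset by (auto intro!: order.trans[OF abs_dot_le] mult_right_mono)
          then have "(dot (K n) (\<lambda>k. dp n v k x) a)\<^sup>2 \<le> (C * h n powi (- int (mi_order v)) * eucl_norm (K n) a')\<^sup>2"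
            by (metis abs_ge_zero power2_abs power_mono)
          also have "\<dots> = B * (\<Sum>k<K n. (a' k)\<^sup>2)" unfolding B_def eucl_norm_power2[symmetric] by (simp add: power_mult_distrib)
          also have "\<dots> = (\<Sum>k<K n. B * (a k)\<^sup>2 * indicator (region n k) x)"
            unfolding sum_distrib_left a'_def active_at_def by (intro sum.cong) (auto simp: indicator_def)
          finally have "ennreal ((dot (K n) (\<lambda>k. dp n v k x) a)\<^sup>2) \<le> ennreal (\<Sum>k<K n. B * (a k)\<^sup>2 * indicator (region n k) x)"
            by (rule ennreal_leI)
          also have "\<dots> = (\<Sum>k<K n. ennreal (B * (a k)\<^sup>2) * indicator (region n k) x)"
            using B0 by (subst sum_ennreal[symmetric]) (auto simp: indicator_def intro!: sum.cong)
          finally show ?thesis using x by simp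
        qed simp
      qed
      also have "\<dots> = (\<Sum>k<K n. ennreal (B * (a k)\<^sup>2) * emeasure lborel (region n k))"
        using region_open by (subst nn_integral_sum) (auto simp: nn_integral_cmult)
      also have "\<dots> \<le> (\<Sum>k<K n. ennreal (B * (a k)\<^sup>2) * ennreal (real c * ub * h n ^ CARD('d)))"
        by (intro sum_mono mult_left_mono vol) auto
      also have "\<dots> = (\<Sum>k<K n. ennreal (B * (a k)\<^sup>2 * (real c * ub * h n ^ CARD('d))))"
        using B0 ub mesh_pos[of n] by (intro sum.cong refl ennreal_mult[symmetric]) (auto simp: less_imp_le)
      also have "\<dots> = ennreal (\<Sum>k<K n. B * (a k)\<^sup>2 * (real c * ub * h n ^ CARD('d)))"
        using B0 ub mesh_pos[of n] by (intro sum_ennreal) (auto simp: less_imp_le)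
      also have "(\<Sum>k<K n. B * (a k)\<^sup>2 * (real c * ub * h n ^ CARD('d))) = (B * h n ^ CARD('d)) * (real c * ub) * (\<Sum>k<K n. (a k)\<^sup>2)"
        unfolding sum_distrib_left by (intro sum.cong) (auto simp: mult_ac)
      also have "\<dots> = C\<^sup>2 * real c * ub * h n powi (int CARD('d) - 2 * int (mi_order v)) * (eucl_norm (K n) a)\<^sup>2"
        unfolding Bh eucl_norm_power2 by (simp add: mult_ac)
      finally show "(\<integral>\<^sup>+x\<in>U n. ennreal ((dot (K n) (\<lambda>k. dp n v k x) a)\<^sup>2) \<partial>lborel)
      \<le> ennreal (C\<^sup>2 * real c * ub * h n powi (int CARD('d) - 2 * int (mi_order v)) * (eucl_norm (K n) a)\<^sup>2)" .
    qed
  qed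
  then show ?thesis using C(1) c(1) ub by (intro exI[of _ "C\<^sup>2 * real c * ub"]) auto
qed

end

section \<open>Moments of the loss increments\<close>

locale series_estimation =
  regular_loss Xs Ys Es Qs N fYX rho psi psibar eta mu0 \<alpha> \<nu> B0 +
  regular_basis Xs \<Delta> K p dp v m sg
  for Xs :: "(real^'d::finite) set" and Ys Es Qs N fYX rho psi psibar eta mu0 \<alpha> \<nu> B0
    and \<Delta> K p dp v m sg +
  fixes M :: "'w measure" and xs :: "nat \<Rightarrow> 'w \<Rightarrow> real^'d" and ys :: "nat \<Rightarrow> 'w \<Rightarrow> real" and fX :: "real^'d \<Rightarrow> real"
  assumes sample: "random_sample M Xs Ys xs ys N fX fYX"
    and fX_nonneg: "\<And>x. 0 \<le> fX x" and fX_outside: "\<And>x. x \<notin> Xs \<Longrightarrow> fX x = 0"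
    and fX_lower: "\<exists>c>0. \<forall>x\<in>Xs. c \<le> fX x"
begin

definition joint_density :: "(real^'d) \<times> real \<Rightarrow> real" where "joint_density = (\<lambda>(x, y). fX x * fYX x y)"

definition law :: "((real^'d) \<times> real) measure" where
  "law = density (lborel \<Otimes>\<^sub>M N) (\<lambda>z. ennreal (joint_density z))"

definition Z :: "nat \<Rightarrow> 'w \<Rightarrow> (real^'d) \<times> real" where "Z i \<omega> = (xs i \<omega>, ys i \<omega>)"

text \<open>The sample lies in this set almost surely. Off the open cells the values of the basis functions are
  arbitrary up to a Euclidean bound, so that neither measurability nor a bound on \<open>p(x)\<^sup>T b\<close> is available.\<close>

definition good_points :: "nat \<Rightarrow> ((real^'d) \<times> real) set" where
  "good_points n = {z. fst z \<in> U n \<and> joint_density z \<noteq> 0}"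

lemma joint_density_nonneg: "0 \<le> joint_density z"
  using fX_nonneg[of "fst z"] fYX_nonneg[of "fst z" "snd z"] fX_outside[of "fst z"]
  unfolding joint_density_def case_prod_unfold by (cases "fst z \<in> Xs") auto

lemma prob_M: "prob_space M"
  and in_Xs: "\<omega> \<in> space M \<Longrightarrow> xs i \<omega> \<in> Xs" and in_Ys: "\<omega> \<in> space M \<Longrightarrow> ys i \<omega> \<in> Ys"
  and indep_Z: "prob_space.indep_vars M (\<lambda>_. borel \<Otimes>\<^sub>M borel) Z UNIV"
  and distr_X: "distributed M lborel (xs i) (\<lambda>x. ennreal (fX x))"
  and distr_Z: "distributed M (lborel \<Otimes>\<^sub>M N) (Z i) (\<lambda>z. ennreal (joint_density z))"
  using sample unfolding random_sample_def Z_def[abs_def] joint_density_def case_prod_unfold by auto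

lemma sets_pair [measurable_cong]: "sets (lborel \<Otimes>\<^sub>M N) = sets (borel \<Otimes>\<^sub>M borel)"
  by (intro sets_pair_measure_cong) (simp_all add: sets_N)

lemma sets_law [simp, measurable_cong]: "sets law = sets (borel \<Otimes>\<^sub>M borel)"
  unfolding law_def by (simp only: sets_density sets_pair)

text \<open>The distribution hypothesis concerns the density as an \<open>ennreal\<close>;
  nonnegativity allows the way back to the reals.\<close>

lemma joint_density_measurable [measurable]: "joint_density \<in> borel_measurable (borel \<Otimes>\<^sub>M borel)"
proof -
  have "(\<lambda>z. ennreal (joint_density z)) \<in> borel_measurable (lborel \<Otimes>\<^sub>M N)"
    using distr_Z[of 0] unfolding distributed_def by simp
  then have "(\<lambda>z. enn2real (ennreal (joint_density z))) \<in> borel_measurable (lborel \<Otimes>\<^sub>M N)" by measurable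
  then have "joint_density \<in> borel_measurable (lborel \<Otimes>\<^sub>M N)" using joint_density_nonneg by simp
  then show ?thesis by (simp only: measurable_cong_sets[OF sets_pair refl])
qed

lemma Z_measurable [measurable]: "Z i \<in> measurable M (borel \<Otimes>\<^sub>M borel)"
proof -
  interpret prob_space M by (rule prob_M)
  show ?thesis using indep_Z by (simp add: indep_vars_def)
qed

lemma law_Z: "distr M (borel \<Otimes>\<^sub>M borel) (Z i) = law"
proof -
  have "distr M (lborel \<Otimes>\<^sub>M N) (Z i) = law"
    using distr_Z[of i] unfolding distributed_def law_def by simp
  moreover have "distr M (borel \<Otimes>\<^sub>M borel) (Z i) = distr M (lborel \<Otimes>\<^sub>M N) (Z i)"
    by (rule distr_cong) (simp_all only: sets_pair)
  ultimately show ?thesis by simp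
qed

lemma U_sets [measurable]: "U n \<in> sets borel"
  using U_open by simp

lemma fX_measurable [measurable]: "fX \<in> borel_measurable borel"
proof -
  have "(\<lambda>x. ennreal (fX x)) \<in> borel_measurable lborel"
    using distr_X[of 0] unfolding distributed_def by simp
  then have "(\<lambda>x. enn2real (ennreal (fX x))) \<in> borel_measurable lborel" by measurable
  then show ?thesis using fX_nonneg by simp
qed

lemma fX_integral: "(\<integral>\<^sup>+x. ennreal (fX x) \<partial>lborel) = 1"
proof -
  interpret prob_space M by (rule prob_M)
  have "prob_space (distr M lborel (xs 0))"
    using distr_X[of 0] unfolding distributed_def by (intro prob_space_distr) auto
  then have "emeasure (distr M lborel (xs 0)) UNIV = 1"
    by (auto dest!: prob_space.emeasure_space_1)
  moreover have "distr M lborel (xs 0) = density lborel (\<lambda>x. ennreal (fX x))"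
    using distr_X[of 0] unfolding distributed_def by simp
  ultimately show ?thesis by (simp add: emeasure_density)
qed

lemma fX_integrable: "integrable lborel fX" and fX_integral_eq: "(\<integral>x. fX x \<partial>lborel) = 1"
proof -
  show i: "integrable lborel fX" by (intro integrableI_nonneg) (auto simp: fX_nonneg fX_integral)
  show "(\<integral>x. fX x \<partial>lborel) = 1"
    using fX_integral fX_nonneg by (simp add: integral_eq_nn_integral)
qed

lemma good_points_sets [measurable]: "good_points n \<in> sets (borel \<Otimes>\<^sub>M borel)"
proof -
  have "{z \<in> space (borel \<Otimes>\<^sub>M borel). fst z \<in> U n \<and> joint_density z \<noteq> 0} \<in> sets (borel \<Otimes>\<^sub>M borel)" by measurable
  then show ?thesis by (simp add: good_points_def space_pair_measure)
qed

lemma good_points_subset: "(x, y) \<in> good_points n \<Longrightarrow> x \<in> U n \<and> x \<in> Xs \<and> fYX x y \<noteq> 0 \<and> y \<in> Ys"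
  using U_subset[of n] fYX_Ys[of x y] unfolding good_points_def joint_density_def by auto

text \<open>Two null events are excluded: a covariate on the boundary of a cell, which is null under
  a Lebesgue density, and a pair at which the joint density vanishes.\<close>

lemma AE_good_points: "AE \<omega> in M. \<forall>i. Z i \<omega> \<in> good_points n"
proof -
  have "AE \<omega> in M. Z i \<omega> \<in> good_points n" for i
  proof -
    have "AE x in lborel. fX x \<noteq> 0 \<longrightarrow> x \<in> U n"
      using AE_U[of n] by eventually_elim (use fX_outside in auto)
    then have "AE x in density lborel (\<lambda>x. ennreal (fX x)). x \<in> U n"
      by (subst AE_density) (auto elim!: eventually_mono simp: fX_nonneg less_le)
    moreover have "distr M lborel (xs i) = density lborel (\<lambda>x. ennreal (fX x))"
      using distr_X[of i] unfolding distributed_def by simp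
    ultimately have "AE x in distr M lborel (xs i). x \<in> U n" by (simp only:)
    moreover have [measurable]: "xs i \<in> measurable M lborel"
      using distr_X[of i] unfolding distributed_def by simp
    ultimately have 1: "AE \<omega> in M. xs i \<omega> \<in> U n"
      by (subst (asm) AE_distr_iff) auto
    have "AE z in law. joint_density z \<noteq> 0"
      unfolding law_def by (subst AE_density) auto
    then have "AE z in distr M (borel \<Otimes>\<^sub>M borel) (Z i). joint_density z \<noteq> 0" unfolding law_Z .
    then have 2: "AE \<omega> in M. joint_density (Z i \<omega>) \<noteq> 0"
      by (subst (asm) AE_distr_iff) auto
    from 1 2 show ?thesis by eventually_elim (simp add: good_points_def Z_def)
  qed
  then show ?thesis by (simp add: AE_all_countable)
qed

definition spline :: "nat \<Rightarrow> (nat \<Rightarrow> real) \<Rightarrow> real^'d \<Rightarrow> real" where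
  "spline n b x = dot (K n) (\<lambda>k. p n k x) b"

text \<open>The increment d of the overview, set to zero off \<open>good_points\<close>. This makes
  it measurable and bounded by the envelope everywhere, and alters the sample values on a null event
  only.\<close>

definition loss_diff :: "nat \<Rightarrow> (nat \<Rightarrow> real) \<Rightarrow> (nat \<Rightarrow> real) \<Rightarrow> real \<Rightarrow> (real^'d) \<times> real \<Rightarrow> real" where
  "loss_diff n b b0 q z = (rho (snd z) (eta (spline n b (fst z))) q - rho (snd z) (eta (spline n b0 (fst z))) q) * indicator (good_points n) z"

lemma spline_continuous: "continuous_on (U n) (spline n b)"
  using dot_continuous unfolding spline_def[abs_def] .

lemma spline_diff: "spline n b x - spline n b0 x = spline n (\<lambda>k. b k - b0 k) x"
  unfolding spline_def by (rule dot_diff_right)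

lemma rho_spline_measurable:
  assumes meas: "(\<lambda>(y, e). rho y e q) \<in> borel_measurable (restrict_space borel (Ys \<times> Es))"
  shows "(\<lambda>z. rho (snd z) (eta (spline n b (fst z))) q * indicator (good_points n) z) \<in> borel_measurable (borel \<Otimes>\<^sub>M borel)"
proof -
  let ?f = "\<lambda>z. (snd z, eta (spline n b (fst z)))"
  have "continuous_on (U n \<times> Ys) ?f"
    by (intro continuous_intros continuous_on_compose2[OF eta_cont[of UNIV]] continuous_on_compose2[OF spline_continuous]) auto
  then have "?f \<in> measurable (restrict_space borel (U n \<times> Ys)) borel"
    by (rule borel_measurable_continuous_on_restrict)
  then have "?f \<in> measurable (restrict_space borel (U n \<times> Ys)) (restrict_space borel (Ys \<times> Es))"
    by (rule measurable_restrict_space2[rotated]) (auto simp: space_restrict_space eta_Es)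
  from measurable_compose[OF this meas]
  have "(\<lambda>z. rho (snd z) (eta (spline n b (fst z))) q) \<in> borel_measurable (restrict_space borel (U n \<times> Ys))" by simp
  then have "(\<lambda>z. rho (snd z) (eta (spline n b (fst z))) q * indicator (good_points n) z) \<in> borel_measurable borel"
  proof (rule borel_measurable_indicator_restrict)
    show "good_points n \<in> sets borel" using good_points_sets[of n] by (simp only: borel_prod)
    show "good_points n \<subseteq> U n \<times> Ys" using good_points_subset by auto
  qed
  then show ?thesis by (simp add: borel_prod)
qed

lemma loss_diff_measurable:
  assumes meas: "(\<lambda>(y, e). rho y e q) \<in> borel_measurable (restrict_space borel (Ys \<times> Es))"
  shows "loss_diff n b b0 q \<in> borel_measurable (borel \<Otimes>\<^sub>M borel)"
proof -
  have "loss_diff n b b0 q = (\<lambda>z. rho (snd z) (eta (spline n b (fst z))) q * indicator (good_points n) z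
     - rho (snd z) (eta (spline n b0 (fst z))) q * indicator (good_points n) z)"
    by (rule ext) (simp add: loss_diff_def algebra_simps)
  then show ?thesis using rho_spline_measurable[OF meas] by simp
qed

lemma psibar_Z_measurable: "{\<omega>\<in>space M. psibar (xs i \<omega>) (ys i \<omega>) \<le> J} \<in> sets M"
proof -
  have "Z i \<in> measurable M (restrict_space borel (Xs \<times> Ys))"
    using Z_measurable[of i] in_Xs in_Ys
    by (intro measurable_restrict_space2) (auto simp: borel_prod Z_def)
  from measurable_compose[OF this psibar_meas]
  have "(\<lambda>\<omega>. psibar (xs i \<omega>) (ys i \<omega>)) \<in> borel_measurable M" by (simp add: Z_def)
  then show ?thesis by measurable
qed

text \<open>The quantity s of the overview: the second moment of the spline with coefficients
  \<open>a\<close> at a random covariate, which lies in \<open>U n\<close> almost surely.\<close>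

definition L2_mass :: "nat \<Rightarrow> (nat \<Rightarrow> real) \<Rightarrow> real" where
  "L2_mass n a = (\<integral>x. indicator (U n) x * (spline n a x)\<^sup>2 * fX x \<partial>lborel)"

lemma spline_indicator_measurable [measurable]: "(\<lambda>x. indicator (U n) x * spline n a x) \<in> borel_measurable borel"
  using borel_measurable_continuous_on_indicator[OF U_sets spline_continuous] by simp

lemma L2_mass_integrable:
  assumes "\<And>x. x \<in> U n \<Longrightarrow> \<bar>spline n a x\<bar> \<le> W"
  shows "integrable lborel (\<lambda>x. indicator (U n) x * (spline n a x)\<^sup>2 * fX x)"
proof (rule Bochner_Integration.integrable_bound)
  show "integrable lborel (\<lambda>x. W\<^sup>2 * fX x)" using fX_integrable by simp
  have "(\<lambda>x. indicator (U n) x * (spline n a x)\<^sup>2 * fX x) = (\<lambda>x. (indicator (U n) x * spline n a x)\<^sup>2 * fX x)"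
    by (rule ext) (simp add: indicator_def)
  then show "(\<lambda>x. indicator (U n) x * (spline n a x)\<^sup>2 * fX x) \<in> borel_measurable lborel" by simp
  have "(spline n a x)\<^sup>2 \<le> W\<^sup>2" if "x \<in> U n" for x
    using power_mono[OF assms[OF that] abs_ge_zero, of 2] by simp
  then show "AE x in lborel. norm (indicator (U n) x * (spline n a x)\<^sup>2 * fX x) \<le> norm (W\<^sup>2 * fX x)"
    by (intro AE_I2) (auto simp: indicator_def fX_nonneg abs_mult intro!: mult_right_mono)
qed

lemma loss_diff_abs_le:
  assumes lip: "\<And>x y z1 z2. x \<in> Xs \<Longrightarrow> y \<in> Ys \<Longrightarrow> \<bar>z1\<bar> \<le> W \<Longrightarrow> \<bar>z2\<bar> \<le> W \<Longrightarrow>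
       \<bar>rho y (eta z1) q - rho y (eta z2) q\<bar> \<le> L * (psibar x y + 1) * \<bar>z1 - z2\<bar>"
    and W: "\<And>x. x \<in> U n \<Longrightarrow> \<bar>spline n b x\<bar> \<le> W" "\<And>x. x \<in> U n \<Longrightarrow> \<bar>spline n b0 x\<bar> \<le> W"
  shows "\<bar>loss_diff n b b0 q (x, y)\<bar> \<le> indicator (good_points n) (x, y) * (L * (psibar x y + 1) * \<bar>spline n (\<lambda>k. b k - b0 k) x\<bar>)"
proof (cases "(x, y) \<in> good_points n")
  case True
  then have "x \<in> U n" "x \<in> Xs" "y \<in> Ys" using good_points_subset by blast+
  then show ?thesis using lip[of x y "spline n b x" "spline n b0 x"] W True
    unfolding loss_diff_def spline_diff[symmetric] by simp
qed (simp add: loss_diff_def)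

lemma nn_integral_law:
  assumes [measurable]: "H \<in> borel_measurable (borel \<Otimes>\<^sub>M borel)"
  shows "(\<integral>\<^sup>+z. H z \<partial>law) = (\<integral>\<^sup>+x. \<integral>\<^sup>+y. ennreal (joint_density (x, y)) * H (x, y) \<partial>N \<partial>lborel)"
proof -
  interpret N: sigma_finite_measure N by (rule sigma_finite_N)
  have "(\<integral>\<^sup>+z. H z \<partial>law) = (\<integral>\<^sup>+z. ennreal (joint_density z) * H z \<partial>(lborel \<Otimes>\<^sub>M N))"
    unfolding law_def by (intro nn_integral_density) measurable
  also have "\<dots> = (\<integral>\<^sup>+x. \<integral>\<^sup>+y. ennreal (joint_density (x, y)) * H (x, y) \<partial>N \<partial>lborel)"
    by (subst N.nn_integral_fst[symmetric]) auto
  finally show ?thesis .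
qed

text \<open>Given the covariate, the increment is at most \<open>L\<close> times the envelope plus 1
  times the spline of the coefficient difference. The conditional second moment of the envelope
  factor is at most \<open>C\<close>, and the integral over the covariate leaves
  \<open>L2_mass\<close>.\<close>

lemma loss_diff_second_moment:
  assumes meas: "(\<lambda>(y, e). rho y e q) \<in> borel_measurable (restrict_space borel (Ys \<times> Es))"
    and lip: "\<And>x y z1 z2. x \<in> Xs \<Longrightarrow> y \<in> Ys \<Longrightarrow> \<bar>z1\<bar> \<le> W \<Longrightarrow> \<bar>z2\<bar> \<le> W \<Longrightarrow>
       \<bar>rho y (eta z1) q - rho y (eta z2) q\<bar> \<le> L * (psibar x y + 1) * \<bar>z1 - z2\<bar>"
    and W: "\<And>x. x \<in> U n \<Longrightarrow> \<bar>spline n b x\<bar> \<le> W" "\<And>x. x \<in> U n \<Longrightarrow> \<bar>spline n b0 x\<bar> \<le> W"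
    and C: "0 \<le> C" "\<And>x. x \<in> Xs \<Longrightarrow> (\<integral>\<^sup>+y. ennreal ((psibar x y + 1)\<^sup>2 * fYX x y) \<partial>N) \<le> ennreal C"
  shows "integrable law (\<lambda>z. (loss_diff n b b0 q z)\<^sup>2)"
    and "(\<integral>z. (loss_diff n b b0 q z)\<^sup>2 \<partial>law) \<le> L\<^sup>2 * C * L2_mass n (\<lambda>k. b k - b0 k)"
proof -
  let ?a = "\<lambda>k. b k - b0 k" and ?F = "loss_diff n b b0 q"
  note [measurable] = loss_diff_measurable[OF meas, of n b b0]
  have Wa: "\<bar>spline n ?a x\<bar> \<le> 2 * W" if "x \<in> U n" for x
    using W[OF that] unfolding spline_diff[symmetric] by linarith
  have "(\<integral>\<^sup>+z. ennreal ((?F z)\<^sup>2) \<partial>law) = (\<integral>\<^sup>+x. \<integral>\<^sup>+y. ennreal (joint_density (x, y)) * ennreal ((?F (x, y))\<^sup>2) \<partial>N \<partial>lborel)"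
    by (rule nn_integral_law) measurable
  also have "\<dots> \<le> (\<integral>\<^sup>+x. ennreal (indicator (U n) x * (spline n ?a x)\<^sup>2 * fX x * L\<^sup>2) * ennreal C \<partial>lborel)"
  proof (rule nn_integral_mono)
    fix x
    show "(\<integral>\<^sup>+y. ennreal (joint_density (x, y)) * ennreal ((?F (x, y))\<^sup>2) \<partial>N) \<le>
       ennreal (indicator (U n) x * (spline n ?a x)\<^sup>2 * fX x * L\<^sup>2) * ennreal C"
    proof (cases "x \<in> U n")
      case True
      then have x: "x \<in> Xs" using U_subset by blast
      let ?c = "(spline n ?a x)\<^sup>2 * fX x * L\<^sup>2"
      have "(\<integral>\<^sup>+y. ennreal (joint_density (x, y)) * ennreal ((?F (x, y))\<^sup>2) \<partial>N) \<le>
        (\<integral>\<^sup>+y. ennreal ?c * ennreal ((psibar x y + 1)\<^sup>2 * fYX x y) \<partial>N)"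
      proof (rule nn_integral_mono)
        fix y
        have "joint_density (x, y) * (?F (x, y))\<^sup>2 \<le> ?c * ((psibar x y + 1)\<^sup>2 * fYX x y)"
        proof -
          have "\<bar>?F (x, y)\<bar> \<le> \<bar>L * (psibar x y + 1) * spline n ?a x\<bar>"
            using loss_diff_abs_le[where x=x and y=y and n=n and b=b and ?b0.0=b0 and q=q and W=W and L=L, OF lip W]
          proof (rule order.trans)
            have "(A::real) * \<bar>B\<bar> \<le> \<bar>A * B\<bar>" for A B by (simp add: abs_mult mult_right_mono)
            then show "indicator (good_points n) (x, y) * (L * (psibar x y + 1) * \<bar>spline n ?a x\<bar>) \<le> \<bar>L * (psibar x y + 1) * spline n ?a x\<bar>"
              by (cases "(x, y) \<in> good_points n") auto
          qed
          then have "(?F (x, y))\<^sup>2 \<le> (L * (psibar x y + 1) * spline n ?a x)\<^sup>2" by (simp only: abs_le_square_iff)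
          then have "joint_density (x, y) * (?F (x, y))\<^sup>2 \<le> joint_density (x, y) * (L * (psibar x y + 1) * spline n ?a x)\<^sup>2"
            by (intro mult_left_mono joint_density_nonneg)
          then show ?thesis by (simp add: joint_density_def power_mult_distrib mult_ac)
        qed
        then have "ennreal (joint_density (x, y) * (?F (x, y))\<^sup>2) \<le> ennreal (?c * ((psibar x y + 1)\<^sup>2 * fYX x y))"
          by (rule ennreal_leI)
        then show "ennreal (joint_density (x, y)) * ennreal ((?F (x, y))\<^sup>2) \<le> ennreal ?c * ennreal ((psibar x y + 1)\<^sup>2 * fYX x y)"
          using joint_density_nonneg fX_nonneg fYX_nonneg[OF x] by (simp add: ennreal_mult)
      qed
      also have "\<dots> = ennreal ?c * (\<integral>\<^sup>+y. ennreal ((psibar x y + 1)\<^sup>2 * fYX x y) \<partial>N)"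
      proof (rule nn_integral_cmult)
        note [measurable] = fYX_meas[OF x] psibar_section[OF x] fYX_support_borel[OF x]
        have eq: "(\<lambda>y. ennreal ((psibar x y + 1)\<^sup>2 * fYX x y)) =
            (\<lambda>y. ennreal ((psibar x y * indicator {y. fYX x y \<noteq> 0} y + 1)\<^sup>2 * fYX x y))"
          by (auto simp: indicator_def)
        show "(\<lambda>y. ennreal ((psibar x y + 1)\<^sup>2 * fYX x y)) \<in> borel_measurable N"
          unfolding eq by measurable
      qed
      also have "\<dots> \<le> ennreal ?c * ennreal C" by (intro mult_left_mono C(2) x) simp
      finally show ?thesis using True by simp
    qed (simp add: loss_diff_def good_points_def)
  qed
  also have "\<dots> = (\<integral>\<^sup>+x. ennreal (L\<^sup>2 * C * (indicator (U n) x * (spline n ?a x)\<^sup>2 * fX x)) \<partial>lborel)"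
    using C(1) fX_nonneg by (intro nn_integral_cong) (simp add: ennreal_mult[symmetric] mult_ac)
  also have "\<dots> = ennreal (\<integral>x. L\<^sup>2 * C * (indicator (U n) x * (spline n ?a x)\<^sup>2 * fX x) \<partial>lborel)"
    using L2_mass_integrable[of n ?a "2 * W"] Wa C(1) fX_nonneg
    by (intro nn_integral_eq_integral) (auto simp: integrable_mult_right)
  also have "\<dots> = ennreal (L\<^sup>2 * C * L2_mass n ?a)"
    unfolding L2_mass_def by simp
  finally have le: "(\<integral>\<^sup>+z. ennreal ((?F z)\<^sup>2) \<partial>law) \<le> ennreal (L\<^sup>2 * C * L2_mass n ?a)" .
  show i: "integrable law (\<lambda>z. (?F z)\<^sup>2)"
    using le by (intro integrableI_nonneg) (auto intro: le_less_trans)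
  have s0: "0 \<le> L2_mass n ?a" unfolding L2_mass_def by (intro integral_nonneg_AE AE_I2) (simp add: fX_nonneg)
  have "(\<integral>z. (?F z)\<^sup>2 \<partial>law) = enn2real (\<integral>\<^sup>+z. ennreal ((?F z)\<^sup>2) \<partial>law)"
    by (intro integral_eq_nn_integral) auto
  also have "\<dots> \<le> L\<^sup>2 * C * L2_mass n ?a"
    using enn2real_mono[OF le] C(1) s0 by simp
  finally show "(\<integral>z. (?F z)\<^sup>2 \<partial>law) \<le> L\<^sup>2 * C * L2_mass n ?a" .
qed

end

section \<open>Uniform lower bound over a net\<close>

lemma same_floor_le:
  fixes a b w :: real
  assumes "0 < w" "\<lfloor>a / w\<rfloor> = \<lfloor>b / w\<rfloor>"
  shows "\<bar>a - b\<bar> \<le> w"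
proof -
  have "\<bar>a / w - b / w\<bar> \<le> 1" using assms(2) by linarith
  then show ?thesis using assms(1) by (simp add: diff_divide_distrib[symmetric] abs_divide divide_le_eq)
qed

text \<open>The floor of - x may be one less than minus the floor of x, which explains the lower
  end; the upper end is chosen symmetrically.\<close>

lemma floor_quotient_range:
  fixes a w B :: real
  assumes "0 < w" "\<bar>a\<bar> \<le> B"
  shows "\<lfloor>a / w\<rfloor> \<in> {- (\<lfloor>B / w\<rfloor> + 1)..\<lfloor>B / w\<rfloor> + 1}"
proof -
  have "a / w \<le> B / w" "(- B) / w \<le> a / w"
    using assms by (intro divide_right_mono; simp)+
  then have "a / w \<le> B / w" "- (B / w) \<le> a / w" by simp_all
  then have "\<lfloor>a / w\<rfloor> \<le> \<lfloor>B / w\<rfloor>" "\<lfloor>- (B / w)\<rfloor> \<le> \<lfloor>a / w\<rfloor>" by (auto intro: floor_mono)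
  moreover have "- (\<lfloor>B / w\<rfloor> + 1) \<le> \<lfloor>- (B / w)\<rfloor>" by linarith
  ultimately show ?thesis by auto
qed

lemma card_floor_range:
  fixes w B :: real
  assumes "0 < w" "0 \<le> B"
  shows "real (card {- (\<lfloor>B / w\<rfloor> + 1)..\<lfloor>B / w\<rfloor> + 1}) \<le> 2 * B / w + 3"
proof -
  have "0 \<le> \<lfloor>B / w\<rfloor>" using assms by simp
  then have "real (card {- (\<lfloor>B / w\<rfloor> + 1)..\<lfloor>B / w\<rfloor> + 1}) = 2 * real_of_int \<lfloor>B / w\<rfloor> + 3" by simp
  also have "\<dots> \<le> 2 * (B / w) + 3" by linarith
  finally show ?thesis by simp
qed

section \<open>The net and its exceptional event\<close>

context series_estimation begin

text \<open>The growth bound is centred at \<open>mu0\<close>, the target at \<open>b0\<close>. With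
  u and v the deviations of the two splines from \<open>mu0\<close>, the square of the difference is
  at most 2 u^2 + 2 v^2. Recentring costs v^2 / L on top of L v^2, and both are at most L e^2
  because L \<ge> 1.\<close>

lemma loss_diff_mean:
  assumes meas: "(\<lambda>(y, e). rho y e q) \<in> borel_measurable (restrict_space borel (Ys \<times> Es))"
    and W: "\<And>x. x \<in> U n \<Longrightarrow> \<bar>spline n b x\<bar> \<le> W" "\<And>x. x \<in> U n \<Longrightarrow> \<bar>spline n b0 x\<bar> \<le> W"
    and L: "1 \<le> L"
    and cond: "\<And>x. x \<in> U n \<Longrightarrow> (spline n b x - mu0 x q)\<^sup>2 / L - L * (spline n b0 x - mu0 x q)\<^sup>2
         \<le> (\<integral>y. (rho y (eta (spline n b x)) q - rho y (eta (spline n b0 x)) q) * fYX x y \<partial>N)"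
    and e: "\<And>x. x \<in> U n \<Longrightarrow> \<bar>spline n b0 x - mu0 x q\<bar> \<le> e"
    and int: "integrable law (loss_diff n b b0 q)"
  shows "L2_mass n (\<lambda>k. b k - b0 k) / (2 * L) - 2 * L * e\<^sup>2 \<le> (\<integral>z. loss_diff n b b0 q z \<partial>law)"
proof -
  let ?a = "\<lambda>k. b k - b0 k" and ?F = "loss_diff n b b0 q"
  interpret N: sigma_finite_measure N by (rule sigma_finite_N)
  interpret P: pair_sigma_finite lborel N by unfold_locales
  have [measurable]: "?F \<in> borel_measurable (lborel \<Otimes>\<^sub>M N)" "joint_density \<in> borel_measurable (lborel \<Otimes>\<^sub>M N)"
    using loss_diff_measurable[OF meas] joint_density_measurable by (simp_all only: measurable_cong_sets[OF sets_pair refl])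
  have iP: "integrable (lborel \<Otimes>\<^sub>M N) (\<lambda>z. joint_density z * ?F z)"
    using int unfolding law_def by (subst (asm) integrable_density) (auto simp: joint_density_nonneg)
  have "(\<integral>z. ?F z \<partial>law) = (\<integral>z. joint_density z * ?F z \<partial>(lborel \<Otimes>\<^sub>M N))"
    unfolding law_def by (subst integral_density) (auto simp: joint_density_nonneg)
  also have "\<dots> = (\<integral>x. \<integral>y. joint_density (x, y) * ?F (x, y) \<partial>N \<partial>lborel)"
    by (rule P.integral_fst'[OF iP, symmetric])
  finally have eq: "(\<integral>z. ?F z \<partial>law) = (\<integral>x. \<integral>y. joint_density (x, y) * ?F (x, y) \<partial>N \<partial>lborel)" .
  have iI: "integrable lborel (\<lambda>x. \<integral>y. joint_density (x, y) * ?F (x, y) \<partial>N)" by (rule P.integrable_fst'[OF iP])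
  let ?g = "\<lambda>x. (indicator (U n) x * (spline n ?a x)\<^sup>2 * fX x) / (2 * L) - 2 * L * e\<^sup>2 * fX x"
  have "\<bar>spline n ?a x\<bar> \<le> 2 * W" if "x \<in> U n" for x
    using W[OF that] unfolding spline_diff[symmetric] by linarith
  then have sI: "integrable lborel (\<lambda>x. indicator (U n) x * (spline n ?a x)\<^sup>2 * fX x)" by (rule L2_mass_integrable)
  have ig: "integrable lborel ?g" using sI fX_integrable by auto
  have "(\<integral>x. ?g x \<partial>lborel) = L2_mass n ?a / (2 * L) - 2 * L * e\<^sup>2"
    using sI fX_integrable unfolding L2_mass_def by (simp add: fX_integral_eq)
  moreover have "(\<integral>x. ?g x \<partial>lborel) \<le> (\<integral>x. \<integral>y. joint_density (x, y) * ?F (x, y) \<partial>N \<partial>lborel)"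
  proof (rule integral_mono[OF ig iI])
    fix x
    show "?g x \<le> (\<integral>y. joint_density (x, y) * ?F (x, y) \<partial>N)"
    proof (cases "x \<in> U n")
      case True
      have "joint_density (x, y) * ?F (x, y) = fX x * ((rho y (eta (spline n b x)) q - rho y (eta (spline n b0 x)) q) * fYX x y)" for y
        using True unfolding loss_diff_def good_points_def joint_density_def by (auto simp: indicator_def)
      then have I: "(\<integral>y. joint_density (x, y) * ?F (x, y) \<partial>N) =
         fX x * (\<integral>y. (rho y (eta (spline n b x)) q - rho y (eta (spline n b0 x)) q) * fYX x y \<partial>N)"
        by (simp only: integral_mult_right_zero)
      let ?u = "spline n b x - mu0 x q" and ?v = "spline n b0 x - mu0 x q"
      have v: "?v\<^sup>2 \<le> e\<^sup>2" using power_mono[OF e[OF True] abs_ge_zero, of 2] by simp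
      have "(spline n ?a x)\<^sup>2 \<le> 2 * ?u\<^sup>2 + 2 * ?v\<^sup>2"
        unfolding spline_diff[symmetric] using zero_le_power2[of "?u + ?v"] by (simp add: power2_eq_square algebra_simps)
      then have "(spline n ?a x)\<^sup>2 / (2 * L) \<le> (2 * ?u\<^sup>2 + 2 * ?v\<^sup>2) / (2 * L)"
        using L by (intro divide_right_mono) auto
      also have "\<dots> = ?u\<^sup>2 / L + ?v\<^sup>2 / L" using L by (simp add: field_simps)
      finally have "(spline n ?a x)\<^sup>2 / (2 * L) - ?v\<^sup>2 / L \<le> ?u\<^sup>2 / L" by linarith
      moreover have "?v\<^sup>2 / L \<le> L * e\<^sup>2"
      proof -
        have "?v\<^sup>2 / L \<le> ?v\<^sup>2 * 1" using L mult_left_mono[OF L, of "?v\<^sup>2"] by (simp add: divide_le_eq)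
        also have "\<dots> \<le> L * e\<^sup>2" using L v mult_right_mono[OF L, of "e\<^sup>2"] by simp
        finally show ?thesis .
      qed
      moreover have "L * ?v\<^sup>2 \<le> L * e\<^sup>2" using L v by (intro mult_left_mono) auto
      ultimately have "(spline n ?a x)\<^sup>2 / (2 * L) - 2 * L * e\<^sup>2 \<le> ?u\<^sup>2 / L - L * ?v\<^sup>2" by linarith
      also note cond[OF True]
      finally have "fX x * ((spline n ?a x)\<^sup>2 / (2 * L) - 2 * L * e\<^sup>2) \<le>
         fX x * (\<integral>y. (rho y (eta (spline n b x)) q - rho y (eta (spline n b0 x)) q) * fYX x y \<partial>N)"
        by (rule mult_left_mono[OF _ fX_nonneg])
      then show ?thesis unfolding I using True by (simp add: algebra_simps)
    next
      case False
      then have "?F (x, y) = 0" for y unfolding loss_diff_def good_points_def by simp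
      then show ?thesis using False L fX_nonneg[of x] by simp
    qed
  qed
  ultimately show ?thesis unfolding eq by simp
qed

text \<open>The tuning parameters are free here. By \<open>n1\<close> the second moment term
  consumes at most half of the mean, \<open>n2\<close> absorbs the bias, \<open>n3\<close> makes the
  clipping invisible where the envelope is at most \<open>J\<close>, and \<open>n4\<close> pays for
  the passage from a net point to an arbitrary parameter. The first summand of the probability is
  the union bound over the net, the second belongs to the brackets for \<open>q\<close>.\<close>

lemma finite_sample_bound:
  fixes beta0 :: "real \<Rightarrow> nat \<Rightarrow> real" and n :: nat
    and Qb C0 R L C2 e s0 J \<theta> t \<kappa> w \<epsilon> :: real
  assumes meas: "\<And>q. q \<in> Qs \<Longrightarrow> (\<lambda>(y, e). rho y e q) \<in> borel_measurable (restrict_space borel (Ys \<times> Es))"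
    and lip: "\<And>x q y z1 z2. x \<in> Xs \<Longrightarrow> q \<in> Qs \<Longrightarrow> y \<in> Ys \<Longrightarrow> \<bar>z1\<bar> \<le> C0 * R \<Longrightarrow> \<bar>z2\<bar> \<le> C0 * R \<Longrightarrow>
       \<bar>rho y (eta z1) q - rho y (eta z2) q\<bar> \<le> L * (psibar x y + 1) * \<bar>z1 - z2\<bar>"
    and qd: "\<And>q q' y z1 z2. q \<in> Qs \<Longrightarrow> q' \<in> Qs \<Longrightarrow> y \<in> Ys \<Longrightarrow> \<bar>z1\<bar> \<le> C0 * R \<Longrightarrow> \<bar>z2\<bar> \<le> C0 * R \<Longrightarrow>
       \<bar>(rho y (eta z1) q - rho y (eta z2) q) - (rho y (eta z1) q' - rho y (eta z2) q')\<bar>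
         \<le> L * (\<bar>of_bool (y \<le> q) - of_bool (y \<le> q')\<bar> + \<bar>q - q'\<bar>)"
    and second: "0 \<le> C2" "\<And>x. x \<in> Xs \<Longrightarrow> (\<integral>\<^sup>+y. ennreal ((psibar x y + 1)\<^sup>2 * fYX x y) \<partial>N) \<le> ennreal C2"
    and mean: "\<And>x q b. x \<in> U n \<Longrightarrow> q \<in> Qs \<Longrightarrow> (\<And>k. k < K n \<Longrightarrow> \<bar>b k\<bar> \<le> R) \<Longrightarrow>
       (spline n b x - mu0 x q)\<^sup>2 / L - L * (spline n (beta0 q) x - mu0 x q)\<^sup>2
         \<le> (\<integral>y. (rho y (eta (spline n b x)) q - rho y (eta (spline n (beta0 q) x)) q) * fYX x y \<partial>N)"
    and approx: "\<And>x q. x \<in> U n \<Longrightarrow> q \<in> Qs \<Longrightarrow> \<bar>spline n (beta0 q) x - mu0 x q\<bar> \<le> e"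
    and Qb: "0 \<le> Qb" "\<And>q. q \<in> Qs \<Longrightarrow> \<bar>q\<bar> \<le> Qb"
    and C0: "0 < C0" "\<And>x. x \<in> U n \<Longrightarrow> (\<Sum>k<K n. \<bar>p n k x\<bar>) \<le> C0"
    and R: "0 < R" "\<And>q k. q \<in> Qs \<Longrightarrow> k < K n \<Longrightarrow> \<bar>beta0 q k\<bar> \<le> R"
    and L: "1 \<le> L"
    and s0: "\<And>a. \<epsilon> < eucl_norm (K n) a \<Longrightarrow> s0 \<le> L2_mass n a"
    and pos: "1 \<le> J" "0 < \<theta>" "0 < \<kappa>" "0 < w"
    and n1: "\<theta> * (L\<^sup>2 * C2) \<le> 1 / (4 * L)"
    and n2: "2 * t \<le> s0 / (4 * L) - 2 * L * e\<^sup>2"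
    and n3: "\<theta> * (L * (2 * J) * (2 * (C0 * R))) \<le> 1"
    and n4: "4 * L * J * C0 * \<kappa> + 4 * L * w \<le> t"
  shows "\<exists>E\<in>sets M. measure M E \<le> (2 * R / \<kappa> + 3) ^ (2 * K n) * (1 / w + 2) * (2 * Qb / w + 3) * exp (- \<theta> * real n * t)
        + (1 / w + 2) * exp (- real n * w) \<and>
     (\<forall>\<omega>\<in>space M - E. (\<forall>i<n. psibar (xs i \<omega>) (ys i \<omega>) \<le> J) \<longrightarrow>
       (\<forall>b. \<forall>q\<in>Qs. (\<forall>k<K n. \<bar>b k\<bar> \<le> R) \<longrightarrow> \<epsilon> < eucl_norm (K n) (\<lambda>k. b k - beta0 q k) \<longrightarrow>
         0 < (\<Sum>i<n. rho (ys i \<omega>) (eta (spline n b (xs i \<omega>))) q - rho (ys i \<omega>) (eta (spline n (beta0 q) (xs i \<omega>))) q)))"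
proof -
  interpret M: prob_space M by (rule prob_M)
  have Wb: "\<bar>spline n b x\<bar> \<le> C0 * B" if "x \<in> U n" "\<And>k. k < K n \<Longrightarrow> \<bar>b k\<bar> \<le> B" "0 \<le> B" for x b B
    unfolding spline_def by (rule abs_dot_sup_le[OF C0(2)[OF that(1)] that(2,3)])
  define Q where "Q = distr M borel (ys 0)"
  have lawY: "distr M borel (ys i) = Q" for i
  proof -
    have "distr M borel (ys i) = distr law borel snd" for i
      unfolding law_Z[of i, symmetric] by (subst distr_distr) (auto simp: comp_def Z_def)
    then show ?thesis unfolding Q_def by simp
  qed
  have indY: "M.indep_vars (\<lambda>_. borel) ys UNIV"
    using M.indep_vars_compose2[OF indep_Z, of "\<lambda>_. snd" "\<lambda>_. borel"] by (simp add: Z_def)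
  interpret Q: prob_space Q
    unfolding Q_def using indY by (intro M.prob_space_distr) (auto simp: M.indep_vars_def)
  have setsQ: "sets Q = sets borel" unfolding Q_def by simp
  interpret Q: real_distribution Q
    by unfold_locales (simp_all add: setsQ sets_eq_imp_space_eq[OF setsQ])
  obtain E1 where E1: "E1 \<in> sets M" "measure M E1 \<le> (1 / w + 2) * exp (- real n * w)"
    "\<And>\<omega> a b. \<omega> \<in> space M - E1 \<Longrightarrow> a \<le> b \<Longrightarrow> \<lfloor>cdf Q a / w\<rfloor> = \<lfloor>cdf Q b / w\<rfloor> \<Longrightarrow>
       (\<Sum>i<n. of_bool (a < ys i \<omega> \<and> ys i \<omega> \<le> b)) \<le> 3 * w * real n"
    using M.empirical_brackets[OF indY lawY pos(4), of n] by auto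
  obtain E0 where E0: "E0 \<in> null_sets M" "\<And>\<omega>. \<omega> \<in> space M - E0 \<Longrightarrow> \<forall>i. Z i \<omega> \<in> good_points n"
    using AE_E3[OF AE_good_points[of n]] by auto
  define \<Theta> where "\<Theta> = {(b, q). q \<in> Qs \<and> (\<forall>k<K n. \<bar>b k\<bar> \<le> R) \<and> \<epsilon> < eucl_norm (K n) (\<lambda>k. b k - beta0 q k)}"
  \<comment> \<open>\<open>b\<close> and \<open>beta0 q\<close> are rounded to cells of width
    \<kappa>. The value \<open>q\<close> is rounded twice: through the distribution function of the
    response, which controls the jumps of 1(y \<le> q), and directly, for the part of the loss that
    is linear in \<open>q\<close>. Restriction discards the entries beyond \<open>K n\<close>, so
    that finitely many codes remain.\<close>
  define code where "code = (\<lambda>(b, q). (restrict (\<lambda>k. \<lfloor>b k / \<kappa>\<rfloor>) {..<K n}, restrict (\<lambda>k. \<lfloor>beta0 q k / \<kappa>\<rfloor>) {..<K n},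
     \<lfloor>cdf Q q / w\<rfloor>, \<lfloor>q / w\<rfloor>))"
  define A where "A = {- (\<lfloor>R / \<kappa>\<rfloor> + 1)..\<lfloor>R / \<kappa>\<rfloor> + 1}"
  define A' where "A' = {- (\<lfloor>Qb / w\<rfloor> + 1)..\<lfloor>Qb / w\<rfloor> + 1}"
  define CC where "CC = PiE {..<K n} (\<lambda>_. A) \<times> PiE {..<K n} (\<lambda>_. A) \<times> {0..\<lfloor>1 / w\<rfloor>} \<times> A'"
  have fin: "finite CC" unfolding CC_def A_def A'_def by (intro finite_cartesian_product finite_PiE) auto
  have sub: "code ` \<Theta> \<subseteq> CC"
  proof
    fix c assume "c \<in> code ` \<Theta>"
    then obtain b q where c: "c = code (b, q)" and q: "q \<in> Qs" and b: "\<And>k. k < K n \<Longrightarrow> \<bar>b k\<bar> \<le> R"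
      unfolding \<Theta>_def by auto
    have "0 \<le> cdf Q q / w" "cdf Q q / w \<le> 1 / w"
      using pos(4) Q.cdf_nonneg[of q] Q.cdf_bounded_prob[of q] by (auto intro: divide_right_mono)
    then have "\<lfloor>cdf Q q / w\<rfloor> \<in> {0..\<lfloor>1 / w\<rfloor>}" by (auto intro: floor_mono)
    then show "c \<in> CC" unfolding c code_def CC_def A_def A'_def
      using floor_quotient_range[OF pos(3) b] floor_quotient_range[OF pos(3) R(2)[OF q]]
        floor_quotient_range[OF pos(4) Qb(2)[OF q]]
      by (auto simp del: atLeastAtMost_iff)
  qed
  have "real (card (code ` \<Theta>)) \<le> real (card CC)" using card_mono[OF fin sub] by simp
  also have "\<dots> = real (card A) ^ (2 * K n) * real (card {0..\<lfloor>1 / w\<rfloor>}) * real (card A')"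
    unfolding CC_def by (simp add: card_cartesian_product card_PiE power_add mult_2 del: card_atLeastAtMost_int)
  also have "\<dots> \<le> (2 * R / \<kappa> + 3) ^ (2 * K n) * (1 / w + 2) * (2 * Qb / w + 3)"
  proof (intro mult_mono power_mono)
    show "real (card A) \<le> 2 * R / \<kappa> + 3" unfolding A_def using pos(3) R(1) by (intro card_floor_range) auto
    show "real (card A') \<le> 2 * Qb / w + 3" unfolding A'_def using pos(4) Qb(1) by (intro card_floor_range) auto
    have "0 \<le> \<lfloor>1 / w\<rfloor>" using pos(4) by simp
    then have "real (card {0..\<lfloor>1 / w\<rfloor>}) = real_of_int \<lfloor>1 / w\<rfloor> + 1" by simp
    then show "real (card {0..\<lfloor>1 / w\<rfloor>}) \<le> 1 / w + 2" by linarith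
  qed (use pos R(1) in auto)
  finally have card: "real (card (code ` \<Theta>)) \<le> (2 * R / \<kappa> + 3) ^ (2 * K n) * (1 / w + 2) * (2 * Qb / w + 3)" .
  define F where "F = (\<lambda>(b, q). loss_diff n b (beta0 q) q)"
  have Fm [measurable]: "F \<tau> \<in> borel_measurable (borel \<Otimes>\<^sub>M borel)" if "\<tau> \<in> \<Theta>" for \<tau>
    using that loss_diff_measurable[OF meas] unfolding F_def \<Theta>_def by auto
  \<comment> \<open>The net consists of members of \<open>\<Theta>\<close> itself, so that each of its points comes with its own \<open>beta0 q\<close>.\<close>
  define rep where "rep c = (SOME \<tau>. \<tau> \<in> \<Theta> \<and> code \<tau> = c)" for c
  have rep: "rep c \<in> \<Theta> \<and> code (rep c) = c" if "c \<in> code ` \<Theta>" for c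
  proof -
    obtain \<tau> where "\<tau> \<in> \<Theta>" "c = code \<tau>" using \<open>c \<in> code ` \<Theta>\<close> by (rule imageE)
    then show ?thesis unfolding rep_def by (intro someI[of "\<lambda>\<tau>. \<tau> \<in> \<Theta> \<and> code \<tau> = c" \<tau>] conjI) simp_all
  qed
  have rep\<Theta>: "rep c \<in> \<Theta>" if "c \<in> code ` \<Theta>" for c using rep[OF that] by (rule conjunct1)
  define D where "D \<tau> = {\<omega>\<in>space M. (\<Sum>i<n. max (F \<tau> (Z i \<omega>)) (- 1 / \<theta>)) \<le> real n * t}" for \<tau>
  have Dm: "D \<tau> \<in> sets M" if "\<tau> \<in> \<Theta>" for \<tau>
    unfolding D_def using Fm[OF that] by measurable
  have Dp: "measure M (D \<tau>) \<le> exp (- \<theta> * real n * t)" if "\<tau> \<in> \<Theta>" for \<tau>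
  proof -
    obtain b q where \<tau>: "\<tau> = (b, q)" and q: "q \<in> Qs" and b: "\<And>k. k < K n \<Longrightarrow> \<bar>b k\<bar> \<le> R"
      and eps: "\<epsilon> < eucl_norm (K n) (\<lambda>k. b k - beta0 q k)"
      using \<open>\<tau> \<in> \<Theta>\<close> unfolding \<Theta>_def by auto
    let ?s = "L2_mass n (\<lambda>k. b k - beta0 q k)"
    have W1: "\<And>x. x \<in> U n \<Longrightarrow> \<bar>spline n b x\<bar> \<le> C0 * R" using R(1) b by (intro Wb) auto
    have W0: "\<And>x. x \<in> U n \<Longrightarrow> \<bar>spline n (beta0 q) x\<bar> \<le> C0 * R" using R b q by (intro Wb) auto
    have lipq: "\<bar>rho y (eta z1) q - rho y (eta z2) q\<bar> \<le> L * (psibar x y + 1) * \<bar>z1 - z2\<bar>"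
      if "x \<in> Xs" "y \<in> Ys" "\<bar>z1\<bar> \<le> C0 * R" "\<bar>z2\<bar> \<le> C0 * R" for x y z1 z2
      using that q by (intro lip)
    have int2: "integrable law (\<lambda>z. (F \<tau> z)\<^sup>2)" and le2: "(\<integral>z. (F \<tau> z)\<^sup>2 \<partial>law) \<le> L\<^sup>2 * C2 * ?s"
      using loss_diff_second_moment[OF meas[OF q] lipq W1 W0 second] unfolding F_def \<tau> prod.case by blast+
    interpret law: prob_space law using law_Z[of 0] M.prob_space_distr[OF Z_measurable[of 0]] by simp
    have Fl: "F \<tau> \<in> borel_measurable law" using Fm[OF \<open>\<tau> \<in> \<Theta>\<close>] by (simp only: measurable_cong_sets[OF sets_law refl])
    have int: "integrable law (F \<tau>)"
      using law.square_integrable_imp_integrable[OF Fl int2] .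
    have mn: "?s / (2 * L) - 2 * L * e\<^sup>2 \<le> (\<integral>z. F \<tau> z \<partial>law)"
      using int unfolding F_def \<tau> prod.case
      by (intro loss_diff_mean[OF meas[OF q] W1 W0 L _ approx[OF _ q]] mean q b)
    have "s0 \<le> ?s" by (rule s0[OF eps])
    then have "s0 / (4 * L) \<le> ?s / (4 * L)" using L by (intro divide_right_mono) auto
    moreover have "\<theta> * (\<integral>z. (F \<tau> z)\<^sup>2 \<partial>law) \<le> ?s / (4 * L)"
    proof -
      have s: "0 \<le> ?s" unfolding L2_mass_def by (intro integral_nonneg_AE AE_I2) (simp add: fX_nonneg)
      have "\<theta> * (\<integral>z. (F \<tau> z)\<^sup>2 \<partial>law) \<le> \<theta> * (L\<^sup>2 * C2 * ?s)" using pos(2) le2 by (intro mult_left_mono) auto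
      also have "\<dots> = \<theta> * (L\<^sup>2 * C2) * ?s" by simp
      also have "\<dots> \<le> 1 / (4 * L) * ?s" by (rule mult_right_mono[OF n1 s])
      finally show ?thesis by simp
    qed
    moreover have "?s / (2 * L) = ?s / (4 * L) + ?s / (4 * L)" using L by (simp add: field_simps)
    ultimately have "2 * t \<le> (\<integral>z. F \<tau> z \<partial>law) - \<theta> * (\<integral>z. (F \<tau> z)\<^sup>2 \<partial>law)"
      using n2 mn by linarith
    \<comment> \<open>The effective mean is 2 t and the threshold t, which leaves the exponent
      \<theta> n t.\<close>
    then have "M.prob (D \<tau>) \<le> exp (- \<theta> * real n * (2 * t - t))"
      unfolding D_def by (intro M.iid_lower_deviation_clipped[OF indep_Z law_Z Fm[OF \<open>\<tau> \<in> \<Theta>\<close>] pos(2) int int2])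
    then show ?thesis by simp
  qed
  define E2 where "E2 = (\<Union>c\<in>code ` \<Theta>. D (rep c))"
  have fin': "finite (code ` \<Theta>)" using finite_subset[OF sub fin] .
  have E2m: "E2 \<in> sets M" unfolding E2_def by (intro sets.finite_UN fin' Dm rep\<Theta>)
  have "measure M E2 \<le> (\<Sum>c\<in>code ` \<Theta>. measure M (D (rep c)))"
    unfolding E2_def by (intro M.finite_measure_subadditive_finite fin' image_subsetI Dm rep\<Theta>)
  also have "\<dots> \<le> (\<Sum>c\<in>code ` \<Theta>. exp (- \<theta> * real n * t))" by (intro sum_mono Dp rep\<Theta>)
  also have "\<dots> = real (card (code ` \<Theta>)) * exp (- \<theta> * real n * t)" by simp
  also have "\<dots> \<le> (2 * R / \<kappa> + 3) ^ (2 * K n) * (1 / w + 2) * (2 * Qb / w + 3) * exp (- \<theta> * real n * t)"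
    by (intro mult_right_mono card) simp
  finally have E2p: "measure M E2 \<le> (2 * R / \<kappa> + 3) ^ (2 * K n) * (1 / w + 2) * (2 * Qb / w + 3) * exp (- \<theta> * real n * t)" .
  define E where "E = E0 \<union> (E2 \<union> E1)"
  have E0m: "E0 \<in> sets M" "measure M E0 = 0" using E0(1) by (auto simp: null_sets_def measure_def)
  have Em: "E \<in> sets M" unfolding E_def using E0m E1 E2m by auto
  have "measure M E \<le> measure M E0 + (measure M E2 + measure M E1)"
    unfolding E_def
    by (rule order.trans[OF measure_Un_le[OF E0m(1) sets.Un[OF E2m E1(1)]] add_left_mono[OF measure_Un_le[OF E2m E1(1)]]])
  then have Ep: "measure M E \<le> (2 * R / \<kappa> + 3) ^ (2 * K n) * (1 / w + 2) * (2 * Qb / w + 3) * exp (- \<theta> * real n * t)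
        + (1 / w + 2) * exp (- real n * w)" using E0m(2) E2p E1(2) by linarith
  have main: "0 < (\<Sum>i<n. rho (ys i \<omega>) (eta (spline n b (xs i \<omega>))) q - rho (ys i \<omega>) (eta (spline n (beta0 q) (xs i \<omega>))) q)"
    if \<omega>: "\<omega> \<in> space M - E" and J: "\<And>i. i < n \<Longrightarrow> psibar (xs i \<omega>) (ys i \<omega>) \<le> J" and q: "q \<in> Qs"
      and b: "\<And>k. k < K n \<Longrightarrow> \<bar>b k\<bar> \<le> R" and eps: "\<epsilon> < eucl_norm (K n) (\<lambda>k. b k - beta0 q k)" for \<omega> b q
  proof -
    have in\<Theta>: "(b, q) \<in> \<Theta>" using q b eps unfolding \<Theta>_def by auto
    define c where "c = code (b, q)"
    have c: "c \<in> code ` \<Theta>" unfolding c_def using in\<Theta> by blast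
    obtain b' q' where r: "rep c = (b', q')" by (cases "rep c")
    have r\<Theta>: "(b', q') \<in> \<Theta>" and rc: "code (b', q') = code (b, q)" using rep[OF c] r c_def by auto
    have q': "q' \<in> Qs" and b': "\<And>k. k < K n \<Longrightarrow> \<bar>b' k\<bar> \<le> R" using r\<Theta> unfolding \<Theta>_def by auto
    have cf: "\<lfloor>cdf Q q' / w\<rfloor> = \<lfloor>cdf Q q / w\<rfloor>" and qf: "\<lfloor>q' / w\<rfloor> = \<lfloor>q / w\<rfloor>"
      and bf: "restrict (\<lambda>k. \<lfloor>b' k / \<kappa>\<rfloor>) {..<K n} = restrict (\<lambda>k. \<lfloor>b k / \<kappa>\<rfloor>) {..<K n}"
      and b0f: "restrict (\<lambda>k. \<lfloor>beta0 q' k / \<kappa>\<rfloor>) {..<K n} = restrict (\<lambda>k. \<lfloor>beta0 q k / \<kappa>\<rfloor>) {..<K n}"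
      using rc unfolding code_def by auto
    have bb: "\<bar>b k - b' k\<bar> \<le> \<kappa>" if "k < K n" for k
      using fun_cong[OF bf, of k] that by (intro same_floor_le[OF pos(3)]) simp
    have bb0: "\<bar>beta0 q k - beta0 q' k\<bar> \<le> \<kappa>" if "k < K n" for k
      using fun_cong[OF b0f, of k] that by (intro same_floor_le[OF pos(3)]) simp
    have qq: "\<bar>q - q'\<bar> \<le> w" using qf by (intro same_floor_le[OF pos(4)]) simp
    define I where "I i = (of_bool (min q q' < ys i \<omega> \<and> ys i \<omega> \<le> max q q') :: real)" for i
    have I: "(\<Sum>i<n. I i) \<le> 3 * w * real n"
      unfolding I_def using \<omega> cf by (intro E1(3)) (auto simp: E_def min_def max_def)
    \<comment> \<open>Three moves lead from the net point to (b, q): b' to b, and beta0 q' to beta0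
      q, both at the fixed value q and each at cost 2 L J C0 \<kappa>; then q' to q with the net
      splines kept, at cost L (I i + w).\<close>
    have summand: "F (b', q') (Z i \<omega>) - (4 * L * J * C0 * \<kappa> + L * w + L * I i)
        \<le> rho (ys i \<omega>) (eta (spline n b (xs i \<omega>))) q - rho (ys i \<omega>) (eta (spline n (beta0 q) (xs i \<omega>))) q"
      and clip: "max (F (b', q') (Z i \<omega>)) (- 1 / \<theta>) = F (b', q') (Z i \<omega>)" if i: "i < n" for i
    proof -
      define x y where "x = xs i \<omega>" and "y = ys i \<omega>"
      have G: "(x, y) \<in> good_points n" using E0(2)[of \<omega>] \<omega> unfolding E_def Z_def x_def y_def by auto
      then have x: "x \<in> U n" "x \<in> Xs" and y: "y \<in> Ys" using good_points_subset by blast+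
      have Jy: "psibar x y \<le> J" "0 < psibar x y" using J[OF i] psibar_pos[OF x(2) y] unfolding x_def y_def by auto
      have Wx: "\<bar>spline n b x\<bar> \<le> C0 * R" "\<bar>spline n b' x\<bar> \<le> C0 * R" "\<bar>spline n (beta0 q) x\<bar> \<le> C0 * R" "\<bar>spline n (beta0 q') x\<bar> \<le> C0 * R"
        using R b b' q q' by (auto intro!: Wb x)
      have lip': "\<bar>rho y (eta z1) q'' - rho y (eta z2) q''\<bar> \<le> L * (2 * J) * d"
        if "q'' \<in> Qs" "\<bar>z1\<bar> \<le> C0 * R" "\<bar>z2\<bar> \<le> C0 * R" "\<bar>z1 - z2\<bar> \<le> d" for z1 z2 q'' d
      proof -
        have "\<bar>rho y (eta z1) q'' - rho y (eta z2) q''\<bar> \<le> L * (psibar x y + 1) * \<bar>z1 - z2\<bar>"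
          using that x y by (intro lip)
        \<comment> \<open>The envelope is at most J and J \<ge> 1, so the envelope plus 1 is at most
          2 J.\<close>
        also have "\<dots> \<le> L * (2 * J) * d" using Jy L pos(1) that(4) by (intro mult_mono) auto
        finally show ?thesis .
      qed
      have d1: "\<bar>spline n b x - spline n b' x\<bar> \<le> C0 * \<kappa>" and d0: "\<bar>spline n (beta0 q') x - spline n (beta0 q) x\<bar> \<le> C0 * \<kappa>"
        unfolding spline_diff using bb bb0 pos(3) by (auto intro!: Wb x simp: abs_minus_commute)
      have F': "F (b', q') (Z i \<omega>) = rho y (eta (spline n b' x)) q' - rho y (eta (spline n (beta0 q') x)) q'"
        using G unfolding F_def loss_diff_def Z_def x_def y_def by simp
      have "\<bar>rho y (eta (spline n b x)) q - rho y (eta (spline n b' x)) q\<bar> \<le> L * (2 * J) * (C0 * \<kappa>)"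
        by (rule lip'[OF q Wx(1,2) d1])
      moreover have "\<bar>rho y (eta (spline n (beta0 q') x)) q - rho y (eta (spline n (beta0 q) x)) q\<bar> \<le> L * (2 * J) * (C0 * \<kappa>)"
        by (rule lip'[OF q Wx(4,3) d0])
      moreover have "\<bar>(rho y (eta (spline n b' x)) q - rho y (eta (spline n (beta0 q') x)) q) - (rho y (eta (spline n b' x)) q' - rho y (eta (spline n (beta0 q') x)) q')\<bar>
         \<le> L * (I i + w)"
      proof -
        have "\<bar>of_bool (y \<le> q) - of_bool (y \<le> q')\<bar> = I i"
          unfolding I_def y_def by (auto simp: min_def max_def)
        then have "L * (\<bar>of_bool (y \<le> q) - of_bool (y \<le> q')\<bar> + \<bar>q - q'\<bar>) \<le> L * (I i + w)"
          using qq L by (intro mult_left_mono) auto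
        then show ?thesis using qd[OF q q' y Wx(2,4)] by linarith
      qed
      moreover have "L * (2 * J) * (C0 * \<kappa>) + L * (2 * J) * (C0 * \<kappa>) = 4 * L * J * C0 * \<kappa>" "L * (I i + w) = L * w + L * I i"
        by (simp_all add: algebra_simps)
      ultimately show "F (b', q') (Z i \<omega>) - (4 * L * J * C0 * \<kappa> + L * w + L * I i)
        \<le> rho (ys i \<omega>) (eta (spline n b (xs i \<omega>))) q - rho (ys i \<omega>) (eta (spline n (beta0 q) (xs i \<omega>))) q"
        unfolding F' x_def[symmetric] y_def[symmetric] by linarith
      have "\<bar>F (b', q') (Z i \<omega>)\<bar> \<le> L * (2 * J) * (2 * (C0 * R))"
        unfolding F' using Wx(2,4) by (intro lip'[OF q']) auto
      moreover have "L * (2 * J) * (2 * (C0 * R)) \<le> 1 / \<theta>" using n3 pos(2) by (simp add: field_simps)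
      ultimately show "max (F (b', q') (Z i \<omega>)) (- 1 / \<theta>) = F (b', q') (Z i \<omega>)" by simp
    qed
    have "\<omega> \<notin> D (b', q')" using \<omega> c r unfolding E_def E2_def by auto
    then have "real n * t < (\<Sum>i<n. max (F (b', q') (Z i \<omega>)) (- 1 / \<theta>))" using \<omega> unfolding D_def by auto
    also have "\<dots> = (\<Sum>i<n. F (b', q') (Z i \<omega>))" using clip by (intro sum.cong) auto
    finally have lower: "real n * t < (\<Sum>i<n. F (b', q') (Z i \<omega>))" .
    have "(\<Sum>i<n. F (b', q') (Z i \<omega>) - (4 * L * J * C0 * \<kappa> + L * w + L * I i))
      \<le> (\<Sum>i<n. rho (ys i \<omega>) (eta (spline n b (xs i \<omega>))) q - rho (ys i \<omega>) (eta (spline n (beta0 q) (xs i \<omega>))) q)"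
      using summand by (intro sum_mono) auto
    moreover have "(\<Sum>i<n. F (b', q') (Z i \<omega>) - (4 * L * J * C0 * \<kappa> + L * w + L * I i)) =
      (\<Sum>i<n. F (b', q') (Z i \<omega>)) - real n * (4 * L * J * C0 * \<kappa> + L * w) - L * (\<Sum>i<n. I i)"
      by (simp add: sum_subtractf sum.distrib sum_distrib_left algebra_simps)
    moreover have "L * (\<Sum>i<n. I i) \<le> L * (3 * w * real n)" using I L by (intro mult_left_mono) auto
    \<comment> \<open>Of the 4 L w in \<open>n4\<close>, one part comes from the distance of the two
      values of \<open>q\<close> and three from the bracket count.\<close>
    moreover have "real n * (4 * L * J * C0 * \<kappa> + L * w) + L * (3 * w * real n) \<le> real n * t"
      using mult_left_mono[OF n4, of "real n"] by (simp add: algebra_simps)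
    ultimately show ?thesis using lower by linarith
  qed
  show ?thesis using Em Ep main by (intro bexI[of _ E] conjI ballI allI impI) auto
qed

end

section \<open>Asymptotics\<close>

text \<open>Here \<open>H\<close> is h^d. If r denotes the diverging ratio of the rate condition,
  then n H / J = r ln n / H. The rate itself forces J \<le> n and 1 / H \<le> n, so each of the 2 K
  axes of the net has at most n^3 cells; as K H \<le> C, the net has at most exp(6 C ln n / H)
  coefficient codes, and the exponential factor wins once r exceeds a constant.\<close>

lemma net_bound_tendsto:
  fixes H J :: "nat \<Rightarrow> real" and K :: "nat \<Rightarrow> nat" and a1 a2 a3 c1 c2 C :: real
  assumes H: "\<And>n. 0 < H n" "H \<longlonglongrightarrow> 0" and J: "\<And>n. 1 \<le> J n"
    and rate: "filterlim (\<lambda>n. real n * (H n)\<^sup>2 / (J n * ln (real n))) at_top sequentially"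
    and K: "0 \<le> C" "\<forall>\<^sub>F n in sequentially. real (K n) * H n \<le> C"
    and a: "0 \<le> a1" "0 \<le> a2" "0 \<le> a3" and c: "0 < c1" "0 < c2"
  shows "(\<lambda>n. (a1 * (J n / H n) + 3) ^ (2 * K n) * (a2 / H n + 2) * (a3 / H n + 3) * exp (- (c1 * (real n * H n / J n)))
     + (a2 / H n + 2) * exp (- (c2 * (real n * H n)))) \<longlonglongrightarrow> 0"
proof (rule tendsto_sandwich[OF _ _ tendsto_const])
  \<comment> \<open>The 1 yields J ln n \<le> n H^2. In the second summand, 6 C is for the
    coefficients, 4 for two factors of at most n^2, and 1 to leave the bound 1 / n. In the third, 2
    is for one factor of at most n^2 and 1 again for 1 / n.\<close>
  define A where "A = 1 + (6 * C + 5) / c1 + 3 / c2"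
  have A: "1 \<le> A" "(6 * C + 5) / c1 \<le> A" "3 / c2 \<le> A" unfolding A_def using K(1) c by auto
  show "(\<lambda>n. 2 * inverse (real n)) \<longlonglongrightarrow> 0"
    using tendsto_mult_right_zero[OF lim_inverse_n, of 2] by simp
  \<comment> \<open>At least 3 so that ln n \<ge> 1; the other summands let one power of n absorb
    each constant.\<close>
  have "\<forall>\<^sub>F n in sequentially. 3 + nat \<lceil>a1\<rceil> + nat \<lceil>a2\<rceil> + nat \<lceil>a3\<rceil> \<le> n" by (rule eventually_ge_at_top)
  moreover have "\<forall>\<^sub>F n in sequentially. H n < 1" by (rule order_tendstoD[OF H(2)]) simp
  moreover have "\<forall>\<^sub>F n in sequentially. A \<le> real n * (H n)\<^sup>2 / (J n * ln (real n))"
    using rate unfolding filterlim_at_top by blast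
  ultimately show "\<forall>\<^sub>F n in sequentially. (a1 * (J n / H n) + 3) ^ (2 * K n) * (a2 / H n + 2) * (a3 / H n + 3) * exp (- (c1 * (real n * H n / J n)))
     + (a2 / H n + 2) * exp (- (c2 * (real n * H n))) \<le> 2 * inverse (real n)"
    using K(2)
  proof eventually_elim
    case (elim n)
    let ?l = "ln (real n)" and ?r = "real n * (H n)\<^sup>2 / (J n * ln (real n))"
    have n: "real n \<ge> 3" "a1 + 3 \<le> real n" "a2 + 3 \<le> real n" "a3 + 3 \<le> real n"
      using elim(1) a by linarith+
    have l: "1 \<le> ?l"
    proof -
      have "exp 1 \<le> real n" using exp_le n(1) by linarith
      then show ?thesis using n(1) by (subst ln_ge_iff) auto
    qed
    have Jn: "1 \<le> J n" and Hn: "0 < H n" "H n < 1" using J H(1) elim(2) by auto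
    have Jl: "0 < J n * ?l" using Jn l by simp
    have "A * (J n * ?l) \<le> real n * (H n)\<^sup>2" using elim(3) Jl by (simp add: le_divide_eq)
    moreover have "1 * (J n * ?l) \<le> A * (J n * ?l)" using A(1) Jl by (intro mult_right_mono) auto
    ultimately have JH: "J n * ?l \<le> real n * (H n)\<^sup>2" by linarith
    have H2: "(H n)\<^sup>2 \<le> H n" "(H n)\<^sup>2 \<le> 1" using Hn by (auto simp: power2_eq_square mult_le_one)
    have "J n * 1 \<le> J n * ?l" using Jn l by (intro mult_left_mono) auto
    then have JH': "J n \<le> real n * (H n)\<^sup>2" using JH by linarith
    have Jln: "J n \<le> real n" using JH' mult_left_mono[OF H2(2), of "real n"] by simp
    have iH: "1 / H n \<le> real n"
    proof -
      have "1 \<le> real n * (H n)\<^sup>2" using JH' Jn by linarith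
      also have "\<dots> \<le> real n * H n" using H2(1) by (intro mult_left_mono) auto
      finally show ?thesis using Hn by (simp add: divide_le_eq)
    qed
    have le2: "x / H n + 3 \<le> (real n)\<^sup>2" if "0 \<le> x" "x + 3 \<le> real n" for x
    proof -
      have "x / H n \<le> x * real n" using mult_left_mono[OF iH that(1)] by simp
      moreover have "3 \<le> 3 * real n" using n(1) by simp
      ultimately have "x / H n + 3 \<le> (x + 3) * real n" by (simp add: algebra_simps)
      also have "\<dots> \<le> real n * real n" using that by (intro mult_right_mono) auto
      finally show ?thesis by (simp add: power2_eq_square)
    qed
    have b1: "a1 * (J n / H n) + 3 \<le> (real n) ^ 3"
    proof -
      have "J n / H n \<le> real n * real n"
        using mult_mono[OF Jln iH] Hn Jn by simp
      then have "a1 * (J n / H n) \<le> a1 * (real n * real n)" using a by (intro mult_left_mono)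
      moreover have "3 * 1 \<le> 3 * (real n * real n)" using n(1) mult_mono[of 1 "real n" 1 "real n"] by (intro mult_left_mono) auto
      ultimately have "a1 * (J n / H n) + 3 \<le> (a1 + 3) * (real n * real n)" by (simp add: algebra_simps)
      also have "\<dots> \<le> real n * (real n * real n)" using n(2) by (intro mult_right_mono) auto
      finally show ?thesis by (simp add: power3_eq_cube mult.assoc)
    qed
    have npow: "(real n) ^ j = exp (real j * ?l)" for j
      using n(1) by (simp add: exp_of_nat_mult)
    have lH: "?l \<le> ?l / H n" using l Hn by (simp add: le_divide_eq)
    have "(a1 * (J n / H n) + 3) ^ (2 * K n) \<le> ((real n) ^ 3) ^ (2 * K n)"
      using a Jn Hn by (intro power_mono b1) auto
    also have "\<dots> = exp (real (6 * K n) * ?l)" unfolding power_mult[symmetric] npow[symmetric] by simp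
    also have "\<dots> \<le> exp (6 * C * (?l / H n))"
    proof -
      have "real (K n) \<le> C / H n" using elim(4) Hn by (simp add: le_divide_eq)
      then have "real (K n) * ?l \<le> C / H n * ?l" using l by (intro mult_right_mono) auto
      then show ?thesis by simp
    qed
    finally have p1: "(a1 * (J n / H n) + 3) ^ (2 * K n) \<le> exp (6 * C * (?l / H n))" .
    have p2: "a2 / H n + 2 \<le> exp (2 * ?l)" using le2[OF a(2) n(3)] npow[of 2] by simp
    have p3: "a3 / H n + 3 \<le> exp (2 * ?l)" using le2[OF a(3) n(4)] npow[of 2] by simp
    have lJ: "?r * (?l / H n) = real n * H n / J n"
      using l Hn Jn by (simp add: field_simps power2_eq_square)
    have e1: "(6 * C + 5) * (?l / H n) \<le> c1 * (real n * H n / J n)"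
    proof -
      have "6 * C + 5 \<le> c1 * ?r" using order.trans[OF A(2) elim(3)] c(1) by (simp add: pos_divide_le_eq mult.commute)
      then have "(6 * C + 5) * (?l / H n) \<le> c1 * ?r * (?l / H n)" using l Hn by (intro mult_right_mono) auto
      then show ?thesis unfolding mult.assoc lJ .
    qed
    have e2: "3 * ?l \<le> c2 * (real n * H n)"
    proof -
      have "3 \<le> c2 * ?r" using order.trans[OF A(3) elim(3)] c(2) by (simp add: pos_divide_le_eq mult.commute)
      then have "3 * ?l \<le> c2 * ?r * (?l / H n)" using l lH c(2) by (intro mult_mono) auto
      also have "\<dots> = c2 * (real n * H n / J n)" unfolding mult.assoc lJ ..
      also have "\<dots> \<le> c2 * (real n * H n)"
        using c(2) Jn Hn mult_left_mono[OF Jn, of "real n * H n"] by (intro mult_left_mono) (auto simp: divide_le_eq)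
      finally show ?thesis .
    qed
    have inv: "exp (- ?l) = inverse (real n)" using n(1) by (simp add: exp_minus)
    have "(a1 * (J n / H n) + 3) ^ (2 * K n) * (a2 / H n + 2) * (a3 / H n + 3) * exp (- (c1 * (real n * H n / J n)))
      \<le> exp (6 * C * (?l / H n)) * exp (2 * ?l) * exp (2 * ?l) * exp (- ((6 * C + 5) * (?l / H n)))"
      using a Jn Hn e1 by (intro mult_mono p1 p2 p3) (auto intro!: mult_nonneg_nonneg add_nonneg_nonneg)
    also have "\<dots> = exp (4 * ?l - 5 * (?l / H n))" by (simp add: exp_add[symmetric] algebra_simps)
    also have "\<dots> \<le> exp (- ?l)" using lH by simp
    finally have f1: "(a1 * (J n / H n) + 3) ^ (2 * K n) * (a2 / H n + 2) * (a3 / H n + 3) * exp (- (c1 * (real n * H n / J n)))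
      \<le> inverse (real n)" unfolding inv .
    have "(a2 / H n + 2) * exp (- (c2 * (real n * H n))) \<le> exp (2 * ?l) * exp (- (3 * ?l))"
      using e2 by (intro mult_mono p2) auto
    also have "\<dots> = exp (- ?l)" by (simp add: exp_add[symmetric])
    finally show ?case using f1 unfolding inv by linarith
  qed
  show "\<forall>\<^sub>F n in sequentially. 0 \<le> (a1 * (J n / H n) + 3) ^ (2 * K n) * (a2 / H n + 2) * (a3 / H n + 3) * exp (- (c1 * (real n * H n / J n)))
     + (a2 / H n + 2) * exp (- (c2 * (real n * H n)))"
    using a less_imp_le[OF H(1)] order.trans[OF zero_le_one J]
    by (intro always_eventually allI add_nonneg_nonneg mult_nonneg_nonneg zero_le_power divide_nonneg_nonneg) auto
qed

section \<open>Consistency while the envelope is bounded on the sample\<close>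

context series_estimation begin

lemma L2_mass_lower: "\<exists>c>0. \<forall>\<^sub>F n in sequentially. \<forall>a. c * h n ^ CARD('d) * (eucl_norm (K n) a)\<^sup>2 \<le> L2_mass n a"
proof -
  obtain C where C: "C > 0" "\<forall>\<^sub>F n in sequentially. \<forall>a. (eucl_norm (K n) a)\<^sup>2 * h n ^ CARD('d) \<le>
        C * (LINT x:U n|lborel. (dot (K n) (\<lambda>k. p n k x) a)\<^sup>2)" using gram_lower_sum by blast
  obtain C' where C': "\<forall>\<^sub>F n in sequentially. \<forall>x\<in>Xs. eucl_norm (K n) (\<lambda>k. p n k x) \<le> C'" using p_sup by blast
  obtain cf where cf: "cf > 0" "\<And>x. x \<in> Xs \<Longrightarrow> cf \<le> fX x" using fX_lower by blast
  have "\<forall>\<^sub>F n in sequentially. \<forall>a. cf / C * h n ^ CARD('d) * (eucl_norm (K n) a)\<^sup>2 \<le> L2_mass n a"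
    using C(2) C'
  proof eventually_elim
    case (elim n)
    show ?case
    proof
      fix a
      let ?I = "LINT x:U n|lborel. (dot (K n) (\<lambda>k. p n k x) a)\<^sup>2"
      have qi: "integrable lborel (\<lambda>x. indicator (U n) x *\<^sub>R (dot (K n) (\<lambda>k. p n k x) a)\<^sup>2)"
        using quadratic_form(1)[where S="U n" and n=n and C=C' and a=a, OF U_open order.refl] elim(2)
        unfolding set_integrable_def by auto
      have "\<bar>spline n a x\<bar> \<le> C' * eucl_norm (K n) a" if "x \<in> U n" for x
        unfolding spline_def using elim(2) that U_subset by (intro order.trans[OF abs_dot_le] mult_right_mono) auto
      then have si: "integrable lborel (\<lambda>x. indicator (U n) x * (spline n a x)\<^sup>2 * fX x)" by (rule L2_mass_integrable)
      have "cf * ?I \<le> L2_mass n a"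
        unfolding set_lebesgue_integral_def L2_mass_def integral_mult_right_zero[symmetric]
      proof (rule integral_mono)
        show "integrable lborel (\<lambda>x. cf * (indicator (U n) x *\<^sub>R (dot (K n) (\<lambda>k. p n k x) a)\<^sup>2))"
          by (intro integrable_mult_right qi)
        fix x
        show "cf * (indicator (U n) x *\<^sub>R (dot (K n) (\<lambda>k. p n k x) a)\<^sup>2) \<le> indicator (U n) x * (spline n a x)\<^sup>2 * fX x"
        proof (cases "x \<in> U n")
          case True
          then have "cf \<le> fX x" using U_subset by (intro cf(2)) blast
          from mult_right_mono[OF this, of "(spline n a x)\<^sup>2"] show ?thesis using True by (simp add: spline_def mult.commute)
        qed simp
      qed (rule si)
      moreover have "cf / C * ((eucl_norm (K n) a)\<^sup>2 * h n ^ CARD('d)) \<le> cf / C * (C * ?I)"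
        using elim(1) cf(1) C(1) by (intro mult_left_mono) auto
      ultimately show "cf / C * h n ^ CARD('d) * (eucl_norm (K n) a)\<^sup>2 \<le> L2_mass n a"
        using C(1) by (simp add: mult_ac)
    qed
  qed
  then show ?thesis using cf(1) C(1) by (intro exI[of _ "cf / C"]) simp
qed

text \<open>The tuning parameters are fixed. With H = h^d, the signal \<open>s0\<close>, the margin
  \<open>t\<close>, the width \<open>w\<close> and J times \<kappa> are all constant multiples of H,
  and \<theta> is a constant divided by J; this gives the bound the shape required by
  \<open>net_bound_tendsto\<close>. The squared bias is negligible against H because it carries the
  extra factor h^(2m - d).\<close>

lemma consistency_event:
  fixes beta0 :: "nat \<Rightarrow> real \<Rightarrow> nat \<Rightarrow> real" and betahat :: "nat \<Rightarrow> real \<Rightarrow> 'w \<Rightarrow> nat \<Rightarrow> real"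
    and J :: "nat \<Rightarrow> real" and R c Ca \<epsilon> :: real
  assumes h0: "h \<longlonglongrightarrow> 0"
    and R: "0 < R" "\<And>n q. q \<in> Qs \<Longrightarrow> max_norm (K n) (beta0 n q) \<le> R"
    and estimator: "m_estimator M Qs xs ys rho eta K p (\<lambda>n. {b. max_norm (K n) b \<le> R}) betahat"
    and smooth: "CARD('d) < 2 * m"
    and approx: "\<forall>\<^sub>F n in sequentially. \<forall>q\<in>Qs. \<forall>x\<in>Xs. \<bar>mu0 x q - spline n (beta0 n q) x\<bar> \<le> Ca * h n ^ m"
    and curvature: "0 < c" "\<And>n x q \<beta> \<zeta>. x \<in> Xs \<Longrightarrow> q \<in> Qs \<Longrightarrow> max_norm (K n) \<beta> \<le> R \<Longrightarrow>
        \<zeta> \<in> closed_segment (eta (spline n \<beta> x)) (eta (mu0 x q)) \<Longrightarrow> c \<le> Psi_deriv 1 N fYX psi x \<zeta> q"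
    and J: "\<And>n. 1 \<le> J n"
    and rate: "filterlim (\<lambda>n. real n * (h n ^ CARD('d))\<^sup>2 / (J n * ln (real n))) at_top sequentially"
    and eps: "0 < \<epsilon>"
  shows "\<exists>B. B \<longlonglongrightarrow> (0::real) \<and> (\<forall>\<^sub>F n in sequentially. \<exists>E\<in>sets M. measure M E \<le> B n \<and>
    (\<forall>\<omega>\<in>space M - E. (\<forall>i<n. psibar (xs i \<omega>) (ys i \<omega>) \<le> J n) \<longrightarrow>
      (\<forall>q\<in>Qs. eucl_norm (K n) (\<lambda>k. betahat n q \<omega> k - beta0 n q k) \<le> \<epsilon>)))"
proof -
  let ?H = "\<lambda>n. h n ^ CARD('d)"
  obtain C0 where C0: "C0 > 0" "\<forall>\<^sub>F n in sequentially. \<forall>x\<in>U n. (\<Sum>k<K n. \<bar>p n k x\<bar>) \<le> C0"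
    using abs_sum_bound by blast
  obtain L r where L: "L \<ge> 1" and r: "r > 0"
    and meas: "\<And>q. q \<in> Qs \<Longrightarrow> (\<lambda>(y, e). rho y e q) \<in> borel_measurable (restrict_space borel (Ys \<times> Es))"
    and lip: "\<And>x q y z1 z2. x \<in> Xs \<Longrightarrow> q \<in> Qs \<Longrightarrow> y \<in> Ys \<Longrightarrow> \<bar>z1\<bar> \<le> C0 * R \<Longrightarrow> \<bar>z2\<bar> \<le> C0 * R \<Longrightarrow>
       \<bar>rho y (eta z1) q - rho y (eta z2) q\<bar> \<le> L * (psibar x y + 1) * \<bar>z1 - z2\<bar>"
    and qd: "\<And>q q' y z1 z2. q \<in> Qs \<Longrightarrow> q' \<in> Qs \<Longrightarrow> y \<in> Ys \<Longrightarrow> \<bar>z1\<bar> \<le> C0 * R \<Longrightarrow> \<bar>z2\<bar> \<le> C0 * R \<Longrightarrow>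
       \<bar>(rho y (eta z1) q - rho y (eta z2) q) - (rho y (eta z1) q' - rho y (eta z2) q')\<bar>
         \<le> L * (\<bar>of_bool (y \<le> q) - of_bool (y \<le> q')\<bar> + \<bar>q - q'\<bar>)"
    and mean: "\<And>x q z1 z0. x \<in> Xs \<Longrightarrow> q \<in> Qs \<Longrightarrow> \<bar>z1\<bar> \<le> C0 * R \<Longrightarrow> \<bar>z0\<bar> \<le> C0 * R \<Longrightarrow> \<bar>z0 - mu0 x q\<bar> \<le> r \<Longrightarrow>
       (\<And>\<zeta>. \<zeta> \<in> closed_segment (eta z1) (eta (mu0 x q)) \<Longrightarrow> c \<le> Psi_deriv 1 N fYX psi x \<zeta> q) \<Longrightarrow>
       integrable N (\<lambda>y. (rho y (eta z1) q - rho y (eta z0) q) * fYX x y) \<and>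
       (z1 - mu0 x q)\<^sup>2 / L - L * (z0 - mu0 x q)\<^sup>2
         \<le> (\<integral>y. (rho y (eta z1) q - rho y (eta z0) q) * fYX x y \<partial>N)"
    apply (rule loss_bounds[OF curvature(1), where W="C0 * R"])
    subgoal premises prems for L r
      by (rule that[of L r]) (fact prems)+
    done
  obtain C2 where C2: "0 \<le> C2" "\<And>x. x \<in> Xs \<Longrightarrow> (\<integral>\<^sup>+y. ennreal ((psibar x y + 1)\<^sup>2 * fYX x y) \<partial>N) \<le> ennreal C2"
    using psibar_second_moment by blast
  obtain Qb where Qb: "0 \<le> Qb" "\<And>q. q \<in> Qs \<Longrightarrow> \<bar>q\<bar> \<le> Qb" using Qs_bounded by blast
  obtain cs where cs: "cs > 0" "\<forall>\<^sub>F n in sequentially. \<forall>a. cs * ?H n * (eucl_norm (K n) a)\<^sup>2 \<le> L2_mass n a"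
    using L2_mass_lower by blast
  obtain CK where CK: "CK > 0" "\<forall>\<^sub>F n in sequentially. real (K n) * ?H n \<le> CK" using dimension_bound by blast
  have Hpos: "0 < ?H n" for n using mesh_pos[of n] by simp
  have hpow: "(\<lambda>n. b * h n ^ j) \<longlonglongrightarrow> 0" if "0 < j" for b j
    using tendsto_power[OF h0, of j] that by (intro tendsto_mult_right_zero) (simp add: zero_power)
  have H0: "?H \<longlonglongrightarrow> 0" using tendsto_power[OF h0, of "CARD('d)"] by (simp add: zero_power)
  \<comment> \<open>From s0 / (4 L), one half covers the bias and the other half is 2 t; hence the
    factor 16.\<close>
  define ct where "ct = cs * \<epsilon>\<^sup>2 / (16 * L)"
  \<comment> \<open>The two entries serve \<open>n1\<close> and \<open>n3\<close>; the added 1 keeps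
    the first denominator in step with the strictly positive quantity L^2 C2 + 1 even when C2 is
    zero.\<close>
  define c\<theta> where "c\<theta> = min (1 / (4 * L * (L\<^sup>2 * C2 + 1))) (1 / (4 * L * C0 * R))"
  have ct: "ct > 0" unfolding ct_def using cs(1) eps L by simp
  have c\<theta>: "c\<theta> > 0" unfolding c\<theta>_def using L C2(1) C0(1) R(1) by (simp add: add_nonneg_pos)
  define B where "B n = (16 * R * L * C0 / ct * (J n / ?H n) + 3) ^ (2 * K n) * (8 * L / ct / ?H n + 2) * (16 * L * Qb / ct / ?H n + 3)
     * exp (- (c\<theta> * ct * (real n * ?H n / J n))) + (8 * L / ct / ?H n + 2) * exp (- (ct / (8 * L) * (real n * ?H n)))" for n
  have "B \<longlonglongrightarrow> 0"
    unfolding B_def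
    by (rule net_bound_tendsto[OF Hpos H0 J rate less_imp_le[OF CK(1)] CK(2)])
       (use R(1) L C0(1) ct c\<theta> Qb(1) in auto)
  moreover have "\<forall>\<^sub>F n in sequentially. Ca * h n ^ m < r"
  proof (rule order_tendstoD)
    have "m > 0" using smooth by (cases m) auto
    then show "(\<lambda>n. Ca * h n ^ m) \<longlonglongrightarrow> 0" by (rule hpow)
  qed (rule r)
  moreover have "\<forall>\<^sub>F n in sequentially. Ca\<^sup>2 * h n ^ (2 * m - CARD('d)) < cs * \<epsilon>\<^sup>2 / (16 * L\<^sup>2)"
  proof (rule order_tendstoD)
    show "(\<lambda>n. Ca\<^sup>2 * h n ^ (2 * m - CARD('d))) \<longlonglongrightarrow> 0"
      using smooth by (intro hpow) simp
    show "0 < cs * \<epsilon>\<^sup>2 / (16 * L\<^sup>2)" using cs(1) eps L by simp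
  qed
  ultimately have ev: "\<forall>\<^sub>F n in sequentially. Ca * h n ^ m < r \<and> Ca\<^sup>2 * h n ^ (2 * m - CARD('d)) < cs * \<epsilon>\<^sup>2 / (16 * L\<^sup>2)" and B0: "B \<longlonglongrightarrow> 0"
    by (auto intro: eventually_conj)
  have "\<forall>\<^sub>F n in sequentially. \<exists>E\<in>sets M. measure M E \<le> B n \<and>
    (\<forall>\<omega>\<in>space M - E. (\<forall>i<n. psibar (xs i \<omega>) (ys i \<omega>) \<le> J n) \<longrightarrow>
      (\<forall>q\<in>Qs. eucl_norm (K n) (\<lambda>k. betahat n q \<omega> k - beta0 n q k) \<le> \<epsilon>))"
    using ev C0(2) cs(2) approx
  proof eventually_elim
    case (elim n)
    define e where "e = Ca * h n ^ m"
    define t where "t = ct * ?H n"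
    define \<theta> where "\<theta> = c\<theta> / J n"
    \<comment> \<open>With this \<kappa> and the next \<open>w\<close>, each of the two errors in
      \<open>n4\<close> is exactly t / 2.\<close>
    define \<kappa> where "\<kappa> = ct * ?H n / (8 * L * C0 * J n)"
    define w where "w = ct * ?H n / (8 * L)"
    define s0 where "s0 = cs * ?H n * \<epsilon>\<^sup>2"
    have Jn: "1 \<le> J n" by (rule J)
    have pos: "0 < \<theta>" "0 < \<kappa>" "0 < w"
      unfolding \<theta>_def \<kappa>_def w_def using c\<theta> ct Hpos[of n] L C0(1) Jn by auto
    have b0: "\<bar>beta0 n q k\<bar> \<le> R" if "q \<in> Qs" "k < K n" for q k
      using R(2)[OF that(1), of n] R(1) that(2) by (simp add: max_norm_le_iff)
    have n1: "\<theta> * (L\<^sup>2 * C2) \<le> 1 / (4 * L)"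
    proof -
      have P: "0 < L\<^sup>2 * C2 + 1" using C2(1) by (simp add: add_nonneg_pos)
      have "\<theta> \<le> c\<theta>" unfolding \<theta>_def using c\<theta> Jn mult_left_mono[OF Jn, of c\<theta>] by (simp add: divide_le_eq)
      also have "\<dots> \<le> 1 / (4 * L * (L\<^sup>2 * C2 + 1))" unfolding c\<theta>_def by simp
      finally have "\<theta> * (L\<^sup>2 * C2 + 1) \<le> 1 / (4 * L * (L\<^sup>2 * C2 + 1)) * (L\<^sup>2 * C2 + 1)"
        using P by (intro mult_right_mono) auto
      also have "\<dots> = 1 / (4 * L)" using P by simp
      finally show ?thesis using pos(1) by (simp add: algebra_simps)
    qed
    have n2: "2 * t \<le> s0 / (4 * L) - 2 * L * e\<^sup>2"
    proof -
      have "e\<^sup>2 = Ca\<^sup>2 * h n ^ (2 * m - CARD('d)) * ?H n"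
        unfolding e_def using smooth by (simp add: power_mult_distrib power_mult[symmetric] power_add[symmetric] mult.commute)
      also have "\<dots> \<le> cs * \<epsilon>\<^sup>2 / (16 * L\<^sup>2) * ?H n"
        using elim(1) Hpos[of n] by (intro mult_right_mono) auto
      finally have "2 * L * e\<^sup>2 \<le> 2 * L * (cs * \<epsilon>\<^sup>2 / (16 * L\<^sup>2) * ?H n)"
        using L by (intro mult_left_mono) auto
      also have "\<dots> = s0 / (8 * L)" unfolding s0_def using L by (simp add: field_simps power2_eq_square)
      finally have "2 * L * e\<^sup>2 \<le> s0 / (8 * L)" .
      moreover have "2 * t = s0 / (8 * L)" unfolding t_def ct_def s0_def using L by (simp add: field_simps)
      moreover have "s0 / (4 * L) = s0 / (8 * L) + s0 / (8 * L)" using L by (simp add: field_simps)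
      ultimately show ?thesis by linarith
    qed
    have n3: "\<theta> * (L * (2 * J n) * (2 * (C0 * R))) \<le> 1"
    proof -
      have P: "0 < 4 * L * C0 * R" using L C0(1) R(1) by simp
      have "c\<theta> \<le> 1 / (4 * L * C0 * R)" unfolding c\<theta>_def by simp
      then have "c\<theta> * (4 * L * C0 * R) \<le> 1" using P by (simp only: pos_le_divide_eq)
      moreover have "\<theta> * (L * (2 * J n) * (2 * (C0 * R))) = c\<theta> * (4 * L * C0 * R)"
        unfolding \<theta>_def using Jn by (simp add: field_simps)
      ultimately show ?thesis by (simp only:)
    qed
    have n4: "4 * L * J n * C0 * \<kappa> + 4 * L * w \<le> t"
      unfolding \<kappa>_def w_def t_def using L C0(1) Jn by (simp add: field_simps)
    have mean': "(spline n b x - mu0 x q)\<^sup>2 / L - L * (spline n (beta0 n q) x - mu0 x q)\<^sup>2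
         \<le> (\<integral>y. (rho y (eta (spline n b x)) q - rho y (eta (spline n (beta0 n q) x)) q) * fYX x y \<partial>N)"
      if x: "x \<in> U n" and q: "q \<in> Qs" and b: "\<And>k. k < K n \<Longrightarrow> \<bar>b k\<bar> \<le> R" for x q b
    proof (rule mean[THEN conjunct2])
      show "x \<in> Xs" "q \<in> Qs" using x q U_subset by auto
      have "(\<Sum>k<K n. \<bar>p n k x\<bar>) \<le> C0" using elim(2) x by blast
      then show "\<bar>spline n b x\<bar> \<le> C0 * R" "\<bar>spline n (beta0 n q) x\<bar> \<le> C0 * R"
        unfolding spline_def using b b0[OF q] R(1) by (auto intro!: abs_dot_sup_le)
      have "\<bar>mu0 x q - spline n (beta0 n q) x\<bar> \<le> Ca * h n ^ m" using elim(4) \<open>x \<in> Xs\<close> q by blast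
      then show "\<bar>spline n (beta0 n q) x - mu0 x q\<bar> \<le> r" using elim(1) by (simp add: abs_minus_commute)
      show "c \<le> Psi_deriv 1 N fYX psi x \<zeta> q" if "\<zeta> \<in> closed_segment (eta (spline n b x)) (eta (mu0 x q))" for \<zeta>
        by (rule curvature(2)[OF \<open>x \<in> Xs\<close> q _ that]) (use b R(1) in \<open>simp add: max_norm_le_iff\<close>)
    qed
    have approx': "\<bar>spline n (beta0 n q) x - mu0 x q\<bar> \<le> e" if "x \<in> U n" "q \<in> Qs" for x q
    proof -
      have "x \<in> Xs" using that U_subset by blast
      then have "\<bar>mu0 x q - spline n (beta0 n q) x\<bar> \<le> Ca * h n ^ m" using elim(4) that(2) by blast
      then show ?thesis unfolding e_def by (simp add: abs_minus_commute)
    qed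
    have s0': "s0 \<le> L2_mass n a" if "\<epsilon> < eucl_norm (K n) a" for a
    proof -
      have "\<epsilon>\<^sup>2 \<le> (eucl_norm (K n) a)\<^sup>2" using that eps by (intro power_mono) auto
      then have "s0 \<le> cs * ?H n * (eucl_norm (K n) a)\<^sup>2"
        unfolding s0_def using cs(1) Hpos[of n] by (intro mult_left_mono) auto
      also have "\<dots> \<le> L2_mass n a" using elim(3) by blast
      finally show ?thesis .
    qed
    have C0': "(\<Sum>k<K n. \<bar>p n k x\<bar>) \<le> C0" if "x \<in> U n" for x using elim(2) that by blast
    have "\<exists>E\<in>sets M. measure M E \<le> (2 * R / \<kappa> + 3) ^ (2 * K n) * (1 / w + 2) * (2 * Qb / w + 3) * exp (- \<theta> * real n * t)
        + (1 / w + 2) * exp (- real n * w) \<and>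
     (\<forall>\<omega>\<in>space M - E. (\<forall>i<n. psibar (xs i \<omega>) (ys i \<omega>) \<le> J n) \<longrightarrow>
       (\<forall>b. \<forall>q\<in>Qs. (\<forall>k<K n. \<bar>b k\<bar> \<le> R) \<longrightarrow> \<epsilon> < eucl_norm (K n) (\<lambda>k. b k - beta0 n q k) \<longrightarrow>
         0 < (\<Sum>i<n. rho (ys i \<omega>) (eta (spline n b (xs i \<omega>))) q - rho (ys i \<omega>) (eta (spline n (beta0 n q) (xs i \<omega>))) q)))"
      by (rule finite_sample_bound[where ?beta0.0="beta0 n" and n=n and R=R and ?C0.0=C0 and L=L and ?C2.0=C2 and e=e and Qb=Qb and ?s0.0=s0 and J="J n" and \<theta>=\<theta> and t=t and \<kappa>=\<kappa> and w=w and \<epsilon>=\<epsilon>])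
        (fact meas lip qd C2 mean' approx' Qb C0(1) C0' R(1) b0 L s0' Jn pos n1 n2 n3 n4)+
    then obtain E where E: "E \<in> sets M" and Ep: "measure M E \<le> (2 * R / \<kappa> + 3) ^ (2 * K n) * (1 / w + 2) * (2 * Qb / w + 3) * exp (- \<theta> * real n * t)
        + (1 / w + 2) * exp (- real n * w)"
      and Em: "\<forall>\<omega>\<in>space M - E. (\<forall>i<n. psibar (xs i \<omega>) (ys i \<omega>) \<le> J n) \<longrightarrow>
       (\<forall>b. \<forall>q\<in>Qs. (\<forall>k<K n. \<bar>b k\<bar> \<le> R) \<longrightarrow> \<epsilon> < eucl_norm (K n) (\<lambda>k. b k - beta0 n q k) \<longrightarrow>
         0 < (\<Sum>i<n. rho (ys i \<omega>) (eta (spline n b (xs i \<omega>))) q - rho (ys i \<omega>) (eta (spline n (beta0 n q) (xs i \<omega>))) q))"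
      by (elim bexE conjE)
    have "(2 * R / \<kappa> + 3) ^ (2 * K n) * (1 / w + 2) * (2 * Qb / w + 3) * exp (- \<theta> * real n * t)
        + (1 / w + 2) * exp (- real n * w) = B n"
    proof -
      have "2 * R / \<kappa> = 16 * R * L * C0 / ct * (J n / ?H n)" "1 / w = 8 * L / ct / ?H n" "2 * Qb / w = 16 * L * Qb / ct / ?H n"
        "- \<theta> * real n * t = - (c\<theta> * ct * (real n * ?H n / J n))" "- real n * w = - (ct / (8 * L) * (real n * ?H n))"
        unfolding \<kappa>_def w_def \<theta>_def t_def using L C0(1) ct Hpos[of n] Jn by (simp_all add: field_simps)
      then show ?thesis unfolding B_def by simp
    qed
    with Ep have "measure M E \<le> B n" by simp
    moreover have "eucl_norm (K n) (\<lambda>k. betahat n q \<omega> k - beta0 n q k) \<le> \<epsilon>"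
      if \<omega>: "\<omega> \<in> space M - E" and Jw: "\<forall>i<n. psibar (xs i \<omega>) (ys i \<omega>) \<le> J n" and q: "q \<in> Qs" for \<omega> q
    proof (rule ccontr)
      assume "\<not> ?thesis"
      then have far: "\<epsilon> < eucl_norm (K n) (\<lambda>k. betahat n q \<omega> k - beta0 n q k)" by simp
      have "is_arg_min (\<lambda>b. \<Sum>i<n. rho (ys i \<omega>) (eta (dot (K n) (\<lambda>k. p n k (xs i \<omega>)) b)) q)
          (\<lambda>b. b \<in> {b. max_norm (K n) b \<le> R}) (betahat n q \<omega>)"
        using estimator q \<omega> unfolding m_estimator_def by blast
      \<comment> \<open>\<open>beta0 n q\<close> is itself feasible, so the minimiser does at least
        as well. This contradicts the positive sum of increments.\<close>
      then have bh: "max_norm (K n) (betahat n q \<omega>) \<le> R"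
        and min: "(\<Sum>i<n. rho (ys i \<omega>) (eta (spline n (betahat n q \<omega>) (xs i \<omega>))) q) \<le> (\<Sum>i<n. rho (ys i \<omega>) (eta (spline n (beta0 n q) (xs i \<omega>))) q)"
        using R(2)[OF q, of n] unfolding is_arg_min_linorder spline_def by auto
      have "0 < (\<Sum>i<n. rho (ys i \<omega>) (eta (spline n (betahat n q \<omega>) (xs i \<omega>))) q - rho (ys i \<omega>) (eta (spline n (beta0 n q) (xs i \<omega>))) q)"
        using Em[rule_format, OF \<omega> _ q _ far] Jw bh R(1) by (simp add: max_norm_le_iff)
      then show False using min by (simp add: sum_subtractf)
    qed
    ultimately show ?case using E by blast
  qed
  then show ?thesis using B0 by blast
qed

end

text \<open>A measurable superset of small probability bounds the outer measure, so neither suprema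
  over uncountable sets nor the selection of minimisers have to be measurable.\<close>

lemma small_oPI:
  assumes "\<And>\<delta> t. 0 < \<delta> \<Longrightarrow> 0 < t \<Longrightarrow> \<forall>\<^sub>F n in sequentially. \<exists>S\<in>sets M. emeasure M S \<le> ennreal t \<and>
     (\<forall>\<omega>\<in>space M - S. Y n \<omega> \<le> ennreal (\<delta> * a n))"
  shows "small_oP M Y a"
  unfolding small_oP_def
proof (intro allI impI order_tendstoI)
  fix \<delta> :: real and b :: ennreal assume "0 < \<delta>" "0 < b"
  obtain t where t: "0 < t" "ennreal t < b"
  proof (cases b)
    case (real r)
    with \<open>0 < b\<close> have "0 < r" by simp
    with real show thesis by (intro that[of "r / 2"]) (auto simp: ennreal_less_iff)
  next
    case top
    then show thesis by (intro that[of 1]) auto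
  qed
  show "\<forall>\<^sub>F n in sequentially. outer_measure_of M {\<omega>\<in>space M. Y n \<omega> > ennreal (\<delta> * a n)} < b"
    using assms[OF \<open>0 < \<delta>\<close> t(1)]
  proof eventually_elim
    case (elim n)
    then obtain S where S: "S \<in> sets M" "emeasure M S \<le> ennreal t" "\<And>\<omega>. \<omega> \<in> space M - S \<Longrightarrow> Y n \<omega> \<le> ennreal (\<delta> * a n)" by blast
    have "{\<omega>\<in>space M. Y n \<omega> > ennreal (\<delta> * a n)} \<subseteq> S" using S(3) by (force simp: not_le[symmetric])
    then have "outer_measure_of M {\<omega>\<in>space M. Y n \<omega> > ennreal (\<delta> * a n)} \<le> emeasure M S"
      unfolding outer_measure_of_def using S(1) by (intro INF_lower) auto
    also have "\<dots> \<le> ennreal t" by (rule S(2))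
    finally show ?case using t(2) by (rule le_less_trans)
  qed
qed auto

section \<open>Tails of the envelope and the truncation level\<close>

context series_estimation begin

text \<open>Integrates the conditional tail over the covariate. Since \<open>J\<close> is
  nonnegative, a pair off \<open>good_points\<close>, where the cut-off envelope is zero, never
  exceeds it. The index 0 of \<open>good_points\<close> is arbitrary.\<close>

lemma psibar_tail:
  assumes J: "0 \<le> J" and b: "0 \<le> b"
    and tail: "\<And>x. x \<in> Xs \<Longrightarrow> cond_nn_expect N fYX (\<lambda>y. of_bool (J \<le> \<bar>psibar x y\<bar>)) x \<le> ennreal b"
  shows "measure M {\<omega>\<in>space M. \<not> psibar (xs i \<omega>) (ys i \<omega>) \<le> J} \<le> b"
proof -
  interpret M: prob_space M by (rule prob_M)
  let ?f = "\<lambda>z. (case z of (x, y) \<Rightarrow> psibar x y) * indicator (good_points 0) z"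
  have "?f \<in> borel_measurable borel"
  proof (rule borel_measurable_indicator_restrict[OF psibar_meas])
    show "good_points 0 \<in> sets borel" using good_points_sets[of 0] by (simp only: borel_prod)
    show "good_points 0 \<subseteq> Xs \<times> Ys" using good_points_subset by auto
  qed
  then have [measurable]: "?f \<in> borel_measurable (borel \<Otimes>\<^sub>M borel)" by (simp only: borel_prod)
  define T where "T = {z. J < ?f z}"
  have "{z \<in> space (borel \<Otimes>\<^sub>M borel). J < ?f z} \<in> sets (borel \<Otimes>\<^sub>M borel)" by measurable
  then have T [measurable]: "T \<in> sets (borel \<Otimes>\<^sub>M borel)" unfolding T_def by (simp add: space_pair_measure)
  have "emeasure M {\<omega>\<in>space M. \<not> psibar (xs i \<omega>) (ys i \<omega>) \<le> J} \<le> emeasure M (Z i -` T \<inter> space M)"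
  proof (rule emeasure_mono_AE)
    show "AE \<omega> in M. \<omega> \<in> {\<omega>\<in>space M. \<not> psibar (xs i \<omega>) (ys i \<omega>) \<le> J} \<longrightarrow> \<omega> \<in> Z i -` T \<inter> space M"
      using AE_good_points[of 0] by eventually_elim (auto simp: T_def Z_def)
    show "Z i -` T \<inter> space M \<in> sets M" by measurable
  qed
  also have "\<dots> = emeasure law T"
    unfolding law_Z[of i, symmetric] by (rule emeasure_distr[symmetric]) measurable
  also have "\<dots> = (\<integral>\<^sup>+z. indicator T z \<partial>law)" using T by simp
  also have "\<dots> = (\<integral>\<^sup>+x. \<integral>\<^sup>+y. ennreal (joint_density (x, y)) * indicator T (x, y) \<partial>N \<partial>lborel)"
    by (rule nn_integral_law) measurable
  also have "\<dots> \<le> (\<integral>\<^sup>+x. ennreal b * ennreal (fX x) \<partial>lborel)"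
  proof (rule nn_integral_mono)
    fix x
    show "(\<integral>\<^sup>+y. ennreal (joint_density (x, y)) * indicator T (x, y) \<partial>N) \<le> ennreal b * ennreal (fX x)"
    proof (cases "x \<in> Xs")
      case x: True
      have eq: "ennreal (joint_density (x, y)) * indicator T (x, y) = ennreal (fX x) * (ennreal (fYX x y) * indicator T (x, y))" for y
        using fX_nonneg fYX_nonneg[OF x] by (simp add: joint_density_def ennreal_mult mult.assoc)
      note [measurable] = fYX_meas[OF x]
      have pull: "(\<integral>\<^sup>+y. ennreal (joint_density (x, y)) * indicator T (x, y) \<partial>N) = ennreal (fX x) * (\<integral>\<^sup>+y. ennreal (fYX x y) * indicator T (x, y) \<partial>N)"
        unfolding eq by (rule nn_integral_cmult) measurable
      have "(\<integral>\<^sup>+y. ennreal (fYX x y) * indicator T (x, y) \<partial>N) \<le> cond_nn_expect N fYX (\<lambda>y. of_bool (J \<le> \<bar>psibar x y\<bar>)) x"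
        unfolding cond_nn_expect_def
      proof (rule nn_integral_mono)
        fix y
        show "ennreal (fYX x y) * indicator T (x, y) \<le> ennreal (of_bool (J \<le> \<bar>psibar x y\<bar>) * fYX x y)"
        proof (cases "(x, y) \<in> T")
          case True
          then have "J \<le> \<bar>psibar x y\<bar>" using J unfolding T_def by (cases "(x, y) \<in> good_points 0") auto
          then show ?thesis by (simp add: indicator_def)
        qed simp
      qed
      also have "\<dots> \<le> ennreal b" by (rule tail[OF x])
      finally show ?thesis unfolding pull by (subst mult.commute) (rule mult_right_mono, simp_all)
    qed (simp add: joint_density_def fX_outside)
  qed
  also have "\<dots> = ennreal b" by (subst nn_integral_cmult) (auto simp: fX_integral)
  finally show ?thesis using b by (simp add: M.emeasure_eq_measure)
qed

lemma psibar_max_tail: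
  assumes J: "0 \<le> J" and b: "0 \<le> b"
    and tail: "\<And>x. x \<in> Xs \<Longrightarrow> cond_nn_expect N fYX (\<lambda>y. of_bool (J \<le> \<bar>psibar x y\<bar>)) x \<le> ennreal b"
  shows "{\<omega>\<in>space M. \<exists>i<n. \<not> psibar (xs i \<omega>) (ys i \<omega>) \<le> J} \<in> sets M"
    and "measure M {\<omega>\<in>space M. \<exists>i<n. \<not> psibar (xs i \<omega>) (ys i \<omega>) \<le> J} \<le> real n * b"
proof -
  interpret M: prob_space M by (rule prob_M)
  let ?S = "\<lambda>i. {\<omega>\<in>space M. \<not> psibar (xs i \<omega>) (ys i \<omega>) \<le> J}"
  have S: "?S i \<in> sets M" for i
  proof -
    have "?S i = space M - {\<omega>\<in>space M. psibar (xs i \<omega>) (ys i \<omega>) \<le> J}" by auto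
    then show ?thesis using psibar_Z_measurable[of i J] by simp
  qed
  have eq: "{\<omega>\<in>space M. \<exists>i<n. \<not> psibar (xs i \<omega>) (ys i \<omega>) \<le> J} = (\<Union>i<n. ?S i)" by auto
  show "{\<omega>\<in>space M. \<exists>i<n. \<not> psibar (xs i \<omega>) (ys i \<omega>) \<le> J} \<in> sets M"
    unfolding eq using S by (intro sets.finite_UN) auto
  have "measure M (\<Union>i<n. ?S i) \<le> (\<Sum>i<n. measure M (?S i))"
    using S by (intro M.finite_measure_subadditive_finite) auto
  also have "\<dots> \<le> (\<Sum>i<n. b)" by (intro sum_mono psibar_tail assms)
  finally show "measure M {\<omega>\<in>space M. \<exists>i<n. \<not> psibar (xs i \<omega>) (ys i \<omega>) \<le> J} \<le> real n * b"
    unfolding eq by simp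
qed

text \<open>Markov's inequality for the \<nu>-th power of the envelope, uniformly in the
  covariate.\<close>

lemma moment_tail: "\<exists>C>0. \<forall>J>0. \<forall>x\<in>Xs. cond_nn_expect N fYX (\<lambda>y. of_bool (J \<le> \<bar>psibar x y\<bar>)) x \<le> ennreal (C / J powr \<nu>)"
proof -
  obtain C where C: "\<And>x. x \<in> Xs \<Longrightarrow> cond_nn_expect N fYX (\<lambda>y. psibar x y powr \<nu>) x \<le> ennreal C"
    using psibar_moment by blast
  have "cond_nn_expect N fYX (\<lambda>y. of_bool (J \<le> \<bar>psibar x y\<bar>)) x \<le> ennreal (max C 1 / J powr \<nu>)"
    if J: "0 < J" and x: "x \<in> Xs" for J x
  proof -
    note [measurable] = fYX_meas[OF x] psibar_section[OF x] fYX_support_borel[OF x]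
    let ?i = "indicator {y. fYX x y \<noteq> 0} :: real \<Rightarrow> real"
    have "cond_nn_expect N fYX (\<lambda>y. of_bool (J \<le> \<bar>psibar x y\<bar>)) x \<le>
      (\<integral>\<^sup>+y. ennreal (1 / J powr \<nu>) * ennreal (psibar x y powr \<nu> * fYX x y) \<partial>N)"
      unfolding cond_nn_expect_def
    proof (rule nn_integral_mono)
      fix y
      have "of_bool (J \<le> \<bar>psibar x y\<bar>) * fYX x y \<le> 1 / J powr \<nu> * (psibar x y powr \<nu> * fYX x y)"
      proof (cases "fYX x y \<noteq> 0 \<and> J \<le> \<bar>psibar x y\<bar>")
        case True
        then have "0 < psibar x y" using psibar_pos[OF x] fYX_Ys[OF x] by blast
        then have "J powr \<nu> \<le> psibar x y powr \<nu>" using True J nu_gt_2 by (intro powr_mono2) auto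
        then have "1 \<le> 1 / J powr \<nu> * psibar x y powr \<nu>" using J by (simp add: le_divide_eq)
        from mult_right_mono[OF this fYX_nonneg[OF x, of y]] show ?thesis using True by simp
      next
        case False
        then show ?thesis using J fYX_nonneg[OF x, of y] by auto
      qed
      then show "ennreal (of_bool (J \<le> \<bar>psibar x y\<bar>) * fYX x y) \<le> ennreal (1 / J powr \<nu>) * ennreal (psibar x y powr \<nu> * fYX x y)"
        using fYX_nonneg[OF x, of y] by (subst ennreal_mult[symmetric]) (auto intro!: ennreal_leI)
    qed
    also have "\<dots> = ennreal (1 / J powr \<nu>) * cond_nn_expect N fYX (\<lambda>y. psibar x y powr \<nu>) x"
      unfolding cond_nn_expect_def
    proof (rule nn_integral_cmult)
      have eq: "(\<lambda>y. ennreal (psibar x y powr \<nu> * fYX x y)) = (\<lambda>y. ennreal ((psibar x y * ?i y) powr \<nu> * fYX x y))"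
        by (auto simp: indicator_def)
      show "(\<lambda>y. ennreal (psibar x y powr \<nu> * fYX x y)) \<in> borel_measurable N" unfolding eq by measurable
    qed
    also have "\<dots> \<le> ennreal (1 / J powr \<nu>) * ennreal (max C 1)"
      by (intro mult_left_mono order.trans[OF C[OF x]] ennreal_leI) auto
    also have "\<dots> = ennreal (max C 1 / J powr \<nu>)" by (subst ennreal_mult[symmetric]) auto
    finally show ?thesis .
  qed
  then show ?thesis by (intro exI[of _ "max C 1"]) auto
qed

text \<open>The union bound over the sample asks for n times the tail at \<open>J\<close> to be at
  most \<open>t\<close>. A \<nu>-th moment then leads to J of order n^(1/\<nu>) with a constant
  depending on \<open>t\<close>, and the diverging ratio becomes a power of the reciprocal of the
  first rate. With a sub-Gaussian tail, J is of order (ln n)^(1/2), and J ln n has the order (ln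
  n)^(3/2) of the second rate.\<close>

lemma truncation:
  assumes rate:
      "(\<lambda>n. ln (real n) powr (\<nu> / (\<nu> - 1))
              / (real n * h n powr (2 * \<nu> / (\<nu> - 1) * real CARD('d)))) \<in> o(\<lambda>_. 1) \<or>
       (\<lambda>n. ln (real n) powr (3 / 2) / (real n * h n ^ (2 * CARD('d)))) \<in> o(\<lambda>_. 1) \<and>
         cond_sub_gaussian N fYX Xs psibar"
    and t: "0 < t"
  shows "\<exists>J. (\<forall>n. 1 \<le> J n) \<and>
     filterlim (\<lambda>n. real n * (h n ^ CARD('d))\<^sup>2 / (J n * ln (real n))) at_top sequentially \<and>
     (\<forall>\<^sub>F n in sequentially. {\<omega>\<in>space M. \<exists>i<n. \<not> psibar (xs i \<omega>) (ys i \<omega>) \<le> J n} \<in> sets M \<and>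
        measure M {\<omega>\<in>space M. \<exists>i<n. \<not> psibar (xs i \<omega>) (ys i \<omega>) \<le> J n} \<le> t)"
  using rate
proof
  let ?f = "\<lambda>n. ln (real n) powr (\<nu> / (\<nu> - 1)) / (real n * h n powr (2 * \<nu> / (\<nu> - 1) * real CARD('d)))"
  assume as: "?f \<in> o(\<lambda>_. 1)"
  have f0: "?f \<longlonglongrightarrow> 0" using smalloD_tendsto[OF as] by simp
  have fpos: "\<forall>\<^sub>F n in sequentially. 0 < ?f n"
    using eventually_ge_at_top[of 2]
  proof eventually_elim
    case (elim n)
    then have "0 < ln (real n)" by simp
    then show ?case using elim mesh_pos[of n] by simp
  qed
  obtain C where C: "C > 0" "\<And>J x. 0 < J \<Longrightarrow> x \<in> Xs \<Longrightarrow> cond_nn_expect N fYX (\<lambda>y. of_bool (J \<le> \<bar>psibar x y\<bar>)) x \<le> ennreal (C / J powr \<nu>)"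
    using moment_tail by blast
  \<comment> \<open>Chosen so that C / A^\<nu> \<le> t; the factor n^(1/\<nu>) in \<open>J\<close>
    cancels the n of the union bound.\<close>
  define A where "A = max 1 ((C / t) powr (1 / \<nu>))"
  have A: "1 \<le> A" "C / A powr \<nu> \<le> t"
  proof -
    show "1 \<le> A" unfolding A_def by simp
    have "C / t = ((C / t) powr (1 / \<nu>)) powr \<nu>" using C(1) t nu_gt_2 by (simp add: powr_powr)
    also have "\<dots> \<le> A powr \<nu>" using nu_gt_2 unfolding A_def by (intro powr_mono2) auto
    finally show "C / A powr \<nu> \<le> t" using t \<open>1 \<le> A\<close> by (simp add: field_simps)
  qed
  define J where "J n = max 1 (A * real n powr (1 / \<nu>))" for n
  have Jn: "J n = A * real n powr (1 / \<nu>)" if "1 \<le> n" for n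
  proof -
    have "1 \<le> real n powr (1 / \<nu>)" using that nu_gt_2 by (intro ge_one_powr_ge_zero) auto
    then have "1 * 1 \<le> A * real n powr (1 / \<nu>)" using A(1) by (intro mult_mono) auto
    then show ?thesis unfolding J_def by simp
  qed
  have "\<forall>\<^sub>F n in sequentially. {\<omega>\<in>space M. \<exists>i<n. \<not> psibar (xs i \<omega>) (ys i \<omega>) \<le> J n} \<in> sets M \<and>
        measure M {\<omega>\<in>space M. \<exists>i<n. \<not> psibar (xs i \<omega>) (ys i \<omega>) \<le> J n} \<le> t"
    using eventually_ge_at_top[of 1]
  proof eventually_elim
    case (elim n)
    have Jp: "0 < J n" unfolding J_def by simp
    have "real n * (C / J n powr \<nu>) = C / A powr \<nu>"
      unfolding Jn[OF elim] using elim A(1) nu_gt_2 by (simp add: powr_mult powr_powr)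
    then have le: "real n * (C / J n powr \<nu>) \<le> t" using A(2) by (simp only:)
    have b0: "0 \<le> C / J n powr \<nu>" using C(1) Jp by simp
    note tail = psibar_max_tail[OF less_imp_le[OF Jp] b0 C(2)[OF Jp], of n]
    show ?case by (intro conjI tail(1) order.trans[OF tail(2) le])
  qed
  moreover have "filterlim (\<lambda>n. real n * (h n ^ CARD('d))\<^sup>2 / (J n * ln (real n))) at_top sequentially"
  proof -
    \<comment> \<open>The reciprocal of the ratio that has to diverge. The exponent (\<nu> - 1) /
      \<nu> turns the powers in the rate into ln n, h^(2d) and n / n^(1/\<nu>).\<close>
    let ?g = "\<lambda>n. A * ?f n powr ((\<nu> - 1) / \<nu>)"
    have "(\<lambda>n. ?f n powr ((\<nu> - 1) / \<nu>)) \<longlonglongrightarrow> 0"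
      by (rule tendsto_zero_powrI[OF f0 tendsto_const eventually_mono[OF fpos less_imp_le]]) (use nu_gt_2 in auto)
    then have g0: "?g \<longlonglongrightarrow> 0" by (rule tendsto_mult_right_zero)
    have gpos: "\<forall>\<^sub>F n in sequentially. 0 < ?g n"
      using fpos
    proof eventually_elim
      case (elim n)
      from order.strict_implies_not_eq[OF elim] have "0 < ?f n powr ((\<nu> - 1) / \<nu>)"
        by (metis powr_gt_zero)
      then show ?case using A(1) by (intro mult_pos_pos) simp_all
    qed
    have "filterlim (\<lambda>n. inverse (?g n)) at_top sequentially"
      using filterlim_inverse_at_top[OF g0 gpos] .
    moreover have "\<forall>\<^sub>F n in sequentially. inverse (?g n) = real n * (h n ^ CARD('d))\<^sup>2 / (J n * ln (real n))"
      using eventually_ge_at_top[of 2]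
    proof eventually_elim
      case (elim n)
      then have l: "0 < ln (real n)" by simp
      have hp: "0 < h n" by (rule mesh_pos)
      have "?f n powr ((\<nu> - 1) / \<nu>) = ln (real n) / (real n powr ((\<nu> - 1) / \<nu>) * h n powr (2 * real CARD('d)))"
        using l hp elim nu_gt_2 by (simp add: powr_divide powr_mult powr_powr)
      moreover have "h n powr (2 * real CARD('d)) = (h n ^ CARD('d))\<^sup>2"
        using hp by (simp add: powr_realpow[symmetric] powr_powr mult.commute flip: power_mult)
      moreover have "real n powr ((\<nu> - 1) / \<nu>) = real n / real n powr (1 / \<nu>)"
        using elim nu_gt_2 by (simp add: powr_diff diff_divide_distrib)
      ultimately show ?case using elim A(1) Jn[of n] by (simp add: field_simps)
    qed
    ultimately show ?thesis by (rule filterlim_cong[THEN iffD1, OF refl refl, rotated])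
  qed
  moreover have "\<forall>n. 1 \<le> J n" unfolding J_def by simp
  ultimately show ?thesis by (intro exI[of _ J] conjI)
next
  let ?f = "\<lambda>n. ln (real n) powr (3 / 2) / (real n * h n ^ (2 * CARD('d)))"
  assume as: "?f \<in> o(\<lambda>_. 1) \<and> cond_sub_gaussian N fYX Xs psibar"
  have f0: "?f \<longlonglongrightarrow> 0" using smalloD_tendsto[OF conjunct1[OF as]] by simp
  obtain s where s: "s > 0" "\<And>x u. x \<in> Xs \<Longrightarrow> 0 \<le> u \<Longrightarrow>
      cond_nn_expect N fYX (\<lambda>y. of_bool (\<bar>psibar x y\<bar> \<ge> u)) x \<le> ennreal (2 * exp (- u\<^sup>2 / s))"
    using as unfolding cond_sub_gaussian_def by blast
  \<comment> \<open>The factor 2 under the root makes each tail at most 2 / n^2, so that n of them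
    sum to 2 / n. The added 1 ensures J \<ge> 1 and is absorbed below in the constant
    \<open>c\<close> as soon as ln n \<ge> 1.\<close>
  define J where "J n = sqrt (2 * s * max 0 (ln (real n))) + 1" for n
  have J1: "1 \<le> J n" for n unfolding J_def using s(1) by simp
  have "(\<lambda>n. 2 * inverse (real n)) \<longlonglongrightarrow> 0"
    using tendsto_mult_right_zero[OF lim_inverse_n, of 2] by simp
  then have "\<forall>\<^sub>F n in sequentially. 2 * inverse (real n) < t" using t by (rule order_tendstoD)
  then have "\<forall>\<^sub>F n in sequentially. {\<omega>\<in>space M. \<exists>i<n. \<not> psibar (xs i \<omega>) (ys i \<omega>) \<le> J n} \<in> sets M \<and>
        measure M {\<omega>\<in>space M. \<exists>i<n. \<not> psibar (xs i \<omega>) (ys i \<omega>) \<le> J n} \<le> t"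
    using eventually_ge_at_top[of 1]
  proof eventually_elim
    case (elim n)
    have Jp: "0 \<le> J n" using J1[of n] by simp
    have l: "0 \<le> ln (real n)" using elim by simp
    have "2 * s * ln (real n) = (sqrt (2 * s * ln (real n)))\<^sup>2" using s(1) l by simp
    also have "\<dots> \<le> (J n)\<^sup>2" unfolding J_def using l s(1) by (intro power_mono) auto
    finally have "2 * ln (real n) \<le> (J n)\<^sup>2 / s" using s(1) by (simp add: le_divide_eq mult_ac)
    then have "exp (- (J n)\<^sup>2 / s) \<le> exp (- (2 * ln (real n)))" by simp
    also have "\<dots> = inverse (real n) * inverse (real n)"
      using elim by (simp add: exp_minus exp_double power2_eq_square)
    finally have "real n * (2 * exp (- (J n)\<^sup>2 / s)) \<le> real n * (2 * (inverse (real n) * inverse (real n)))"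
      by (intro mult_left_mono) auto
    also have "\<dots> = 2 * inverse (real n)" using elim by (simp add: field_simps)
    finally have "real n * (2 * exp (- (J n)\<^sup>2 / s)) \<le> t" using elim by linarith
    then have le: "real n * (2 * exp (- (J n)\<^sup>2 / s)) \<le> t" .
    note tail = psibar_max_tail[OF Jp _ s(2)[OF _ Jp], of n]
    show ?case by (intro conjI tail(1) order.trans[OF tail(2) le]) simp_all
  qed
  moreover have "filterlim (\<lambda>n. real n * (h n ^ CARD('d))\<^sup>2 / (J n * ln (real n))) at_top sequentially"
  proof -
    define c where "c = sqrt (2 * s) + 1"
    have c: "c > 0" unfolding c_def using s(1) by (simp add: add_nonneg_pos)
    have g0: "(\<lambda>n. c * ?f n) \<longlonglongrightarrow> 0" by (rule tendsto_mult_right_zero[OF f0])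
    have gpos: "\<forall>\<^sub>F n in sequentially. 0 < c * ?f n"
      using eventually_ge_at_top[of 2]
    proof eventually_elim
      case (elim n)
      then have "0 < ln (real n)" by simp
      then show ?case using elim mesh_pos[of n] c by simp
    qed
    have "filterlim (\<lambda>n. inverse (c * ?f n)) at_top sequentially"
      using filterlim_inverse_at_top[OF g0 gpos] .
    then show ?thesis
    proof (rule filterlim_at_top_mono)
      show "\<forall>\<^sub>F n in sequentially. inverse (c * ?f n) \<le> real n * (h n ^ CARD('d))\<^sup>2 / (J n * ln (real n))"
        using eventually_ge_at_top[of 3]
      proof eventually_elim
        case (elim n)
        have l: "1 \<le> ln (real n)"
        proof -
          have "exp 1 \<le> real n" using exp_le elim by simp
          then show ?thesis using elim by (subst ln_ge_iff) auto
        qed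
        have hp: "0 < h n" by (rule mesh_pos)
        have "J n \<le> c * sqrt (ln (real n))"
          unfolding J_def c_def using l by (simp add: real_sqrt_mult algebra_simps)
        then have "J n * ln (real n) \<le> c * sqrt (ln (real n)) * ln (real n)" using l by (intro mult_right_mono) auto
        also have "\<dots> = c * ln (real n) powr (3 / 2)"
        proof -
          have "ln (real n) powr (3 / 2) = sqrt (ln (real n)) * ln (real n)"
            using powr_add[of "ln (real n)" "1 / 2" 1] l by (simp add: powr_half_sqrt)
          then show ?thesis by simp
        qed
        finally have le: "J n * ln (real n) \<le> c * ln (real n) powr (3 / 2)" .
        have "inverse (c * ?f n) = real n * (h n ^ CARD('d))\<^sup>2 / (c * ln (real n) powr (3 / 2))"
          by (simp add: field_simps power_mult[symmetric] mult.commute)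
        also have "\<dots> \<le> real n * (h n ^ CARD('d))\<^sup>2 / (J n * ln (real n))"
        proof (rule divide_left_mono[OF le])
          show "0 < c * ln (real n) powr (3 / 2) * (J n * ln (real n))"
            using c l J1[of n] by (auto intro!: mult_pos_pos)
        qed simp
        finally show ?case .
      qed
    qed
  qed
  moreover have "\<forall>n. 1 \<le> J n" using J1 by simp
  ultimately show ?thesis by (intro exI[of _ J] conjI)
qed

end

section \<open>Consistency\<close>

context series_estimation begin

text \<open>Half of \<open>t\<close> goes to the envelope exceeding \<open>J\<close> and fixes
  \<open>J\<close>; for this \<open>J\<close> the exceptional events have probability tending to
  zero, so eventually at most the other half.\<close>

lemma uniform_consistency:
  fixes beta0 :: "nat \<Rightarrow> real \<Rightarrow> nat \<Rightarrow> real" and betahat :: "nat \<Rightarrow> real \<Rightarrow> 'w \<Rightarrow> nat \<Rightarrow> real"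
    and R c Ca \<epsilon> t :: real
  assumes h0: "h \<longlonglongrightarrow> 0"
    and R: "0 < R" "\<And>n q. q \<in> Qs \<Longrightarrow> max_norm (K n) (beta0 n q) \<le> R"
    and estimator: "m_estimator M Qs xs ys rho eta K p (\<lambda>n. {b. max_norm (K n) b \<le> R}) betahat"
    and smooth: "CARD('d) < 2 * m"
    and approx: "\<forall>\<^sub>F n in sequentially. \<forall>q\<in>Qs. \<forall>x\<in>Xs. \<bar>mu0 x q - spline n (beta0 n q) x\<bar> \<le> Ca * h n ^ m"
    and curvature: "0 < c" "\<And>n x q \<beta> \<zeta>. x \<in> Xs \<Longrightarrow> q \<in> Qs \<Longrightarrow> max_norm (K n) \<beta> \<le> R \<Longrightarrow>
        \<zeta> \<in> closed_segment (eta (spline n \<beta> x)) (eta (mu0 x q)) \<Longrightarrow> c \<le> Psi_deriv 1 N fYX psi x \<zeta> q"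
    and rate:
      "(\<lambda>n. ln (real n) powr (\<nu> / (\<nu> - 1))
              / (real n * h n powr (2 * \<nu> / (\<nu> - 1) * real CARD('d)))) \<in> o(\<lambda>_. 1) \<or>
       (\<lambda>n. ln (real n) powr (3 / 2) / (real n * h n ^ (2 * CARD('d)))) \<in> o(\<lambda>_. 1) \<and>
         cond_sub_gaussian N fYX Xs psibar"
    and eps: "0 < \<epsilon>" and t: "0 < t"
  shows "\<forall>\<^sub>F n in sequentially. \<exists>S\<in>sets M. emeasure M S \<le> ennreal t \<and>
    (\<forall>\<omega>\<in>space M - S. \<forall>q\<in>Qs. eucl_norm (K n) (\<lambda>k. betahat n q \<omega> k - beta0 n q k) \<le> \<epsilon>)"
proof -
  interpret M: prob_space M by (rule prob_M)
  have t2: "0 < t / 2" using t by simp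
  obtain J where J: "\<forall>n. 1 \<le> J n"
    and Jr: "filterlim (\<lambda>n. real n * (h n ^ CARD('d))\<^sup>2 / (J n * ln (real n))) at_top sequentially"
    and Jt: "\<forall>\<^sub>F n in sequentially. {\<omega>\<in>space M. \<exists>i<n. \<not> psibar (xs i \<omega>) (ys i \<omega>) \<le> J n} \<in> sets M \<and>
        measure M {\<omega>\<in>space M. \<exists>i<n. \<not> psibar (xs i \<omega>) (ys i \<omega>) \<le> J n} \<le> t / 2"
    using truncation[OF rate t2] by (elim exE conjE)
  obtain B where B: "B \<longlonglongrightarrow> 0" and BE: "\<forall>\<^sub>F n in sequentially. \<exists>E\<in>sets M. measure M E \<le> B n \<and>
    (\<forall>\<omega>\<in>space M - E. (\<forall>i<n. psibar (xs i \<omega>) (ys i \<omega>) \<le> J n) \<longrightarrow>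
      (\<forall>q\<in>Qs. eucl_norm (K n) (\<lambda>k. betahat n q \<omega> k - beta0 n q k) \<le> \<epsilon>))"
  proof -
    have "\<exists>B. B \<longlonglongrightarrow> (0::real) \<and> (\<forall>\<^sub>F n in sequentially. \<exists>E\<in>sets M. measure M E \<le> B n \<and>
      (\<forall>\<omega>\<in>space M - E. (\<forall>i<n. psibar (xs i \<omega>) (ys i \<omega>) \<le> J n) \<longrightarrow>
        (\<forall>q\<in>Qs. eucl_norm (K n) (\<lambda>k. betahat n q \<omega> k - beta0 n q k) \<le> \<epsilon>)))"
      by (rule consistency_event[where R=R and c=c and Ca=Ca])
         (fact h0 R estimator smooth approx curvature J[rule_format] Jr eps)+
    then show thesis by (elim exE conjE) (rule that)
  qed
  have "\<forall>\<^sub>F n in sequentially. B n < t / 2" by (rule order_tendstoD(2)[OF B t2])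
  with BE Jt show ?thesis
  proof eventually_elim
    case (elim n)
    let ?S = "{\<omega>\<in>space M. \<exists>i<n. \<not> psibar (xs i \<omega>) (ys i \<omega>) \<le> J n}"
    obtain E where E: "E \<in> sets M" "measure M E \<le> B n"
      and Em: "\<forall>\<omega>\<in>space M - E. (\<forall>i<n. psibar (xs i \<omega>) (ys i \<omega>) \<le> J n) \<longrightarrow>
      (\<forall>q\<in>Qs. eucl_norm (K n) (\<lambda>k. betahat n q \<omega> k - beta0 n q k) \<le> \<epsilon>)"
      using elim(1) by (elim bexE conjE)
    have S: "?S \<in> sets M" "measure M ?S \<le> t / 2"
      by (rule conjunct1[OF elim(2)], rule conjunct2[OF elim(2)])
    have "measure M (E \<union> ?S) \<le> measure M E + measure M ?S" by (rule measure_Un_le[OF E(1) S(1)])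
    also have "\<dots> \<le> t" using E(2) S(2) elim(3) by linarith
    finally have le: "emeasure M (E \<union> ?S) \<le> ennreal t"
      by (simp only: M.emeasure_eq_measure) (rule ennreal_leI)
    show ?case
    proof (intro bexI[of _ "E \<union> ?S"] conjI ballI)
      show "emeasure M (E \<union> ?S) \<le> ennreal t" by (rule le)
      show "E \<union> ?S \<in> sets M" by (rule sets.Un[OF E(1) S(1)])
      show "eucl_norm (K n) (\<lambda>k. betahat n q \<omega> k - beta0 n q k) \<le> \<epsilon>"
        if "\<omega> \<in> space M - (E \<union> ?S)" "q \<in> Qs" for \<omega> q
      proof -
        have "\<omega> \<in> space M - E" "\<forall>i<n. psibar (xs i \<omega>) (ys i \<omega>) \<le> J n" using that(1) by auto
        with Em that(2) show ?thesis by blast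
      qed
    qed
  qed
qed

section \<open>From coefficients to derivatives of the estimated function\<close>

lemma dp_combination_measurable:
  "(\<lambda>x. ennreal ((dot (K n) (\<lambda>k. dp n v k x) a)\<^sup>2) * indicator (U n) x) \<in> borel_measurable borel"
proof -
  have "continuous_on (U n) (\<lambda>x. dot (K n) (\<lambda>k. dp n v k x) a)"
    unfolding dot_def by (intro continuous_intros dp_continuous v_order) auto
  then have [measurable]: "(\<lambda>x. indicator (U n) x *\<^sub>R dot (K n) (\<lambda>k. dp n v k x) a) \<in> borel_measurable borel"
    by (intro borel_measurable_continuous_on_indicator U_sets)
  have eq: "(\<lambda>x. ennreal ((dot (K n) (\<lambda>k. dp n v k x) a)\<^sup>2) * indicator (U n) x) =
    (\<lambda>x. ennreal ((indicator (U n) x *\<^sub>R dot (K n) (\<lambda>k. dp n v k x) a)\<^sup>2))"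
    by (auto simp: indicator_def)
  show ?thesis unfolding eq by measurable
qed

text \<open>\<open>f\<close> is split into the combination g of basis derivatives and a remainder of
  size \<open>e\<close>, with f^2 \<le> 2 g^2 + 2 (f - g)^2. The density is bounded by
  \<open>Cf\<close> in the first term and integrates to one in the second.\<close>

lemma weighted_L2_error:
  fixes a :: "nat \<Rightarrow> real" and f :: "real^'d \<Rightarrow> real" and e Cf D :: real
  assumes f: "\<And>x. x \<in> Xs \<Longrightarrow> \<bar>f x - dot (K n) (\<lambda>k. dp n v k x) a\<bar> \<le> e"
    and fX: "0 \<le> Cf" "\<And>x. x \<in> Xs \<Longrightarrow> fX x \<le> Cf"
    and D: "0 \<le> D" "(\<integral>\<^sup>+x\<in>U n. ennreal ((dot (K n) (\<lambda>k. dp n v k x) a)\<^sup>2) \<partial>lborel) \<le> ennreal D"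
  shows "(\<integral>\<^sup>+x\<in>Xs. ennreal ((f x)\<^sup>2 * fX x) \<partial>lborel) \<le> ennreal (2 * Cf * D + 2 * e\<^sup>2)"
proof -
  note [measurable] = dp_combination_measurable[of n a]
  let ?g = "\<lambda>x. ennreal ((dot (K n) (\<lambda>k. dp n v k x) a)\<^sup>2) * indicator (U n) x"
  have "(\<integral>\<^sup>+x\<in>Xs. ennreal ((f x)\<^sup>2 * fX x) \<partial>lborel) \<le>
    (\<integral>\<^sup>+x. ennreal (2 * Cf) * ?g x + ennreal (2 * e\<^sup>2) * ennreal (fX x) \<partial>lborel)"
  proof (rule nn_integral_mono_AE)
    show "AE x in lborel. ennreal ((f x)\<^sup>2 * fX x) * indicator Xs x \<le>
      ennreal (2 * Cf) * ?g x + ennreal (2 * e\<^sup>2) * ennreal (fX x)"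
      using AE_U[of n]
    proof eventually_elim
      case (elim x)
      show ?case
      proof (cases "x \<in> Xs")
        case True
        with elim have x: "x \<in> U n" by blast
        let ?d = "dot (K n) (\<lambda>k. dp n v k x) a"
        have e2: "(f x - ?d)\<^sup>2 \<le> e\<^sup>2" using power_mono[OF f[OF True] abs_ge_zero, of 2] by simp
        have "(f x)\<^sup>2 \<le> 2 * ?d\<^sup>2 + 2 * (f x - ?d)\<^sup>2"
          using zero_le_power2[of "f x - 2 * ?d"] by (simp add: power2_eq_square algebra_simps)
        also have "\<dots> \<le> 2 * ?d\<^sup>2 + 2 * e\<^sup>2" using e2 by simp
        finally have "(f x)\<^sup>2 * fX x \<le> (2 * ?d\<^sup>2 + 2 * e\<^sup>2) * fX x" by (rule mult_right_mono[OF _ fX_nonneg])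
        also have "\<dots> = 2 * ?d\<^sup>2 * fX x + 2 * e\<^sup>2 * fX x" by (simp add: algebra_simps)
        also have "\<dots> \<le> 2 * ?d\<^sup>2 * Cf + 2 * e\<^sup>2 * fX x"
          using fX(2)[OF True] by (intro add_right_mono mult_left_mono) auto
        also have "\<dots> = 2 * Cf * ?d\<^sup>2 + 2 * e\<^sup>2 * fX x" by simp
        finally have "ennreal ((f x)\<^sup>2 * fX x) \<le> ennreal (2 * Cf * ?d\<^sup>2 + 2 * e\<^sup>2 * fX x)" by (rule ennreal_leI)
        also have "\<dots> = ennreal (2 * Cf * ?d\<^sup>2) + ennreal (2 * e\<^sup>2 * fX x)"
          using fX(1) fX_nonneg by (intro ennreal_plus) auto
        also have "ennreal (2 * Cf * ?d\<^sup>2) = ennreal (2 * Cf) * ennreal (?d\<^sup>2)"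
          using fX(1) by (intro ennreal_mult) auto
        also have "ennreal (2 * e\<^sup>2 * fX x) = ennreal (2 * e\<^sup>2) * ennreal (fX x)"
          using fX_nonneg by (intro ennreal_mult) auto
        finally show ?thesis using x True by simp
      qed simp
    qed
  qed
  also have "\<dots> = ennreal (2 * Cf) * (\<integral>\<^sup>+x. ?g x \<partial>lborel) + ennreal (2 * e\<^sup>2) * (\<integral>\<^sup>+x. ennreal (fX x) \<partial>lborel)"
    by (subst nn_integral_add) (auto simp: nn_integral_cmult)
  also have "\<dots> \<le> ennreal (2 * Cf) * ennreal D + ennreal (2 * e\<^sup>2) * 1"
    unfolding fX_integral by (intro add_mono mult_left_mono D(2)) auto
  also have "ennreal (2 * Cf) * ennreal D = ennreal (2 * Cf * D)"
    using fX(1) D(1) by (intro ennreal_mult[symmetric]) auto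
  also have "ennreal (2 * Cf * D) + ennreal (2 * e\<^sup>2) * 1 = ennreal (2 * Cf * D + 2 * e\<^sup>2)"
    using fX(1) D(1) unfolding mult_1_right by (intro ennreal_plus[symmetric]) auto
  finally show ?thesis .
qed

text \<open>The error of the derivative is the combination of basis derivatives with coefficients
  betahat - beta0, minus an approximation error of order h^(m - |v|). In the sup norm the first part
  costs h^(-|v|) by Cauchy-Schwarz; in mean square \<open>derivative_L2\<close> gains a factor h^d.
  The approximation error is of smaller order in both cases: its size is h^m times the sup norm
  rate, and its square is h^(2m - d) times the mean square rate.\<close>

lemma consistency_conclusions:
  fixes beta0 :: "nat \<Rightarrow> real \<Rightarrow> nat \<Rightarrow> real" and betahat :: "nat \<Rightarrow> real \<Rightarrow> 'w \<Rightarrow> nat \<Rightarrow> real"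
    and dmuv :: "real^'d \<Rightarrow> real \<Rightarrow> real" and Ca Cf :: real
  assumes cons: "\<And>\<epsilon> t. 0 < \<epsilon> \<Longrightarrow> 0 < t \<Longrightarrow> \<forall>\<^sub>F n in sequentially. \<exists>S\<in>sets M. emeasure M S \<le> ennreal t \<and>
    (\<forall>\<omega>\<in>space M - S. \<forall>q\<in>Qs. eucl_norm (K n) (\<lambda>k. betahat n q \<omega> k - beta0 n q k) \<le> \<epsilon>)"
    and h0: "h \<longlonglongrightarrow> 0" and smooth: "CARD('d) < 2 * m"
    and approx: "\<forall>\<^sub>F n in sequentially. \<forall>q\<in>Qs. \<forall>x\<in>Xs.
      \<bar>dmuv x q - dot (K n) (beta0 n q) (\<lambda>k. dp n v k x)\<bar> \<le> Ca * h n powi (int m - int (mi_order v))"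
    and fX: "0 < Cf" "\<And>x. x \<in> Xs \<Longrightarrow> fX x \<le> Cf"
  shows "small_oP M (\<lambda>n \<omega>. SUP q\<in>Qs. ennreal (eucl_norm (K n) (\<lambda>k. betahat n q \<omega> k - beta0 n q k)))
        (\<lambda>_. 1)"
    and "small_oP M
        (\<lambda>n \<omega>. SUP x\<in>Xs. SUP q\<in>Qs. ennreal \<bar>mu_hat K dp betahat v n \<omega> x q - dmuv x q\<bar>)
        (\<lambda>n. h n powi (- int (mi_order v)))"
    and "small_oP M
        (\<lambda>n \<omega>. SUP q\<in>Qs. \<integral>\<^sup>+x\<in>Xs.
           ennreal ((mu_hat K dp betahat v n \<omega> x q - dmuv x q)\<^sup>2 * fX x) \<partial>lborel)
        (\<lambda>n. h n powi (int CARD('d) - 2 * int (mi_order v)))"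
proof -
  have hp: "0 < h n" "h n \<noteq> 0" for n using mesh_pos[of n] by auto
  have hpow: "(\<lambda>n. b * h n ^ j) \<longlonglongrightarrow> 0" if "0 < j" for b j
    using tendsto_power[OF h0, of j] that by (intro tendsto_mult_right_zero) (simp add: zero_power)
  have m0: "0 < m" using smooth by (cases m) auto
  have hm: "h n powi (int m - int (mi_order v)) = h n ^ m * h n powi (- int (mi_order v))" for n
    using power_int_add[OF disjI1[OF hp(2)], of n "int m" "- int (mi_order v)"] by simp
  have split: "mu_hat K dp betahat v n \<omega> x q - dmuv x q =
      dot (K n) (\<lambda>k. dp n v k x) (\<lambda>k. betahat n q \<omega> k - beta0 n q k)
      - (dmuv x q - dot (K n) (beta0 n q) (\<lambda>k. dp n v k x))" for n \<omega> x q
    unfolding mu_hat_def dot_diff_right[symmetric] by (simp add: dot_commute)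
  show "small_oP M (\<lambda>n \<omega>. SUP q\<in>Qs. ennreal (eucl_norm (K n) (\<lambda>k. betahat n q \<omega> k - beta0 n q k))) (\<lambda>_. 1)"
  proof (rule small_oPI)
    fix \<delta> t :: real assume "0 < \<delta>" "0 < t"
    from cons[OF this] show "\<forall>\<^sub>F n in sequentially. \<exists>S\<in>sets M. emeasure M S \<le> ennreal t \<and>
     (\<forall>\<omega>\<in>space M - S. (SUP q\<in>Qs. ennreal (eucl_norm (K n) (\<lambda>k. betahat n q \<omega> k - beta0 n q k))) \<le> ennreal (\<delta> * 1))"
    proof eventually_elim
      case (elim n)
      then obtain S where S: "S \<in> sets M" "emeasure M S \<le> ennreal t"
        "\<forall>\<omega>\<in>space M - S. \<forall>q\<in>Qs. eucl_norm (K n) (\<lambda>k. betahat n q \<omega> k - beta0 n q k) \<le> \<delta>" by (elim bexE conjE)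
      show ?case using S by (intro bexI[of _ S] conjI ballI SUP_least ennreal_leI) auto
    qed
  qed
  obtain C where C: "C > 0" "\<forall>\<^sub>F n in sequentially. \<forall>x\<in>Xs. eucl_norm (K n) (\<lambda>k. dp n v k x) \<le> C * h n powi (- int (mi_order v))"
    using dp_sup[OF v_order(1)] by (elim exE conjE)
  show "small_oP M
        (\<lambda>n \<omega>. SUP x\<in>Xs. SUP q\<in>Qs. ennreal \<bar>mu_hat K dp betahat v n \<omega> x q - dmuv x q\<bar>)
        (\<lambda>n. h n powi (- int (mi_order v)))"
  proof (rule small_oPI)
    fix \<delta> t :: real assume \<delta>: "0 < \<delta>" and t: "0 < t"
    have eps: "0 < \<delta> / (2 * C)" using \<delta> C(1) by simp
    have "\<forall>\<^sub>F n in sequentially. Ca * h n ^ m < \<delta> / 2"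
      using \<delta> by (intro order_tendstoD(2)[OF hpow[OF m0]]) simp
    with cons[OF eps t] C(2) approx
    show "\<forall>\<^sub>F n in sequentially. \<exists>S\<in>sets M. emeasure M S \<le> ennreal t \<and>
     (\<forall>\<omega>\<in>space M - S. (SUP x\<in>Xs. SUP q\<in>Qs. ennreal \<bar>mu_hat K dp betahat v n \<omega> x q - dmuv x q\<bar>)
        \<le> ennreal (\<delta> * h n powi (- int (mi_order v))))"
    proof eventually_elim
      case (elim n)
      then obtain S where S: "S \<in> sets M" "emeasure M S \<le> ennreal t"
        "\<forall>\<omega>\<in>space M - S. \<forall>q\<in>Qs. eucl_norm (K n) (\<lambda>k. betahat n q \<omega> k - beta0 n q k) \<le> \<delta> / (2 * C)" by (elim bexE conjE)
      show ?case
      proof (intro bexI[of _ S] conjI ballI SUP_least ennreal_leI S(1,2))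
        fix \<omega> x q assume h: "\<omega> \<in> space M - S" "x \<in> Xs" "q \<in> Qs"
        let ?v = "h n powi (- int (mi_order v))"
        have vp: "0 < ?v" using hp(1)[of n] by simp
        have "\<bar>dot (K n) (\<lambda>k. dp n v k x) (\<lambda>k. betahat n q \<omega> k - beta0 n q k)\<bar> \<le> C * ?v * (\<delta> / (2 * C))"
          using elim(2) S(3) h vp C(1) by (intro order.trans[OF abs_dot_le] mult_mono) auto
        also have "\<dots> = \<delta> / 2 * ?v" using C(1) by simp
        finally have 1: "\<bar>dot (K n) (\<lambda>k. dp n v k x) (\<lambda>k. betahat n q \<omega> k - beta0 n q k)\<bar> \<le> \<delta> / 2 * ?v" .
        have "\<bar>dmuv x q - dot (K n) (beta0 n q) (\<lambda>k. dp n v k x)\<bar> \<le> Ca * h n ^ m * ?v"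
          using elim(3) h unfolding hm by (auto simp: mult.assoc)
        also have "\<dots> \<le> \<delta> / 2 * ?v" using elim(4) vp by (intro mult_right_mono) auto
        finally have 2: "\<bar>dmuv x q - dot (K n) (beta0 n q) (\<lambda>k. dp n v k x)\<bar> \<le> \<delta> / 2 * ?v" .
        have "\<delta> / 2 * ?v + \<delta> / 2 * ?v = \<delta> * ?v" by simp
        with 1 2 show "\<bar>mu_hat K dp betahat v n \<omega> x q - dmuv x q\<bar> \<le> \<delta> * ?v" unfolding split by linarith
      qed
    qed
  qed
  obtain C3 where C3: "C3 > 0" "\<forall>\<^sub>F n in sequentially. \<forall>a. (\<integral>\<^sup>+x\<in>U n. ennreal ((dot (K n) (\<lambda>k. dp n v k x) a)\<^sup>2) \<partial>lborel)
      \<le> ennreal (C3 * h n powi (int CARD('d) - 2 * int (mi_order v)) * (eucl_norm (K n) a)\<^sup>2)"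
    using derivative_L2 by (elim exE conjE)
  show "small_oP M
        (\<lambda>n \<omega>. SUP q\<in>Qs. \<integral>\<^sup>+x\<in>Xs.
           ennreal ((mu_hat K dp betahat v n \<omega> x q - dmuv x q)\<^sup>2 * fX x) \<partial>lborel)
        (\<lambda>n. h n powi (int CARD('d) - 2 * int (mi_order v)))"
  proof (rule small_oPI)
    fix \<delta> t :: real assume \<delta>: "0 < \<delta>" and t: "0 < t"
    \<comment> \<open>Makes 2 Cf C3 \<epsilon>^2 equal to \<delta> / 2; the other half of \<delta>
      is left to the approximation error.\<close>
    define \<epsilon> where "\<epsilon> = sqrt (\<delta> / (4 * Cf * C3))"
    have eps: "0 < \<epsilon>" "\<epsilon>\<^sup>2 = \<delta> / (4 * Cf * C3)" unfolding \<epsilon>_def using \<delta> C3(1) fX(1) by auto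
    have "\<forall>\<^sub>F n in sequentially. (2 * Ca\<^sup>2) * h n ^ (2 * m - CARD('d)) < \<delta> / 2"
      using \<delta> smooth by (intro order_tendstoD(2)[OF hpow]) simp_all
    with cons[OF eps(1) t] C3(2) approx
    show "\<forall>\<^sub>F n in sequentially. \<exists>S\<in>sets M. emeasure M S \<le> ennreal t \<and>
     (\<forall>\<omega>\<in>space M - S. (SUP q\<in>Qs. \<integral>\<^sup>+x\<in>Xs. ennreal ((mu_hat K dp betahat v n \<omega> x q - dmuv x q)\<^sup>2 * fX x) \<partial>lborel)
        \<le> ennreal (\<delta> * h n powi (int CARD('d) - 2 * int (mi_order v))))"
    proof eventually_elim
      case (elim n)
      then obtain S where S: "S \<in> sets M" "emeasure M S \<le> ennreal t"
        "\<forall>\<omega>\<in>space M - S. \<forall>q\<in>Qs. eucl_norm (K n) (\<lambda>k. betahat n q \<omega> k - beta0 n q k) \<le> \<epsilon>" by (elim bexE conjE)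
      show ?case
      proof (intro bexI[of _ S] conjI ballI SUP_least S(1,2))
        fix \<omega> q assume w: "\<omega> \<in> space M - S" and q: "q \<in> Qs"
        let ?a = "\<lambda>k. betahat n q \<omega> k - beta0 n q k"
        let ?P = "h n powi (int CARD('d) - 2 * int (mi_order v))"
        let ?e = "Ca * h n powi (int m - int (mi_order v))"
        have Pp: "0 < ?P" using hp(1)[of n] by simp
        define D where "D = C3 * ?P * (eucl_norm (K n) ?a)\<^sup>2"
        have D0: "0 \<le> D" unfolding D_def using C3(1) Pp by simp
        have "(\<integral>\<^sup>+x\<in>Xs. ennreal ((mu_hat K dp betahat v n \<omega> x q - dmuv x q)\<^sup>2 * fX x) \<partial>lborel) \<le> ennreal (2 * Cf * D + 2 * ?e\<^sup>2)"
        proof (rule weighted_L2_error)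
          show "\<bar>mu_hat K dp betahat v n \<omega> x q - dmuv x q - dot (K n) (\<lambda>k. dp n v k x) ?a\<bar> \<le> ?e" if "x \<in> Xs" for x
          proof -
            have "\<bar>dmuv x q - dot (K n) (beta0 n q) (\<lambda>k. dp n v k x)\<bar> \<le> ?e" using elim(3) q that by blast
            then show ?thesis unfolding split by linarith
          qed
          show "(\<integral>\<^sup>+x\<in>U n. ennreal ((dot (K n) (\<lambda>k. dp n v k x) ?a)\<^sup>2) \<partial>lborel) \<le> ennreal D"
            unfolding D_def using elim(2) by blast
        qed (use fX D0 in auto)
        also have "\<dots> \<le> ennreal (\<delta> * ?P)"
        proof (rule ennreal_leI)
          have "(eucl_norm (K n) ?a)\<^sup>2 \<le> \<epsilon>\<^sup>2" using S(3) w q by (intro power_mono) auto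
          then have "D \<le> C3 * ?P * \<epsilon>\<^sup>2" unfolding D_def using C3(1) Pp by (intro mult_left_mono) auto
          then have "2 * Cf * D \<le> 2 * Cf * (C3 * ?P * \<epsilon>\<^sup>2)" using fX(1) by (intro mult_left_mono) auto
          also have "\<dots> = \<delta> / 2 * ?P" unfolding eps(2) using fX(1) C3(1) by (simp add: field_simps)
          finally have 1: "2 * Cf * D \<le> \<delta> / 2 * ?P" .
          have "(h n powi (int m - int (mi_order v)))\<^sup>2 = h n ^ (2 * m - CARD('d)) * ?P"
          proof -
            have "(h n powi (int m - int (mi_order v)))\<^sup>2 = h n powi (int (2 * m - CARD('d)) + (int CARD('d) - 2 * int (mi_order v)))"
              unfolding power2_eq_square power_int_add[OF disjI1[OF hp(2)], symmetric]
              using smooth by (intro arg_cong[where f="\<lambda>z. h n powi z"]) linarith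
            then show ?thesis unfolding power_int_add[OF disjI1[OF hp(2)]] by simp
          qed
          then have "2 * ?e\<^sup>2 = 2 * Ca\<^sup>2 * h n ^ (2 * m - CARD('d)) * ?P" by (simp add: power_mult_distrib)
          also have "\<dots> \<le> \<delta> / 2 * ?P" using elim(4) Pp by (intro mult_right_mono) auto
          finally have "2 * ?e\<^sup>2 \<le> \<delta> / 2 * ?P" .
          moreover have "\<delta> / 2 * ?P + \<delta> / 2 * ?P = \<delta> * ?P" by simp
          ultimately show "2 * Cf * D + 2 * ?e\<^sup>2 \<le> \<delta> * ?P" using 1 by linarith
        qed
        finally show "(\<integral>\<^sup>+x\<in>Xs. ennreal ((mu_hat K dp betahat v n \<omega> x q - dmuv x q)\<^sup>2 * fX x) \<partial>lborel) \<le> ennreal (\<delta> * ?P)" .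
      qed
    qed
  qed
qed

end

theorem lemma2:
  fixes M :: "'w measure"
    and Xs :: "(real^'d::finite) set" and Ys Es Qs :: "real set"
    and xs :: "nat \<Rightarrow> 'w \<Rightarrow> real^'d" and ys :: "nat \<Rightarrow> 'w \<Rightarrow> real"
    and N :: "real measure" and fX :: "real^'d \<Rightarrow> real" and fYX :: "real^'d \<Rightarrow> real \<Rightarrow> real"
    and rho psi :: "real \<Rightarrow> real \<Rightarrow> real \<Rightarrow> real" and psibar :: "real^'d \<Rightarrow> real \<Rightarrow> real"
    and eta :: "real \<Rightarrow> real"
    and mu0 :: "real^'d \<Rightarrow> real \<Rightarrow> real" and dmu0 :: "('d \<Rightarrow> nat) \<Rightarrow> real^'d \<Rightarrow> real \<Rightarrow> real"
    and \<Delta> :: "nat \<Rightarrow> (real^'d) set set" and K :: "nat \<Rightarrow> nat"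
    and p :: "nat \<Rightarrow> nat \<Rightarrow> real^'d \<Rightarrow> real"
    and dp :: "nat \<Rightarrow> ('d \<Rightarrow> nat) \<Rightarrow> nat \<Rightarrow> real^'d \<Rightarrow> real"
    and beta0 :: "nat \<Rightarrow> real \<Rightarrow> nat \<Rightarrow> real" and betahat :: "nat \<Rightarrow> real \<Rightarrow> 'w \<Rightarrow> nat \<Rightarrow> real"
    and Bs :: "nat \<Rightarrow> (nat \<Rightarrow> real) set" and v :: "'d \<Rightarrow> nat" and m sg :: nat
    and R \<alpha> \<nu> :: real and h :: "nat \<Rightarrow> real"
  defines "h \<equiv> (\<lambda>n. mesh (\<Delta> n))"
    and "Bs \<equiv> (\<lambda>n. {b. max_norm (K n) b \<le> R})"
  assumes partition: "\<And>n. polyhedral_partition Xs (\<Delta> n)"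
    and estimator: "m_estimator M Qs xs ys rho eta K p Bs betahat"
    and quasi_uniform: "quasi_uniform_partition \<Delta>"
    and basis: "local_basis Xs \<Delta> K p dp v m sg"
    and dgp: "data_generating_process M Xs Ys Qs xs ys N fX fYX rho eta mu0 dmu0 m"
    and loss: "loss_function Xs Ys Es Qs N fYX rho psi psibar eta mu0 \<alpha> \<nu>"
    and simplified: "simplified_setup Xs Ys Es Qs N fYX rho eta mu0 \<alpha> \<nu>"
    and approx: "approximation_error Xs Qs \<Delta> K dp dmu0 beta0 m sg"
    and R_pos: "R > 0"
    and R_bound: "\<And>n q. q \<in> Qs \<Longrightarrow> R \<ge> 2 * max_norm (K n) (beta0 n q)"
    and smooth: "real m > real CARD('d) / 2"
    and curvature: "\<exists>c>0. \<forall>n. \<forall>x\<in>Xs. \<forall>q\<in>Qs. \<forall>\<beta>\<in>Bs n.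
        \<forall>\<zeta>\<in>closed_segment (eta (dot (K n) (\<lambda>k. p n k x) \<beta>)) (eta (mu0 x q)).
          Psi_deriv 1 N fYX psi x \<zeta> q > c"
    and rate:
      "(\<lambda>n. ln (real n) powr (\<nu> / (\<nu> - 1))
              / (real n * h n powr (2 * \<nu> / (\<nu> - 1) * real CARD('d)))) \<in> o(\<lambda>_. 1) \<or>
       (\<lambda>n. ln (real n) powr (3 / 2) / (real n * h n ^ (2 * CARD('d)))) \<in> o(\<lambda>_. 1) \<and>
         cond_sub_gaussian N fYX Xs psibar"
  shows
    "small_oP M (\<lambda>n \<omega>. SUP q\<in>Qs. ennreal (eucl_norm (K n) (\<lambda>k. betahat n q \<omega> k - beta0 n q k)))
        (\<lambda>_. 1) \<and>
     small_oP M
        (\<lambda>n \<omega>. SUP x\<in>Xs. SUP q\<in>Qs. ennreal \<bar>mu_hat K dp betahat v n \<omega> x q - dmu0 v x q\<bar>)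
        (\<lambda>n. h n powi (- int (mi_order v))) \<and>
     small_oP M
        (\<lambda>n \<omega>. SUP q\<in>Qs. \<integral>\<^sup>+x\<in>Xs.
           ennreal ((mu_hat K dp betahat v n \<omega> x q - dmu0 v x q)\<^sup>2 * fX x) \<partial>lborel)
        (\<lambda>n. h n powi (int CARD('d) - 2 * int (mi_order v)))"
proof -
  have sample: "random_sample M Xs Ys xs ys N fX fYX"
    and domain: "\<exists>U. open U \<and> connected U \<and> bounded U \<and> Xs = closure U"
    and fX_nonneg: "\<forall>x. 0 \<le> fX x" and fX_outside: "\<forall>x. x \<notin> Xs \<longrightarrow> fX x = 0"
    and fX_cont: "continuous_on Xs fX" and fX_lower: "\<exists>c>0. \<forall>x\<in>Xs. c \<le> fX x"
    and N: "sigma_finite_measure N" "sets N = sets borel"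
    and fYX: "\<forall>x\<in>Xs. fYX x \<in> borel_measurable borel \<and> (\<forall>y. 0 \<le> fYX x y) \<and>
        (\<integral>\<^sup>+y. ennreal (fYX x y) \<partial>N) = 1 \<and> cond_support fYX x \<subseteq> Ys"
    and dmu0: "\<forall>q\<in>Qs. partials_upto m Xs (\<lambda>x. mu0 x q) (\<lambda>s x. dmu0 s x q)"
    and dmu0_bound: "\<forall>s. mi_order s \<le> m \<longrightarrow> (\<exists>C. \<forall>x\<in>Xs. \<forall>q\<in>Qs. \<bar>dmu0 s x q\<bar> \<le> C)"
    using dgp unfolding data_generating_process_def by - (elim conjE, assumption)+
  have zero_order: "mi_order (\<lambda>_::'d. 0) = 0" by (simp add: mi_order_def)
  have dmu0_zero: "dmu0 (\<lambda>_. 0) x q = mu0 x q" if "x \<in> Xs" "q \<in> Qs" for x q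
    using dmu0 that unfolding partials_upto_def by blast
  obtain B0 where B0: "\<And>x q. x \<in> Xs \<Longrightarrow> q \<in> Qs \<Longrightarrow> \<bar>mu0 x q\<bar> \<le> B0"
  proof -
    obtain C where C: "\<forall>x\<in>Xs. \<forall>q\<in>Qs. \<bar>dmu0 (\<lambda>_. 0) x q\<bar> \<le> C"
      using dmu0_bound[rule_format, of "\<lambda>_. 0"] zero_order by auto
    show thesis
    proof (rule that)
      show "\<bar>mu0 x q\<bar> \<le> C" if "x \<in> Xs" "q \<in> Qs" for x q
        using C that by (simp add: dmu0_zero)
    qed
  qed
  have bounded_Xs: "bounded Xs" and closed_Xs: "closed Xs" using domain by auto
  interpret series_estimation Xs Ys Es Qs N fYX rho psi psibar eta mu0 \<alpha> \<nu> B0 \<Delta> K p dp v m sg M xs ys fX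
    by (intro series_estimation.intro series_estimation_axioms.intro regular_loss.intro regular_basis.intro)
       ((fact loss simplified B0 N partition basis bounded_Xs sample fX_lower) | (use fYX fX_nonneg fX_outside in blast))+
  have h0: "(\<lambda>n. mesh (\<Delta> n)) \<longlonglongrightarrow> 0"
  proof -
    have "(\<lambda>n. mesh (\<Delta> n)) \<in> o(\<lambda>_. 1)" using quasi_uniform unfolding quasi_uniform_partition_def by (elim conjE)
    from smalloD_tendsto[OF this] show ?thesis by simp
  qed
  have R': "max_norm (K n) (beta0 n q) \<le> R" if "q \<in> Qs" for n q
    using R_bound[OF that, of n] max_norm_nonneg[of "K n" "beta0 n q"] by linarith
  have smooth': "CARD('d) < 2 * m" using smooth by linarith
  have approx_s: "\<exists>C. eventually (\<lambda>n. \<forall>q\<in>Qs. \<forall>x\<in>Xs.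
          \<bar>dmu0 s x q - dot (K n) (beta0 n q) (\<lambda>k. dp n s k x)\<bar>
            \<le> C * mesh (\<Delta> n) powi (int m - int (mi_order s))) sequentially" if "mi_order s \<le> sg" for s
    using approx that unfolding approximation_error_def by blast
  obtain Ca where "\<forall>\<^sub>F n in sequentially. \<forall>q\<in>Qs. \<forall>x\<in>Xs.
          \<bar>dmu0 (\<lambda>_. 0) x q - dot (K n) (beta0 n q) (\<lambda>k. dp n (\<lambda>_. 0) k x)\<bar>
            \<le> Ca * mesh (\<Delta> n) powi (int m - int (mi_order (\<lambda>_::'d. 0)))"
    using approx_s[of "\<lambda>_. 0"] zero_order by auto
  \<comment> \<open>At order zero \<open>dp\<close> agrees with \<open>p\<close> on all of
    \<open>Xs\<close>, including cell boundaries, so this case of the approximation condition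
    concerns \<open>spline\<close> itself.\<close>
  then have approx0: "\<forall>\<^sub>F n in sequentially. \<forall>q\<in>Qs. \<forall>x\<in>Xs. \<bar>mu0 x q - spline n (beta0 n q) x\<bar> \<le> Ca * mesh (\<Delta> n) ^ m"
  proof eventually_elim
    case (elim n)
    have "dot (K n) (beta0 n q) (\<lambda>k. dp n (\<lambda>_. 0) k x) = spline n (beta0 n q) x" if "x \<in> Xs" for x q
      unfolding spline_def dot_def using cellwise(1)[OF _ that] by (intro sum.cong) auto
    with elim show ?case by (auto simp: zero_order dmu0_zero)
  qed
  obtain c where c: "c > 0" and curv: "\<forall>n. \<forall>x\<in>Xs. \<forall>q\<in>Qs. \<forall>\<beta>\<in>Bs n.
        \<forall>\<zeta>\<in>closed_segment (eta (dot (K n) (\<lambda>k. p n k x) \<beta>)) (eta (mu0 x q)).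
          Psi_deriv 1 N fYX psi x \<zeta> q > c"
    using curvature by (elim exE conjE)
  have curv': "c \<le> Psi_deriv 1 N fYX psi x \<zeta> q"
    if "x \<in> Xs" "q \<in> Qs" "max_norm (K n) \<beta> \<le> R" "\<zeta> \<in> closed_segment (eta (spline n \<beta> x)) (eta (mu0 x q))" for n x q \<beta> \<zeta>
    using curv[rule_format, of x q \<beta> n \<zeta>] that unfolding Bs_def spline_def by simp
  have cons: "\<forall>\<^sub>F n in sequentially. \<exists>S\<in>sets M. emeasure M S \<le> ennreal t \<and>
    (\<forall>\<omega>\<in>space M - S. \<forall>q\<in>Qs. eucl_norm (K n) (\<lambda>k. betahat n q \<omega> k - beta0 n q k) \<le> \<epsilon>)"
    if "0 < \<epsilon>" "0 < t" for \<epsilon> t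
    by (rule uniform_consistency[where R=R and c=c and Ca=Ca])
       (fact h0 R_pos R' estimator[unfolded Bs_def] smooth' approx0 c curv' rate[unfolded h_def] that)+
  obtain Cv where Cv: "\<forall>\<^sub>F n in sequentially. \<forall>q\<in>Qs. \<forall>x\<in>Xs.
          \<bar>dmu0 v x q - dot (K n) (beta0 n q) (\<lambda>k. dp n v k x)\<bar>
            \<le> Cv * mesh (\<Delta> n) powi (int m - int (mi_order v))"
    using approx_s[OF v_order(1)] by (elim exE)
  \<comment> \<open>The integrated squared error requires an upper bound on the density, which
    continuity on the compact support supplies.\<close>
  have "compact Xs" using bounded_Xs closed_Xs by (simp add: compact_eq_bounded_closed)
  then have "bounded (fX ` Xs)" using fX_cont by (intro compact_imp_bounded compact_continuous_image)
  then obtain Cf where Cf: "Cf > 0" "\<And>x. x \<in> Xs \<Longrightarrow> fX x \<le> Cf"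
    unfolding bounded_pos by (force simp: abs_le_iff)
  show ?thesis
    unfolding h_def
    by (intro conjI consistency_conclusions[where Ca=Cv and Cf=Cf]) (fact cons h0 smooth' Cv Cf)+
qed

end
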